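(* Let $D$ be a Dedekind domain that is not a field, and let $S$ be a ring Morita equivalent to $D$. Then the following are equivalent: (i) $S$ is a right C4-ring; (ii) $S$ is a right C4$^*$-ring; (iii) $S$ is a strongly right C4$^*$-ring; (iv) $S\cong D$ as rings. Moreover, every ring Morita equivalent to $D$ is a right semi-weak-CS ring.
   Context: All rings are associative with identity and all modules are unitary right modules. A ring $S$ is a right C4-ring (respectively right C4$^*$-ring, strongly right C4$^*$-ring, right semi-weak-CS ring) if the regular module $S_S$ is C4 (respectively C4$^*$, strongly C4$^*$, semi-weak-CS). A module $M$ is a C4-module if, whenever $M=A\oplus B$ (internal direct sum) and $f:A\to B$ is a homomorphism such that $\ker f$ is a direct summand of $A$, the image $\operatorname{Im} f$ is a direct summand of $B$. A module is C4$^*$ if every submodule of it is a C4-module. For a module $M$, $\mathcal S(M)$ is the set of triples $(X,Y,\varphi)$ where $X,Y$ are semisimple direct summands of $M$ with $X\cap Y=0$ and $\varphi:X\to Y$ is an isomorphism. It is partially ordered by $(X,Y,\varphi)\preccurlyeq(X',Y',\varphi')$ iff $X\le X'$, $Y\le Y'$ and $\varphi'|_X=\varphi$. For a chain $\mathcal C\subseteq\mathcal S(M)$, put $X_{\mathcal C}=\bigcup_{(X,Y,\varphi)\in\mathcal C}X$ and $Y_{\mathcal C}=\bigcup_{(X,Y,\varphi)\in\mathcal C}Y$. The module $M$ is semi-weak-CS if for every chain $\mathcal C\subseteq\mathcal S(M)$ there are direct summands $A,B$ of $M$ such that $X_{\mathcal C}$ is an essential submodule of $A$ and $Y_{\mathcal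 C}$ is an essential submodule of $B$. A module is strongly C4$^*$ if it is both C4$^*$ and semi-weak-CS. *)

theory Defs
  imports "HOL-Algebra.Module" "HOL-Algebra.QuotRing" "HOL-Algebra.Ring_Divisibility" "HOL-Library.Equipollence"
begin

section \<open>Dedekind domains\<close>

text \<open>
  Integral closedness in the field of fractions, with denominators cleared: a fraction \<open>a / b\<close>
  is a root of the monic polynomial \<open>x ^ n + (\<Sum>i<n. c i * x ^ i)\<close> iff
  \<open>a ^ n + (\<Sum>i<n. c i * a ^ i * b ^ (n - i)) = 0\<close>, and it lies in the domain iff \<open>b\<close>
  divides \<open>a\<close>. For \<open>n = 0\<close> the equation reads \<open>1 = 0\<close>.
\<close>

definition integrally_closed :: "('a, 'x) ring_scheme \<Rightarrow> bool" where
  "integrally_closed R \<longleftrightarrow>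
    (\<forall>a \<in> carrier R. \<forall>b \<in> carrier R - {\<zero>\<^bsub>R\<^esub>}. \<forall>n :: nat. \<forall>c \<in> {..<n} \<rightarrow> carrier R.
      a [^]\<^bsub>R\<^esub> n \<oplus>\<^bsub>R\<^esub> (\<Oplus>\<^bsub>R\<^esub>i\<in>{..<n}. c i \<otimes>\<^bsub>R\<^esub> a [^]\<^bsub>R\<^esub> i \<otimes>\<^bsub>R\<^esub> b [^]\<^bsub>R\<^esub> (n - i)) = \<zero>\<^bsub>R\<^esub>
      \<longrightarrow> b divides\<^bsub>R\<^esub> a)"

text \<open>Fields are included.\<close>

locale dedekind_domain = noetherian_domain +
  assumes integrally_closed: "integrally_closed R"
    and nonzero_prime_maximal: "\<lbrakk>primeideal P R; P \<noteq> {\<zero>}\<rbrakk> \<Longrightarrow> maximalideal P R"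


section \<open>Right modules\<close>

text \<open>
  The library locale \<^locale>\<open>module\<close> is restricted to commutative rings; its record and the locale
  \<^locale>\<open>submodule\<close> are not. The scalar product \<open>a \<odot> x\<close> of the record is read as \<open>x\<close> times \<open>a\<close>,
  the ring acting from the right. The multiplicative components of the record play no role.
\<close>

locale right_module = R?: ring R + M?: abelian_group M
  for R :: "('a, 'x) ring_scheme" (structure) and M :: "('a, 'b, 'y) module_scheme" (structure) +
  assumes smult_closed: "\<lbrakk>a \<in> carrier R; x \<in> carrier M\<rbrakk> \<Longrightarrow> a \<odot>\<^bsub>M\<^esub> x \<in> carrier M"
    and smult_distr_ring: "\<lbrakk>a \<in> carrier R; b \<in> carrier R; x \<in> carrier M\<rbrakk> \<Longrightarrow>
      (a \<oplus>\<^bsub>R\<^esub> b) \<odot>\<^bsub>M\<^esub> x = a \<odot>\<^bsub>M\<^esub> x \<oplus>\<^bsub>M\<^esub> b \<odot>\<^bsub>M\<^esub> x"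
    and smult_distr_module: "\<lbrakk>a \<in> carrier R; x \<in> carrier M; y \<in> carrier M\<rbrakk> \<Longrightarrow>
      a \<odot>\<^bsub>M\<^esub> (x \<oplus>\<^bsub>M\<^esub> y) = a \<odot>\<^bsub>M\<^esub> x \<oplus>\<^bsub>M\<^esub> a \<odot>\<^bsub>M\<^esub> y"
    and smult_assoc: "\<lbrakk>a \<in> carrier R; b \<in> carrier R; x \<in> carrier M\<rbrakk> \<Longrightarrow>
      (a \<otimes>\<^bsub>R\<^esub> b) \<odot>\<^bsub>M\<^esub> x = b \<odot>\<^bsub>M\<^esub> (a \<odot>\<^bsub>M\<^esub> x)"
    and smult_one: "x \<in> carrier M \<Longrightarrow> \<one>\<^bsub>R\<^esub> \<odot>\<^bsub>M\<^esub> x = x"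

definition regular_right_module :: "('a, 'x) ring_scheme \<Rightarrow> ('a, 'a) module" where
  "regular_right_module R =
    \<lparr>carrier = carrier R, monoid.mult = monoid.mult R, one = \<one>\<^bsub>R\<^esub>,
     ring.zero = \<zero>\<^bsub>R\<^esub>, ring.add = ring.add R, smult = (\<lambda>a x. x \<otimes>\<^bsub>R\<^esub> a)\<rparr>"

text \<open>Homomorphisms are extensional, so that they are equal iff they agree on the domain.\<close>

definition rmod_hom ::
  "('a, 'x) ring_scheme \<Rightarrow> ('a, 'b, 'y) module_scheme \<Rightarrow> ('a, 'c, 'z) module_scheme \<Rightarrow> ('b \<Rightarrow> 'c) set"
where
  "rmod_hom R M N = {f \<in> carrier M \<rightarrow>\<^sub>E carrier N.
    (\<forall>x \<in> carrier M. \<forall>y \<in> carrier M. f (x \<oplus>\<^bsub>M\<^esub> y) = f x \<oplus>\<^bsub>N\<^esub> f y) \<and>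
    (\<forall>a \<in> carrier R. \<forall>x \<in> carrier M. f (a \<odot>\<^bsub>M\<^esub> x) = a \<odot>\<^bsub>N\<^esub> f x)}"

definition rmod_iso ::
  "('a, 'x) ring_scheme \<Rightarrow> ('a, 'b, 'y) module_scheme \<Rightarrow> ('a, 'c, 'z) module_scheme \<Rightarrow> ('b \<Rightarrow> 'c) set"
where
  "rmod_iso R M N = {f \<in> rmod_hom R M N. bij_betw f (carrier M) (carrier N)}"

definition internal_direct_sum ::
  "('a, 'x) ring_scheme \<Rightarrow> ('a, 'b, 'y) module_scheme \<Rightarrow> 'b set \<Rightarrow> 'b set \<Rightarrow> bool"
where
  "internal_direct_sum R M A B \<longleftrightarrow> submodule A R M \<and> submodule B R M \<and>
    A \<inter> B = {\<zero>\<^bsub>M\<^esub>} \<and> A <+>\<^bsub>M\<^esub> B = carrier M"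

definition direct_summand ::
  "('a, 'x) ring_scheme \<Rightarrow> ('a, 'b, 'y) module_scheme \<Rightarrow> 'b set \<Rightarrow> bool"
where
  "direct_summand R M A \<longleftrightarrow> (\<exists>B. internal_direct_sum R M A B)"

definition semisimple_module :: "('a, 'x) ring_scheme \<Rightarrow> ('a, 'b, 'y) module_scheme \<Rightarrow> bool" where
  "semisimple_module R M \<longleftrightarrow> (\<forall>N. submodule N R M \<longrightarrow> direct_summand R M N)"

text \<open>\<open>essential_in R M X A\<close>: \<open>X\<close> is an essential submodule of the submodule \<open>A\<close> of \<open>M\<close>.\<close>

definition essential_in ::
  "('a, 'x) ring_scheme \<Rightarrow> ('a, 'b, 'y) module_scheme \<Rightarrow> 'b set \<Rightarrow> 'b set \<Rightarrow> bool"
where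
  "essential_in R M X A \<longleftrightarrow> submodule X R (M\<lparr>carrier := A\<rparr>) \<and>
    (\<forall>N. submodule N R (M\<lparr>carrier := A\<rparr>) \<longrightarrow> N \<inter> X = {\<zero>\<^bsub>M\<^esub>} \<longrightarrow> N = {\<zero>\<^bsub>M\<^esub>})"


section \<open>C4-modules and semi-weak-CS modules\<close>

definition C4_module :: "('a, 'x) ring_scheme \<Rightarrow> ('a, 'b, 'y) module_scheme \<Rightarrow> bool" where
  "C4_module R M \<longleftrightarrow>
    (\<forall>A B f. internal_direct_sum R M A B \<longrightarrow>
      f \<in> rmod_hom R (M\<lparr>carrier := A\<rparr>) (M\<lparr>carrier := B\<rparr>) \<longrightarrow>
      direct_summand R (M\<lparr>carrier := A\<rparr>) (a_kernel (M\<lparr>carrier := A\<rparr>) (M\<lparr>carrier := B\<rparr>) f) \<longrightarrow>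
      direct_summand R (M\<lparr>carrier := B\<rparr>) (f ` A))"

definition C4_star_module :: "('a, 'x) ring_scheme \<Rightarrow> ('a, 'b, 'y) module_scheme \<Rightarrow> bool" where
  "C4_star_module R M \<longleftrightarrow> (\<forall>N. submodule N R M \<longrightarrow> C4_module R (M\<lparr>carrier := N\<rparr>))"

definition semisimple_triples ::
  "('a, 'x) ring_scheme \<Rightarrow> ('a, 'b, 'y) module_scheme \<Rightarrow> ('b set \<times> 'b set \<times> ('b \<Rightarrow> 'b)) set"
where
  "semisimple_triples R M = {(X, Y, \<phi>).
    direct_summand R M X \<and> semisimple_module R (M\<lparr>carrier := X\<rparr>) \<and>
    direct_summand R M Y \<and> semisimple_module R (M\<lparr>carrier := Y\<rparr>) \<and>
    X \<inter> Y = {\<zero>\<^bsub>M\<^esub>} \<and> \<phi> \<in> rmod_iso R (M\<lparr>carrier := X\<rparr>) (M\<lparr>carrier := Y\<rparr>)}"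

definition triple_le ::
  "'b set \<times> 'b set \<times> ('b \<Rightarrow> 'b) \<Rightarrow> 'b set \<times> 'b set \<times> ('b \<Rightarrow> 'b) \<Rightarrow> bool"
where
  "triple_le = (\<lambda>(X, Y, \<phi>) (X', Y', \<phi>'). X \<subseteq> X' \<and> Y \<subseteq> Y' \<and> (\<forall>x \<in> X. \<phi>' x = \<phi> x))"

text \<open>
  Adjoining zero to the unions only matters for the empty chain, whose union is the zero submodule.
\<close>

definition chain_dom ::
  "('a, 'b, 'y) module_scheme \<Rightarrow> ('b set \<times> 'b set \<times> ('b \<Rightarrow> 'b)) set \<Rightarrow> 'b set"
where
  "chain_dom M C = insert \<zero>\<^bsub>M\<^esub> (\<Union>(X, Y, \<phi>) \<in> C. X)"

definition chain_cod ::
  "('a, 'b, 'y) module_scheme \<Rightarrow> ('b set \<times> 'b set \<times> ('b \<Rightarrow> 'b)) set \<Rightarrow> 'b set"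
where
  "chain_cod M C = insert \<zero>\<^bsub>M\<^esub> (\<Union>(X, Y, \<phi>) \<in> C. Y)"

definition semi_weak_CS_module :: "('a, 'x) ring_scheme \<Rightarrow> ('a, 'b, 'y) module_scheme \<Rightarrow> bool" where
  "semi_weak_CS_module R M \<longleftrightarrow>
    (\<forall>C. C \<subseteq> semisimple_triples R M \<longrightarrow> Complete_Partial_Order.chain triple_le C \<longrightarrow>
      (\<exists>A B. direct_summand R M A \<and> direct_summand R M B \<and>
        essential_in R M (chain_dom M C) A \<and> essential_in R M (chain_cod M C) B))"

definition strongly_C4_star_module :: "('a, 'x) ring_scheme \<Rightarrow> ('a, 'b, 'y) module_scheme \<Rightarrow> bool" where
  "strongly_C4_star_module R M \<longleftrightarrow> C4_star_module R M \<and> semi_weak_CS_module R M"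

definition right_C4_ring :: "('a, 'x) ring_scheme \<Rightarrow> bool" where
  "right_C4_ring S \<longleftrightarrow> C4_module S (regular_right_module S)"

definition right_C4_star_ring :: "('a, 'x) ring_scheme \<Rightarrow> bool" where
  "right_C4_star_ring S \<longleftrightarrow> C4_star_module S (regular_right_module S)"

definition strongly_right_C4_star_ring :: "('a, 'x) ring_scheme \<Rightarrow> bool" where
  "strongly_right_C4_star_ring S \<longleftrightarrow> strongly_C4_star_module S (regular_right_module S)"

definition right_semi_weak_CS_ring :: "('a, 'x) ring_scheme \<Rightarrow> bool" where
  "right_semi_weak_CS_ring S \<longleftrightarrow> semi_weak_CS_module S (regular_right_module S)"


section \<open>Morita equivalence\<close>

text \<open>
  The objects of the category of right modules over \<open>R\<close> are the right \<open>R\<close>-modules whose elements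
  have type \<open>'u\<close>, which serves as the universe. A functor is given by its action \<open>F\<close> on objects and
  its action \<open>f\<close> on morphisms, where \<open>f M N\<close> acts on the homomorphisms from \<open>M\<close> to \<open>N\<close>.
\<close>

type_synonym ('a, 'u, 'b) rmod_objmap = "('a, 'u) module \<Rightarrow> ('b, 'u) module"
type_synonym ('a, 'u) rmod_mormap =
  "('a, 'u) module \<Rightarrow> ('a, 'u) module \<Rightarrow> ('u \<Rightarrow> 'u) \<Rightarrow> 'u \<Rightarrow> 'u"

definition rmod_functor ::
  "('a, 'x) ring_scheme \<Rightarrow> ('b, 'y) ring_scheme \<Rightarrow>
   ('a, 'u, 'b) rmod_objmap \<Rightarrow> ('a, 'u) rmod_mormap \<Rightarrow> bool"
where
  "rmod_functor R S F f \<longleftrightarrow>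
    (\<forall>M. right_module R M \<longrightarrow> right_module S (F M)) \<and>
    (\<forall>M N. right_module R M \<longrightarrow> right_module R N \<longrightarrow>
      f M N \<in> rmod_hom R M N \<rightarrow> rmod_hom S (F M) (F N)) \<and>
    (\<forall>M. right_module R M \<longrightarrow>
      f M M (\<lambda>x \<in> carrier M. x) = (\<lambda>x \<in> carrier (F M). x)) \<and>
    (\<forall>L M N. right_module R L \<longrightarrow> right_module R M \<longrightarrow> right_module R N \<longrightarrow>
      (\<forall>h \<in> rmod_hom R L M. \<forall>g \<in> rmod_hom R M N.
        f L N (compose (carrier L) g h) = compose (carrier (F L)) (f M N g) (f L M h)))"

definition rmod_nat_iso ::
  "('a, 'x) ring_scheme \<Rightarrow> ('b, 'y) ring_scheme \<Rightarrow>
   ('a, 'u, 'b) rmod_objmap \<Rightarrow> ('a, 'u) rmod_mormap \<Rightarrow>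
   ('a, 'u, 'b) rmod_objmap \<Rightarrow> ('a, 'u) rmod_mormap \<Rightarrow>
   (('a, 'u) module \<Rightarrow> 'u \<Rightarrow> 'u) \<Rightarrow> bool"
where
  "rmod_nat_iso R S F f G g \<eta> \<longleftrightarrow>
    (\<forall>M. right_module R M \<longrightarrow> \<eta> M \<in> rmod_iso S (F M) (G M)) \<and>
    (\<forall>M N. right_module R M \<longrightarrow> right_module R N \<longrightarrow> (\<forall>h \<in> rmod_hom R M N.
      compose (carrier (F M)) (g M N h) (\<eta> M) = compose (carrier (F M)) (\<eta> N) (f M N h)))"

text \<open>
  Equivalence of the categories of right modules with elements in \<open>'u\<close>. If \<open>'u\<close> is infinite and at
  least as large as both rings, this is Morita equivalence: an equivalence of the full module
  categories is tensoring with a finitely generated projective bimodule and so restricts to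
  modules of cardinality at most that of \<open>'u\<close>; conversely, the image of the regular module under an
  equivalence of the restricted categories is a progenerator. For a smaller \<open>'u\<close> the notion is
  not meaningful.
\<close>

definition morita_equivalent ::
  "'u itself \<Rightarrow> ('a, 'x) ring_scheme \<Rightarrow> ('b, 'y) ring_scheme \<Rightarrow> bool"
where
  "morita_equivalent U R S \<longleftrightarrow>
    (\<exists>(F :: ('a, 'u, 'b) rmod_objmap) f (G :: ('b, 'u, 'a) rmod_objmap) g \<eta> \<epsilon>.
      rmod_functor R S F f \<and> rmod_functor S R G g \<and>
      rmod_nat_iso R R (\<lambda>M. M) (\<lambda>M N h. h) (\<lambda>M. G (F M)) (\<lambda>M N h. g (F M) (F N) (f M N h)) \<eta> \<and>
      rmod_nat_iso S S (\<lambda>M. F (G M)) (\<lambda>M N h. f (G M) (G N) (g M N h)) (\<lambda>M. M) (\<lambda>M N h. h) \<epsilon>)"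

end

theory Submission
  imports Defs "HOL-Algebra.Ideal_Product"
begin

text \<open>
  Let \<open>P\<close> be the image of the regular module of \<open>S\<close> under the equivalence. Then \<open>S\<close> is the
  endomorphism ring of \<open>P\<close>. The regular module of \<open>D\<close> is a generator, hence so is its preimage, and
  therefore the functionals \<open>P \<rightarrow> D\<close> separate points; in particular \<open>P\<close> is torsion-free. The rest
  uses only this and the invertibility of nonzero ideals of \<open>D\<close>.

  A nonzero semisimple right ideal of \<open>S\<close> would be divisible by every nonzero element of \<open>D\<close>, which
  the functionals exclude, so the chains in the semi-weak-CS condition are trivial.

  Let \<open>q\<close> be a nonzero functional. Its image is an invertible ideal, so \<open>q\<close> splits and
  \<open>P = A \<oplus> ker q\<close>. If \<open>q\<close> is injective, \<open>P\<close> is isomorphic to an ideal, whose endomorphisms are all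
  scalar, and \<open>S \<cong> D\<close>. Otherwise choose \<open>b \<noteq> 0\<close> in \<open>ker q\<close> and a nonzero nonunit \<open>d\<close>: the map
  \<open>p \<mapsto> b q(p) d\<close> from \<open>A\<close> to \<open>ker q\<close> is injective, and its image is not a direct summand, since it
  would then contain all \<open>b q(p)\<close> and the invertible ideal \<open>q(P)\<close> would be divisible by \<open>d\<close>. So the
  C4 condition fails. Conversely a nonzero submodule of a domain is indecomposable.
\<close>

section \<open>Invertibility of ideals in Dedekind domains\<close>

text \<open>Fractions are handled with denominators cleared: for a nonzero \<open>c\<close> in an
  ideal \<open>I\<close> the inverse of \<open>I\<close> appears as the ideal \<open>c I^-1\<close>
  of the ring, and invertibility reads \<open>c \<in> I (c I^-1)\<close>.

  The equivalence relates modules over one element type by functors that are not assumed additive.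
  To identify \<open>S\<close> with the endomorphisms of \<open>P\<close> as a ring, sums of
  morphisms are recovered from biproducts, which fit into the universe because it is infinite.

  Why functionals separate points: let \<open>U\<close> be the regular module of \<open>S\<close>
  and \<open>Q\<close> the preimage of that of \<open>D\<close>. A point \<open>p\<close> of
  \<open>P\<close> corresponds to a morphism \<open>k : Q \<rightarrow> U\<close>, and functionals
  on \<open>P\<close> correspond to morphisms \<open>x : U \<rightarrow> Q\<close>. If all of them
  vanish at \<open>p\<close>, then \<open>x k = 0\<close> for every \<open>x\<close>. For
  \<open>t : Q \<rightarrow> U\<close> and \<open>y\<close> in \<open>Q\<close>, the product of
  \<open>t y\<close> with \<open>k w\<close> is \<open>t (y (k w)) = 0\<close>, because
  \<open>u \<mapsto> y u\<close> is a morphism from \<open>U\<close> to \<open>Q\<close>. As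
  \<open>Q\<close> is a generator, the values \<open>t y\<close> generate \<open>S\<close> as a
  right ideal, so \<open>1\<close> annihilates the values of \<open>k\<close>, and
  \<open>p = 0\<close>.\<close>

lemma (in noetherian_ring) exists_maximal_ideal_in:
  assumes "\<C> \<noteq> {}" and "\<And>I. I \<in> \<C> \<Longrightarrow> ideal I R"
  shows "\<exists>M\<in>\<C>. \<forall>J\<in>\<C>. M \<subseteq> J \<longrightarrow> J = M"
proof (rule subset_Zorn_nonempty[OF assms(1)])
    fix C assume C: "C \<noteq> {}" "subset.chain \<C> C"
    have "subset.chain {I. ideal I R} C"
      using C(2) assms(2) unfolding subset.chain_def by auto
    \<comment> \<open>The chain condition places the union of the chain in the chain itself, which
      makes Zorn's lemma applicable to an arbitrary family.\<close>
    then have "\<Union>C \<in> C"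
      using ideal_chain_is_trivial C(1) by blast
    with C(2) show "\<Union>C \<in> \<C>" unfolding subset.chain_def by auto
qed

lemma (in noetherian_ring) exists_maximalideal:
  assumes "ideal I R" "\<one> \<notin> I"
  obtains P where "maximalideal P R" "I \<subseteq> P"
proof -
  define \<J> where "\<J> = {J. ideal J R \<and> \<one> \<notin> J \<and> I \<subseteq> J}"
  have "\<J> \<noteq> {}" "\<And>J. J \<in> \<J> \<Longrightarrow> ideal J R" using assms by (auto simp: \<J>_def)
  then obtain P where "P \<in> \<J>" and max: "\<And>J. J \<in> \<J> \<Longrightarrow> P \<subseteq> J \<Longrightarrow> J = P"
    using exists_maximal_ideal_in[of \<J>] by blast
  then have P: "ideal P R" "\<one> \<notin> P" "I \<subseteq> P" by (auto simp: \<J>_def)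
  have "maximalideal P R"
  proof (rule maximalidealI)
    show "carrier R \<noteq> P" using P by auto
    fix J assume "ideal J R" "P \<subseteq> J" "J \<subseteq> carrier R"
    then show "J = P \<or> J = carrier R"
      using max[of J] P(3) ideal.one_imp_carrier[of J R] by (auto simp: \<J>_def)
  qed fact
  then show ?thesis using P(3) that by blast
qed

section \<open>Colon ideals and ideals spanned by a sequence\<close>

context cring
begin

lemma idealI_comm:
  assumes "I \<subseteq> carrier R" "\<zero> \<in> I"
    and "\<And>x y. x \<in> I \<Longrightarrow> y \<in> I \<Longrightarrow> x \<oplus> y \<in> I"
    and mult: "\<And>a x. a \<in> carrier R \<Longrightarrow> x \<in> I \<Longrightarrow> a \<otimes> x \<in> I"
  shows "ideal I R"
proof (rule idealI)
  show "ring R" by (rule ring_axioms)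
  show "subgroup I (add_monoid R)"
  proof (rule add.subgroupI)
    fix x assume x: "x \<in> I"
    then have "\<ominus> x = \<ominus> \<one> \<otimes> x" using assms(1) by (simp add: l_minus subsetD)
    then show "\<ominus> x \<in> I" using mult x by simp
  qed (use assms in auto)
  fix a x assume "a \<in> I" "x \<in> carrier R"
  then show "x \<otimes> a \<in> I" "a \<otimes> x \<in> I" using mult[of x a] m_comm[of a x] assms(1) by auto
qed

lemma divides_add:
  assumes "a \<in> carrier R" "a divides x" "a divides y"
  shows "a divides (x \<oplus> y)"
proof -
  obtain u v where "u \<in> carrier R" "x = a \<otimes> u" "v \<in> carrier R" "y = a \<otimes> v"
    using assms by (auto simp: factor_def)
  then show ?thesis using assms(1) by (intro dividesI[of "u \<oplus> v"]) (simp_all add: r_distr)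
qed

lemma divides_mult_left:
  assumes "a \<in> carrier R" "x \<in> carrier R" "a divides y"
  shows "a divides (x \<otimes> y)"
proof -
  obtain u where "u \<in> carrier R" "y = a \<otimes> u"
    using assms by (auto simp: factor_def)
  then show ?thesis using assms by (intro dividesI[of "x \<otimes> u"]) (simp_all add: m_lcomm)
qed

text \<open>For nonzero \<open>c\<close> in an ideal \<open>I\<close> of a domain this is the
  inverse fractional ideal of \<open>I\<close> scaled by \<open>c\<close>: a member \<open>y\<close>
  stands for the fraction \<open>y / c\<close>, which maps \<open>I\<close> into the ring. For
  \<open>I = {s}\<close> it is the ideal \<open>(c : s)\<close>.\<close>

definition colon :: "'a set \<Rightarrow> 'a \<Rightarrow> 'a set" where
  "colon I c = {y \<in> carrier R. \<forall>i \<in> I. c divides (i \<otimes> y)}"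

lemma colon_ideal:
  assumes c: "c \<in> carrier R" and I: "I \<subseteq> carrier R"
  shows "ideal (colon I c) R"
proof (rule idealI_comm)
  have "c divides (i \<otimes> \<zero>)" if "i \<in> I" for i
    using c subsetD[OF I that] by (simp add: divides_zero)
  then show "\<zero> \<in> colon I c" by (simp add: colon_def)
  fix x assume x: "x \<in> colon I c"
  show "x \<oplus> y \<in> colon I c" if y: "y \<in> colon I c" for y
  proof -
    have "c divides (i \<otimes> (x \<oplus> y))" if "i \<in> I" for i
      using divides_add[OF c, of "i \<otimes> x" "i \<otimes> y"] subsetD[OF I that] x y that
      by (simp add: colon_def r_distr)
    then show ?thesis using x y by (simp add: colon_def)
  qed
  show "a \<otimes> x \<in> colon I c" if a: "a \<in> carrier R" for a
  proof -
    have "c divides (i \<otimes> (a \<otimes> x))" if "i \<in> I" for i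
      using divides_mult_left[OF c a, of "i \<otimes> x"] subsetD[OF I that] x a that
      by (simp add: colon_def m_lcomm)
    then show ?thesis using x a by (simp add: colon_def)
  qed
qed (auto simp: colon_def)

text \<open>The coefficients are kept explicit because they become those of an integral
  equation.\<close>

definition lincombs :: "(nat \<Rightarrow> 'a) \<Rightarrow> nat \<Rightarrow> 'a set" where
  "lincombs y n = {(\<Oplus>i\<in>{..<n}. k i \<otimes> y i) | k. k \<in> {..<n} \<rightarrow> carrier R}"

lemma lincombs_ideal:
  assumes y: "\<And>i. y i \<in> carrier R"
  shows "ideal (lincombs y n) R"
proof (rule idealI_comm)
  show "lincombs y n \<subseteq> carrier R"
    using y by (auto simp: lincombs_def Pi_iff intro!: finsum_closed)
  have "(\<Oplus>i\<in>{..<n}. \<zero> \<otimes> y i) = \<zero>"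
    using y by (simp add: finsum_zero)
  then show "\<zero> \<in> lincombs y n"
    unfolding lincombs_def by (auto intro!: exI[of _ "\<lambda>_. \<zero>"])
  fix a b assume "a \<in> lincombs y n" "b \<in> lincombs y n"
  then obtain k l where k: "k \<in> {..<n} \<rightarrow> carrier R" "a = (\<Oplus>i\<in>{..<n}. k i \<otimes> y i)"
    and l: "l \<in> {..<n} \<rightarrow> carrier R" "b = (\<Oplus>i\<in>{..<n}. l i \<otimes> y i)"
    by (auto simp: lincombs_def)
  have "a \<oplus> b = (\<Oplus>i\<in>{..<n}. k i \<otimes> y i \<oplus> l i \<otimes> y i)"
    unfolding k l by (rule finsum_addf[symmetric]) (use k l y in auto)
  also have "\<dots> = (\<Oplus>i\<in>{..<n}. (k i \<oplus> l i) \<otimes> y i)"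
    by (rule finsum_cong') (use k l y in \<open>auto simp: l_distr Pi_iff\<close>)
  finally show "a \<oplus> b \<in> lincombs y n"
    using k l unfolding lincombs_def by (auto intro!: exI[of _ "\<lambda>i. k i \<oplus> l i"])
next
  fix r a assume r: "r \<in> carrier R" and "a \<in> lincombs y n"
  then obtain k where k: "k \<in> {..<n} \<rightarrow> carrier R" "a = (\<Oplus>i\<in>{..<n}. k i \<otimes> y i)"
    by (auto simp: lincombs_def)
  have "r \<otimes> a = (\<Oplus>i\<in>{..<n}. r \<otimes> (k i \<otimes> y i))"
    unfolding k by (rule finsum_rdistr) (use k y r in auto)
  also have "\<dots> = (\<Oplus>i\<in>{..<n}. (r \<otimes> k i) \<otimes> y i)"
    by (rule finsum_cong') (use k r y in \<open>auto simp: m_assoc Pi_iff\<close>)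
  finally show "r \<otimes> a \<in> lincombs y n"
    using k r unfolding lincombs_def by (auto intro!: exI[of _ "\<lambda>i. r \<otimes> k i"])
qed

lemma lincombs_Suc:
  assumes y: "\<And>i. y i \<in> carrier R"
  shows "lincombs y n \<subseteq> lincombs y (Suc n)" "y n \<in> lincombs y (Suc n)"
proof -
  have *: "(\<Oplus>i\<in>{..<Suc n}. (k(n := a)) i \<otimes> y i) = a \<otimes> y n \<oplus> (\<Oplus>i\<in>{..<n}. k i \<otimes> y i)"
    if "k \<in> {..<n} \<rightarrow> carrier R" "a \<in> carrier R" for k a
  proof -
    have "(\<Oplus>i\<in>{..<n}. (k(n := a)) i \<otimes> y i) = (\<Oplus>i\<in>{..<n}. k i \<otimes> y i)"
      by (rule finsum_cong') (use y that in \<open>auto simp: Pi_iff\<close>)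
    then show ?thesis
      using that y by (simp add: lessThan_Suc finsum_insert Pi_iff)
  qed
  show "lincombs y n \<subseteq> lincombs y (Suc n)"
  proof
    fix a assume "a \<in> lincombs y n"
    then obtain k where k: "k \<in> {..<n} \<rightarrow> carrier R" "a = (\<Oplus>i\<in>{..<n}. k i \<otimes> y i)"
      by (auto simp: lincombs_def)
    have "a = (\<Oplus>i\<in>{..<Suc n}. (k(n := \<zero>)) i \<otimes> y i)"
      using *[OF k(1), of \<zero>] k y by (simp add: finsum_closed Pi_iff)
    moreover have "k(n := \<zero>) \<in> {..<Suc n} \<rightarrow> carrier R" using k by (auto simp: Pi_iff less_Suc_eq)
    ultimately show "a \<in> lincombs y (Suc n)" unfolding lincombs_def by blast
  qed
  have "(\<Oplus>i\<in>{..<n}. \<zero> \<otimes> y i) = \<zero>"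
    using y by (simp add: finsum_zero)
  then have "y n = (\<Oplus>i\<in>{..<Suc n}. ((\<lambda>_. \<zero>)(n := \<one>)) i \<otimes> y i)"
    using *[of "\<lambda>_. \<zero>" \<one>] y by simp
  moreover have "(\<lambda>_. \<zero>)(n := \<one>) \<in> {..<Suc n} \<rightarrow> carrier R" by auto
  ultimately show "y n \<in> lincombs y (Suc n)" unfolding lincombs_def by blast
qed

end

text \<open>
  The fraction \<open>s / a\<close> maps the ideal \<open>J\<close> into itself. Iterating it on a nonzero element of \<open>J\<close>
  produces a sequence whose linear span becomes stationary, which yields an integral equation.
\<close>

lemma (in noetherian_domain) divides_if_stabilizes_ideal:
  assumes "integrally_closed R" and J: "ideal J R" and z: "z \<in> J" "z \<noteq> \<zero>"
    and s: "s \<in> carrier R" and a: "a \<in> carrier R" "a \<noteq> \<zero>"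
    and stable: "\<And>j. j \<in> J \<Longrightarrow> \<exists>j'\<in>J. s \<otimes> j = a \<otimes> j'"
  shows "a divides s"
proof -
  interpret J: ideal J R by (rule J)
  have zR: "z \<in> carrier R" using z J.Icarr by blast
  obtain g where g: "\<And>j. j \<in> J \<Longrightarrow> g j \<in> J \<and> s \<otimes> j = a \<otimes> g j"
    using stable by metis
  \<comment> \<open>\<open>g\<close> multiplies by the fraction \<open>s / a\<close>, so
    \<open>y n\<close> is \<open>(s / a) ^ n * z\<close>.\<close>
  define y where "y n = (g ^^ n) z" for n
  have y0: "y 0 = z" and yJ: "y n \<in> J" and ySuc: "a \<otimes> y (Suc n) = s \<otimes> y n" for n
  proof -
    show yJ: "y n \<in> J" for n unfolding y_def by (induction n) (use g z in auto)
    show "y 0 = z" by (simp add: y_def)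
    show "a \<otimes> y (Suc n) = s \<otimes> y n" for n using g[OF yJ[of n]] by (simp add: y_def)
  qed
  have yR: "y n \<in> carrier R" for n using yJ J.Icarr by blast
  \<comment> \<open>The surplus exponent \<open>m\<close> lets all terms of a linear relation share
    the factor \<open>a [^] n\<close>, which leaves \<open>a [^] (n - i)\<close> in term
    \<open>i\<close>.\<close>
  have pow: "a [^] (i + m) \<otimes> y i = a [^] m \<otimes> s [^] i \<otimes> z" for i m
  proof (induction i arbitrary: m)
    case 0
    then show ?case using y0 a yR by (simp add: z J.Icarr)
  next
    case (Suc i)
    have "a [^] (Suc i + m) \<otimes> y (Suc i) = a [^] (i + m) \<otimes> (a \<otimes> y (Suc i))"
      using a yR by (simp add: m_assoc)
    also have "\<dots> = s \<otimes> (a [^] (i + m) \<otimes> y i)"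
      using ySuc a s yR by (simp add: m_lcomm)
    also have "\<dots> = a [^] m \<otimes> s [^] Suc i \<otimes> z"
      unfolding Suc using a s z by (simp add: J.Icarr m_ac)
    finally show ?case .
  qed
  \<comment> \<open>The spans increase with \<open>n\<close>. A maximal one already contains the
    next iterate \<open>y n\<close>, and this relation is the integral equation.\<close>
  have "\<exists>M\<in>range (lincombs y). \<forall>L\<in>range (lincombs y). M \<subseteq> L \<longrightarrow> L = M"
    by (rule exists_maximal_ideal_in) (use lincombs_ideal[of y] yR in auto)
  then obtain n where "\<And>m. lincombs y n \<subseteq> lincombs y m \<Longrightarrow> lincombs y m = lincombs y n" by auto
  then have "y n \<in> lincombs y n"
    using lincombs_Suc[of y n] yR by blast
  then obtain k where k: "k \<in> {..<n} \<rightarrow> carrier R" "y n = (\<Oplus>i\<in>{..<n}. k i \<otimes> y i)"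
    by (auto simp: lincombs_def)
  define w where "w = (\<Oplus>i\<in>{..<n}. k i \<otimes> s [^] i \<otimes> a [^] (n - i))"
  have wR: "w \<in> carrier R" unfolding w_def using k s a by (auto intro!: finsum_closed)
  have "s [^] n \<otimes> z = a [^] n \<otimes> y n" using pow[of n 0] a s z by (simp add: J.Icarr)
  also have "\<dots> = (\<Oplus>i\<in>{..<n}. a [^] n \<otimes> (k i \<otimes> y i))"
    unfolding k(2) by (rule finsum_rdistr) (use k yR a in auto)
  also have "\<dots> = (\<Oplus>i\<in>{..<n}. (k i \<otimes> s [^] i \<otimes> a [^] (n - i)) \<otimes> z)"
  proof (rule finsum_cong')
    fix i assume i: "i \<in> {..<n}"
    then have ki: "k i \<in> carrier R" using k by auto
    have "a [^] n \<otimes> (k i \<otimes> y i) = k i \<otimes> (a [^] n \<otimes> y i)"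
      using ki yR a by (simp add: m_lcomm)
    also have "a [^] n \<otimes> y i = a [^] (n - i) \<otimes> s [^] i \<otimes> z"
      using pow[of i "n - i"] i by simp
    finally show "a [^] n \<otimes> (k i \<otimes> y i) = (k i \<otimes> s [^] i \<otimes> a [^] (n - i)) \<otimes> z"
      using ki a s z by (simp add: J.Icarr m_ac)
  qed (use k s a zR in auto)
  also have "\<dots> = w \<otimes> z"
    unfolding w_def by (rule finsum_ldistr[symmetric]) (use k s a zR in auto)
  finally have "s [^] n = w" using z wR s J.Icarr by (simp add: m_rcancel)
  \<comment> \<open>\<open>integrally_closed\<close> has the sum on the side of the power, hence the
    sign.\<close>
  moreover define k' where "k' i = \<ominus> k i" for i
  have k': "k' \<in> {..<n} \<rightarrow> carrier R" using k by (auto simp: k'_def Pi_iff)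
  have "(\<Oplus>i\<in>{..<n}. k' i \<otimes> s [^] i \<otimes> a [^] (n - i)) = \<ominus> \<one> \<otimes> w"
  proof -
    have "(\<Oplus>i\<in>{..<n}. k' i \<otimes> s [^] i \<otimes> a [^] (n - i)) =
        (\<Oplus>i\<in>{..<n}. \<ominus> \<one> \<otimes> (k i \<otimes> s [^] i \<otimes> a [^] (n - i)))"
      by (rule finsum_cong') (use k a s in \<open>auto simp: k'_def l_minus m_assoc Pi_iff\<close>)
    also have "\<dots> = \<ominus> \<one> \<otimes> w"
      unfolding w_def by (rule finsum_rdistr[symmetric]) (use k a s in auto)
    finally show ?thesis .
  qed
  ultimately have "s [^] n \<oplus> (\<Oplus>i\<in>{..<n}. k' i \<otimes> s [^] i \<otimes> a [^] (n - i)) = \<zero>"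
    using wR by (simp add: l_minus r_neg)
  then show ?thesis using assms(1)[unfolded integrally_closed_def, rule_format, of s a k' n] s a k'
    by blast
qed

text \<open>
  A maximal one among the ideals \<open>(c : s)\<close> contained in \<open>P\<close> is prime and contains \<open>c \<noteq> 0\<close>, so it is
  maximal and equals \<open>P\<close>.
\<close>

lemma (in dedekind_domain) maximalideal_eq_colon:
  assumes P: "maximalideal P R" and c: "c \<in> P" "c \<noteq> \<zero>"
  shows "\<exists>s\<in>carrier R. P = colon {s} c"
proof -
  interpret P: maximalideal P R by fact
  interpret P: primeideal P R by (rule maximalideal_prime[OF P])
  have cR: "c \<in> carrier R" using c P.Icarr by blast
  define \<C> where "\<C> = {colon {s} c | s. s \<in> carrier R \<and> colon {s} c \<subseteq> P}"
  \<comment> \<open>\<open>(c : 1)\<close> is the principal ideal of \<open>c\<close>, so the family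
    is nonempty.\<close>
  have "colon {\<one>} c \<subseteq> P"
    using c P.I_r_closed by (auto simp: colon_def factor_def)
  then have "\<C> \<noteq> {}" by (auto simp: \<C>_def)
  moreover have "ideal I R" if "I \<in> \<C>" for I
    using that colon_ideal[OF cR] by (auto simp: \<C>_def)
  ultimately obtain Q where Q: "Q \<in> \<C>" and max: "\<And>J. J \<in> \<C> \<Longrightarrow> Q \<subseteq> J \<Longrightarrow> J = Q"
    using exists_maximal_ideal_in[of \<C>] by blast
  then obtain s where s: "s \<in> carrier R" "Q = colon {s} c" "Q \<subseteq> P" by (auto simp: \<C>_def)
  have up: "colon {s} c \<subseteq> colon {s \<otimes> u} c" if "u \<in> carrier R" for u
  proof
    fix r assume "r \<in> colon {s} c"
    then have r: "r \<in> carrier R" "c divides (s \<otimes> r)" by (auto simp: colon_def)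
    have "s \<otimes> u \<otimes> r = u \<otimes> (s \<otimes> r)" using s that r by (simp add: m_ac)
    then show "r \<in> colon {s \<otimes> u} c"
      using r s that cR by (simp add: colon_def divides_mult_left)
  qed
  have idQ: "ideal Q R" unfolding s(2) by (rule colon_ideal) (use cR s in auto)
  have "primeideal Q R"
  proof (rule primeidealI)
    show "cring R" by (rule is_cring)
    show "ideal Q R" by fact
    show "carrier R \<noteq> Q" using s(3) P.I_notcarr P.a_subset by blast
    fix u v assume u: "u \<in> carrier R" and v: "v \<in> carrier R" and uv: "u \<otimes> v \<in> Q"
    show "u \<in> Q \<or> v \<in> Q"
    \<comment> \<open>Either \<open>(c : s u)\<close> stays inside \<open>P\<close>, or some
      \<open>w\<close> outside \<open>P\<close> gives \<open>(c : s w)\<close> inside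
      \<open>P\<close>. By maximality that ideal equals \<open>Q\<close>; the first contains
      \<open>v\<close>, the second \<open>u\<close>.\<close>
    proof (cases "colon {s \<otimes> u} c \<subseteq> P")
      case True
      then have "colon {s \<otimes> u} c = Q" using max[of "colon {s \<otimes> u} c"] up[OF u] s u
        by (auto simp: \<C>_def)
      moreover have "v \<in> colon {s \<otimes> u} c"
        using uv s u v by (auto simp: colon_def m_assoc)
      ultimately show ?thesis by blast
    next
      case False
      then obtain w where w: "w \<in> carrier R" "c divides (s \<otimes> u \<otimes> w)" "w \<notin> P"
        by (auto simp: colon_def)
      \<comment> \<open>\<open>w\<close> multiplies \<open>(c : s w)\<close> into
        \<open>Q \<subseteq> P\<close> and lies outside the prime ideal \<open>P\<close>.\<close>
      have "colon {s \<otimes> w} c \<subseteq> P"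
      proof
        fix r assume "r \<in> colon {s \<otimes> w} c"
        then have r: "r \<in> carrier R" "c divides (s \<otimes> (w \<otimes> r))"
          using s w by (auto simp: colon_def m_assoc)
        then have "w \<otimes> r \<in> Q" using s w by (auto simp: colon_def)
        then show "r \<in> P" using P.I_prime[of w r] w r s by blast
      qed
      then have "colon {s \<otimes> w} c = Q" using max[of "colon {s \<otimes> w} c"] up[OF w(1)] s w
        by (auto simp: \<C>_def)
      moreover have "u \<in> colon {s \<otimes> w} c"
        using w s u by (auto simp: colon_def m_ac)
      ultimately show ?thesis by blast
    qed
  qed
  moreover have "c \<in> Q"
    unfolding s(2) using cR s by (auto simp: colon_def intro: divides_mult_left)
  then have "Q \<noteq> {\<zero>}" using c by auto
  ultimately interpret Q: maximalideal Q R by (rule nonzero_prime_maximal)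
  have "P = Q" using Q.I_maximal[OF P.is_ideal s(3)] P.a_subset P.I_notcarr by auto
  then show ?thesis using s by blast
qed

text \<open>The hypothesis \<open>dvd\<close> says that the fraction \<open>s / c\<close> maps
  \<open>I I^-1\<close> into the ring. It then maps \<open>I^-1\<close>, and so its multiple
  \<open>colon I c\<close>, into itself, which is the input of
  \<open>divides_if_stabilizes_ideal\<close>.\<close>

lemma (in domain) colon_stable:
  assumes I: "I \<subseteq> carrier R" and c: "c \<in> I" "c \<noteq> \<zero>" and s: "s \<in> carrier R"
    and dvd: "\<And>t. t \<in> carrier R \<Longrightarrow> t \<otimes> c \<in> I \<cdot> colon I c \<Longrightarrow> c divides (s \<otimes> t)"
    and j: "j \<in> colon I c"
  shows "\<exists>j'\<in>colon I c. s \<otimes> j = c \<otimes> j'"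
proof -
  have cR: "c \<in> carrier R" using c I by blast
  have jR: "j \<in> carrier R" using j by (simp add: colon_def)
  have key: "\<exists>w\<in>carrier R. s \<otimes> j \<otimes> i = c \<otimes> c \<otimes> w" if i: "i \<in> I" for i
  proof -
    have iR: "i \<in> carrier R" using i I by blast
    obtain t where t: "t \<in> carrier R" "i \<otimes> j = c \<otimes> t"
      using i j by (auto simp: colon_def factor_def)
    have "t \<otimes> c = i \<otimes> j" using t cR m_comm by simp
    then have "t \<otimes> c \<in> I \<cdot> colon I c" using ideal_prod.prod[OF i j] by simp
    then obtain w where w: "w \<in> carrier R" "s \<otimes> t = c \<otimes> w"
      using dvd[OF t(1)] by (auto simp: factor_def)
    have "s \<otimes> j \<otimes> i = s \<otimes> (i \<otimes> j)" using s iR jR by (simp add: m_ac)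
    also have "\<dots> = c \<otimes> (s \<otimes> t)" using t s cR by (simp add: m_lcomm)
    finally show ?thesis using w cR by (auto simp: m_assoc)
  qed
  \<comment> \<open>The case \<open>i = c\<close> shows that \<open>(s / c) * j\<close> is a ring
    element \<open>w0\<close>; the other members of \<open>I\<close> then show that
    \<open>w0\<close> lies in the colon ideal again.\<close>
  obtain w0 where w0: "w0 \<in> carrier R" "s \<otimes> j \<otimes> c = c \<otimes> c \<otimes> w0" using key[OF c(1)] by blast
  have "s \<otimes> j \<otimes> c = c \<otimes> w0 \<otimes> c" using w0 cR by (simp add: m_ac)
  then have sj: "s \<otimes> j = c \<otimes> w0" using c(2) s jR cR w0 by (simp add: m_rcancel)
  have "c divides (i \<otimes> w0)" if i: "i \<in> I" for i
  proof -
    have iR: "i \<in> carrier R" using i I by blast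
    obtain w where w: "w \<in> carrier R" "s \<otimes> j \<otimes> i = c \<otimes> c \<otimes> w" using key[OF i] by blast
    have "c \<otimes> (i \<otimes> w0) = c \<otimes> (c \<otimes> w)"
      using w iR w0(1) cR unfolding sj by (simp add: m_ac)
    then have "i \<otimes> w0 = c \<otimes> w" using c(2) cR iR w w0 by (simp add: m_lcancel)
    then show ?thesis using w by auto
  qed
  then show ?thesis using w0 sj by (auto simp: colon_def)
qed

text \<open>Divided by \<open>c\<close>, this is \<open>1 \<in> I I^-1\<close>. Otherwise the ideal
  \<open>T = I I^-1\<close> lies in a maximal ideal \<open>(c : s)\<close>. Then
  \<open>s / c\<close> stabilises \<open>c I^-1\<close>, integral closedness makes \<open>c\<close>
  divide \<open>s\<close>, and \<open>(c : s)\<close> is the whole ring.\<close>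

lemma (in dedekind_domain) ideal_invertible:
  assumes I: "ideal I R" and c: "c \<in> I" "c \<noteq> \<zero>"
  shows "c \<in> I \<cdot> colon I c"
proof (rule ccontr)
  assume neg: "c \<notin> I \<cdot> colon I c"
  have IR: "I \<subseteq> carrier R" using ideal.Icarr[OF I] by blast
  have cR: "c \<in> carrier R" using c IR by blast
  have cJ: "ideal (colon I c) R" using colon_ideal cR IR by blast
  have IJ: "ideal (I \<cdot> colon I c) R" using ideal_prod_is_ideal I cJ by blast
  define T where "T = {r \<in> carrier R. r \<otimes> c \<in> I \<cdot> colon I c}"
  have "ideal T R"
  proof (rule idealI_comm)
    have "\<zero> \<in> I \<cdot> colon I c"
      using IJ by (simp add: additive_subgroup.zero_closed ideal.axioms(1))
    then show "T \<subseteq> carrier R" "\<zero> \<in> T" using cR by (auto simp: T_def)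
    show "x \<oplus> y \<in> T" if "x \<in> T" "y \<in> T" for x y
      using that cR ideal_prod.sum[of "x \<otimes> c" R I "colon I c" "y \<otimes> c"] by (simp add: T_def l_distr)
    show "a \<otimes> x \<in> T" if "a \<in> carrier R" "x \<in> T" for a x
      using that cR ideal.I_l_closed[OF IJ, of "x \<otimes> c" a] by (simp add: T_def m_assoc)
  qed
  moreover have "\<one> \<notin> T" using neg cR by (simp add: T_def)
  ultimately obtain P where P: "maximalideal P R" "T \<subseteq> P" by (rule exists_maximalideal)
  have "c divides (i \<otimes> c)" if "i \<in> I" for i
    using IR cR that by (intro dividesI[of i]) (auto simp: m_comm)
  then have cJc: "c \<in> colon I c" using cR by (simp add: colon_def)
  then have "c \<in> T" using cR ideal_prod.prod[OF c(1) cJc] by (simp add: T_def)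
  then have "c \<in> P" by (rule subsetD[OF P(2)])
  then obtain s where s: "s \<in> carrier R" "P = colon {s} c"
    using maximalideal_eq_colon[OF P(1) _ c(2)] by blast
  have "c divides s"
  proof (rule divides_if_stabilizes_ideal[OF integrally_closed cJ cJc c(2) s(1) cR c(2)])
    show "\<exists>j'\<in>colon I c. s \<otimes> j = c \<otimes> j'" if "j \<in> colon I c" for j
    proof (rule colon_stable[OF IR c s(1) _ that])
      show "c divides (s \<otimes> t)" if "t \<in> carrier R" "t \<otimes> c \<in> I \<cdot> colon I c" for t
        using that P(2) s by (auto simp: T_def colon_def)
    qed
  qed
  then have "\<one> \<in> P" using s by (simp add: colon_def)
  then show False
    using P(1) ideal.one_imp_carrier maximalideal.axioms(1) maximalideal.I_notcarr by metis
qed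

section \<open>Right modules and homomorphisms\<close>

lemma regular_right_module_simps [simp]:
  "carrier (regular_right_module R) = carrier R"
  "\<zero>\<^bsub>regular_right_module R\<^esub> = \<zero>\<^bsub>R\<^esub>"
  "x \<oplus>\<^bsub>regular_right_module R\<^esub> y = x \<oplus>\<^bsub>R\<^esub> y"
  "a \<odot>\<^bsub>regular_right_module R\<^esub> x = x \<otimes>\<^bsub>R\<^esub> a"
  by (simp_all add: regular_right_module_def)

lemma right_moduleI:
  assumes "ring R" "abelian_group M"
    and "\<And>a x. \<lbrakk>a \<in> carrier R; x \<in> carrier M\<rbrakk> \<Longrightarrow> a \<odot>\<^bsub>M\<^esub> x \<in> carrier M"
    and "\<And>a b x. \<lbrakk>a \<in> carrier R; b \<in> carrier R; x \<in> carrier M\<rbrakk> \<Longrightarrow>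
      (a \<oplus>\<^bsub>R\<^esub> b) \<odot>\<^bsub>M\<^esub> x = a \<odot>\<^bsub>M\<^esub> x \<oplus>\<^bsub>M\<^esub> b \<odot>\<^bsub>M\<^esub> x"
    and "\<And>a x y. \<lbrakk>a \<in> carrier R; x \<in> carrier M; y \<in> carrier M\<rbrakk> \<Longrightarrow>
      a \<odot>\<^bsub>M\<^esub> (x \<oplus>\<^bsub>M\<^esub> y) = a \<odot>\<^bsub>M\<^esub> x \<oplus>\<^bsub>M\<^esub> a \<odot>\<^bsub>M\<^esub> y"
    and "\<And>a b x. \<lbrakk>a \<in> carrier R; b \<in> carrier R; x \<in> carrier M\<rbrakk> \<Longrightarrow>
      (a \<otimes>\<^bsub>R\<^esub> b) \<odot>\<^bsub>M\<^esub> x = b \<odot>\<^bsub>M\<^esub> (a \<odot>\<^bsub>M\<^esub> x)"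
    and "\<And>x. x \<in> carrier M \<Longrightarrow> \<one>\<^bsub>R\<^esub> \<odot>\<^bsub>M\<^esub> x = x"
  shows "right_module R M"
  using assms by (simp add: right_module_def right_module_axioms_def)

lemma rmod_homI:
  assumes "f \<in> extensional (carrier M)"
    and "\<And>x. x \<in> carrier M \<Longrightarrow> f x \<in> carrier N"
    and "\<And>x y. \<lbrakk>x \<in> carrier M; y \<in> carrier M\<rbrakk> \<Longrightarrow> f (x \<oplus>\<^bsub>M\<^esub> y) = f x \<oplus>\<^bsub>N\<^esub> f y"
    and "\<And>a x. \<lbrakk>a \<in> carrier R; x \<in> carrier M\<rbrakk> \<Longrightarrow> f (a \<odot>\<^bsub>M\<^esub> x) = a \<odot>\<^bsub>N\<^esub> f x"
  shows "f \<in> rmod_hom R M N"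
  using assms by (auto simp: rmod_hom_def PiE_def)

lemma rmod_homD:
  assumes "f \<in> rmod_hom R M N"
  shows "f \<in> extensional (carrier M)"
    and "x \<in> carrier M \<Longrightarrow> f x \<in> carrier N"
    and "\<lbrakk>x \<in> carrier M; y \<in> carrier M\<rbrakk> \<Longrightarrow> f (x \<oplus>\<^bsub>M\<^esub> y) = f x \<oplus>\<^bsub>N\<^esub> f y"
    and "\<lbrakk>a \<in> carrier R; x \<in> carrier M\<rbrakk> \<Longrightarrow> f (a \<odot>\<^bsub>M\<^esub> x) = a \<odot>\<^bsub>N\<^esub> f x"
  using assms by (auto simp: rmod_hom_def PiE_def)

lemma rmod_hom_eqI:
  assumes "f \<in> rmod_hom R M N" "g \<in> rmod_hom R M N'"
    and "\<And>x. x \<in> carrier M \<Longrightarrow> f x = g x"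
  shows "f = g"
  using assms by (metis rmod_homD(1) extensionalityI)

lemma rmod_hom_compose:
  assumes "f \<in> rmod_hom R L M" "g \<in> rmod_hom R M N"
    and "right_module R L"
  shows "compose (carrier L) g f \<in> rmod_hom R L N"
proof -
  interpret L: right_module R L by fact
  show ?thesis
    by (rule rmod_homI) (simp_all add: compose_def rmod_homD[OF assms(1)] rmod_homD[OF assms(2)] L.smult_closed)
qed

context right_module
begin

lemma smult_zero_left:
  assumes "x \<in> carrier M"
  shows "\<zero>\<^bsub>R\<^esub> \<odot>\<^bsub>M\<^esub> x = \<zero>\<^bsub>M\<^esub>"
proof -
  have "\<zero>\<^bsub>R\<^esub> \<odot>\<^bsub>M\<^esub> x \<oplus>\<^bsub>M\<^esub> \<zero>\<^bsub>R\<^esub> \<odot>\<^bsub>M\<^esub> x = \<zero>\<^bsub>R\<^esub> \<odot>\<^bsub>M\<^esub> x"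
    using smult_distr_ring[of "\<zero>\<^bsub>R\<^esub>" "\<zero>\<^bsub>R\<^esub>" x] assms by simp
  then show ?thesis using smult_closed[of "\<zero>\<^bsub>R\<^esub>" x] assms by (simp add: M.add.l_cancel_one)
qed

lemma smult_zero_right:
  assumes "a \<in> carrier R"
  shows "a \<odot>\<^bsub>M\<^esub> \<zero>\<^bsub>M\<^esub> = \<zero>\<^bsub>M\<^esub>"
proof -
  have "a \<odot>\<^bsub>M\<^esub> \<zero>\<^bsub>M\<^esub> \<oplus>\<^bsub>M\<^esub> a \<odot>\<^bsub>M\<^esub> \<zero>\<^bsub>M\<^esub> = a \<odot>\<^bsub>M\<^esub> \<zero>\<^bsub>M\<^esub>"
    using smult_distr_module[of a "\<zero>\<^bsub>M\<^esub>" "\<zero>\<^bsub>M\<^esub>"] assms by simp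
  then show ?thesis using smult_closed[of a "\<zero>\<^bsub>M\<^esub>"] assms by (simp add: M.add.l_cancel_one)
qed

lemma smult_minus_one: "x \<in> carrier M \<Longrightarrow> (\<ominus>\<^bsub>R\<^esub> \<one>\<^bsub>R\<^esub>) \<odot>\<^bsub>M\<^esub> x = \<ominus>\<^bsub>M\<^esub> x"
proof -
  assume x: "x \<in> carrier M"
  have "(\<ominus>\<^bsub>R\<^esub> \<one>\<^bsub>R\<^esub>) \<odot>\<^bsub>M\<^esub> x \<oplus>\<^bsub>M\<^esub> x = (\<ominus>\<^bsub>R\<^esub> \<one>\<^bsub>R\<^esub> \<oplus>\<^bsub>R\<^esub> \<one>\<^bsub>R\<^esub>) \<odot>\<^bsub>M\<^esub> x"
    using x smult_distr_ring[of "\<ominus>\<^bsub>R\<^esub> \<one>\<^bsub>R\<^esub>" "\<one>\<^bsub>R\<^esub>" x] by (simp add: smult_one)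
  also have "\<dots> = \<zero>\<^bsub>M\<^esub>" using x by (simp add: R.l_neg smult_zero_left)
  finally show ?thesis
    using x smult_closed[of "\<ominus>\<^bsub>R\<^esub> \<one>\<^bsub>R\<^esub>" x] M.minus_equality by simp
qed

text \<open>Closure under negation follows from closure under the scalar \<open>-1\<close>.\<close>

lemma submodule_iff:
  "submodule A R M \<longleftrightarrow> A \<subseteq> carrier M \<and> \<zero>\<^bsub>M\<^esub> \<in> A \<and> (\<forall>x\<in>A. \<forall>y\<in>A. x \<oplus>\<^bsub>M\<^esub> y \<in> A) \<and>
    (\<forall>a\<in>carrier R. \<forall>x\<in>A. a \<odot>\<^bsub>M\<^esub> x \<in> A)" (is "_ \<longleftrightarrow> ?r")
proof
  assume "submodule A R M"
  then interpret submodule A R M .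
  show ?r using subset one_closed m_closed by (auto simp del: subset)
next
  assume r: ?r
  have "subgroup A (add_monoid M)"
  proof (rule M.add.subgroupI)
    fix x assume "x \<in> A"
    then show "\<ominus>\<^bsub>M\<^esub> x \<in> A"
      using r smult_minus_one[of x] R.a_inv_closed[OF R.one_closed] by fastforce
  qed (use r in auto)
  then show "submodule A R M"
    using r by (simp add: submodule_def submodule_axioms_def)
qed

lemma submodule_minus:
  assumes "submodule A R M" "x \<in> A"
  shows "\<ominus>\<^bsub>M\<^esub> x \<in> A"
  using assms smult_minus_one[of x] R.a_inv_closed[OF R.one_closed] unfolding submodule_iff
  by fastforce

lemma submodule_right_module:
  assumes "submodule N R M"
  shows "right_module R (M\<lparr>carrier := N\<rparr>)"
proof (rule right_moduleI)
  have N: "N \<subseteq> carrier M" using assms by (simp add: submodule_iff)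
  show "abelian_group (M\<lparr>carrier := N\<rparr>)"
  proof (rule abelian_groupI)
    fix x assume "x \<in> carrier (M\<lparr>carrier := N\<rparr>)"
    then show "\<exists>y\<in>carrier (M\<lparr>carrier := N\<rparr>). y \<oplus>\<^bsub>M\<lparr>carrier := N\<rparr>\<^esub> x = \<zero>\<^bsub>M\<lparr>carrier := N\<rparr>\<^esub>"
      using submodule_minus[OF assms, of x] N M.l_neg[of x] by auto
  qed (use assms N in \<open>auto simp: submodule_iff subset_iff M.a_ac\<close>)
qed (use assms in \<open>auto simp: submodule_iff subset_iff smult_distr_ring smult_distr_module
      smult_assoc smult_one R.ring_axioms\<close>)

lemma submodule_carrier_update:
  assumes "submodule N R M"
  shows "submodule A R (M\<lparr>carrier := N\<rparr>) \<longleftrightarrow> submodule A R M \<and> A \<subseteq> N"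
  using assms right_module.submodule_iff[OF submodule_right_module[OF assms]]
  by (auto simp: submodule_iff)

lemma internal_direct_sum_iff:
  "internal_direct_sum R M A B \<longleftrightarrow> submodule A R M \<and> submodule B R M \<and>
    A \<inter> B = {\<zero>\<^bsub>M\<^esub>} \<and> (\<forall>x\<in>carrier M. \<exists>a\<in>A. \<exists>b\<in>B. x = a \<oplus>\<^bsub>M\<^esub> b)"
proof -
  have *: "A <+>\<^bsub>M\<^esub> B = {x. \<exists>a\<in>A. \<exists>b\<in>B. x = a \<oplus>\<^bsub>M\<^esub> b}" by (auto simp: set_add_def')
  have "A <+>\<^bsub>M\<^esub> B = carrier M \<longleftrightarrow> (\<forall>x\<in>carrier M. \<exists>a\<in>A. \<exists>b\<in>B. x = a \<oplus>\<^bsub>M\<^esub> b)"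
    if "A \<subseteq> carrier M" "B \<subseteq> carrier M"
    using M.setadd_subset_G[OF that] unfolding * by blast
  then show ?thesis unfolding internal_direct_sum_def by (auto simp: submodule_iff)
qed

lemma internal_direct_sum_subD:
  assumes N: "submodule N R M" and d: "internal_direct_sum R (M\<lparr>carrier := N\<rparr>) A B"
  shows "submodule A R M" "A \<subseteq> N" "submodule B R M" "B \<subseteq> N" "A \<inter> B = {\<zero>\<^bsub>M\<^esub>}"
    "x \<in> N \<Longrightarrow> \<exists>a\<in>A. \<exists>b\<in>B. x = a \<oplus>\<^bsub>M\<^esub> b"
  using d right_module.internal_direct_sum_iff[OF submodule_right_module[OF N], of A B]
  by (auto simp: submodule_carrier_update[OF N])

lemma submodule_zero: "submodule {\<zero>\<^bsub>M\<^esub>} R M"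
  by (simp add: submodule_iff smult_zero_right)

lemma submodule_self: "submodule (carrier M) R M"
  by (simp add: submodule_iff smult_closed)

lemma direct_summand_zero: "direct_summand R M {\<zero>\<^bsub>M\<^esub>}"
  unfolding direct_summand_def internal_direct_sum_iff
  using submodule_zero submodule_self by (auto intro!: exI[of _ "carrier M"])

lemma rmod_hom_zero:
  assumes "right_module R N" "f \<in> rmod_hom R M N"
  shows "f \<zero>\<^bsub>M\<^esub> = \<zero>\<^bsub>N\<^esub>"
proof -
  interpret N: right_module R N by fact
  have "f \<zero>\<^bsub>M\<^esub> = f (\<zero>\<^bsub>R\<^esub> \<odot>\<^bsub>M\<^esub> \<zero>\<^bsub>M\<^esub>)" by (simp add: smult_zero_left)
  also have "\<dots> = \<zero>\<^bsub>N\<^esub>"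
    using rmod_homD[OF assms(2)] by (simp add: N.smult_zero_left)
  finally show ?thesis .
qed

end

lemma regular_right_module:
  assumes "ring R"
  shows "right_module R (regular_right_module R)"
proof -
  interpret ring R by fact
  have "abelian_group (regular_right_module R)"
    by (rule abelian_groupI) (auto simp: a_ac intro: l_neg bexI[of _ "\<ominus>\<^bsub>R\<^esub> x" for x])
  then show ?thesis
    by (rule right_moduleI[OF assms]) (simp_all add: r_distr l_distr m_assoc)
qed

lemma rmod_hom_plus:
  assumes f: "f \<in> rmod_hom R M N" and g: "g \<in> rmod_hom R M N"
    and "right_module R M" "right_module R N"
  shows "(\<lambda>x\<in>carrier M. f x \<oplus>\<^bsub>N\<^esub> g x) \<in> rmod_hom R M N"
proof -
  interpret M: right_module R M by fact
  interpret N: right_module R N by fact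
  show ?thesis
    by (rule rmod_homI)
      (simp_all add: rmod_homD[OF f] rmod_homD[OF g] M.smult_closed N.smult_distr_module N.a_ac)
qed

lemma rmod_hom_const_zero:
  assumes "right_module R M" "right_module R N"
  shows "(\<lambda>x\<in>carrier M. \<zero>\<^bsub>N\<^esub>) \<in> rmod_hom R M N"
proof -
  interpret M: right_module R M by fact
  interpret N: right_module R N by fact
  show ?thesis by (rule rmod_homI) (simp_all add: M.smult_closed N.smult_zero_right)
qed

lemma rmod_hom_id:
  assumes "right_module R M"
  shows "(\<lambda>x\<in>carrier M. x) \<in> rmod_hom R M M"
proof -
  interpret M: right_module R M by fact
  show ?thesis by (rule rmod_homI) (simp_all add: M.smult_closed)
qed

section \<open>Transport of module structure: copies, quotients, biproducts\<close>

definition image_module :: "('b \<Rightarrow> 'c) \<Rightarrow> ('a, 'b, 'z) module_scheme \<Rightarrow> ('a, 'c) module" where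
  "image_module \<phi> M =
    \<lparr>carrier = \<phi> ` carrier M, monoid.mult = undefined, one = undefined,
     ring.zero = \<phi> \<zero>\<^bsub>M\<^esub>,
     ring.add = (\<lambda>u v. \<phi> (inv_into (carrier M) \<phi> u \<oplus>\<^bsub>M\<^esub> inv_into (carrier M) \<phi> v)),
     smult = (\<lambda>a u. \<phi> (a \<odot>\<^bsub>M\<^esub> inv_into (carrier M) \<phi> u))\<rparr>"

text \<open>The operations on the image use preimages chosen by \<open>inv_into\<close>, and the
  hypotheses make the result independent of the choice. An injective \<open>\<phi>\<close> gives an
  isomorphic copy over another type; a choice of coset representatives gives a quotient.\<close>

lemma image_module:
  assumes "right_module R M"
    and add: "\<And>x x' y. \<lbrakk>x \<in> carrier M; x' \<in> carrier M; y \<in> carrier M; \<phi> x = \<phi> x'\<rbrakk> \<Longrightarrow>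
      \<phi> (x \<oplus>\<^bsub>M\<^esub> y) = \<phi> (x' \<oplus>\<^bsub>M\<^esub> y)"
    and smult: "\<And>a x x'. \<lbrakk>a \<in> carrier R; x \<in> carrier M; x' \<in> carrier M; \<phi> x = \<phi> x'\<rbrakk> \<Longrightarrow>
      \<phi> (a \<odot>\<^bsub>M\<^esub> x) = \<phi> (a \<odot>\<^bsub>M\<^esub> x')"
  shows "right_module R (image_module \<phi> M)"
    and "(\<lambda>x\<in>carrier M. \<phi> x) \<in> rmod_hom R M (image_module \<phi> M)"
proof -
  interpret M: right_module R M by fact
  let ?N = "image_module \<phi> M"
  have carr: "carrier ?N = \<phi> ` carrier M" and zero: "\<zero>\<^bsub>?N\<^esub> = \<phi> \<zero>\<^bsub>M\<^esub>"
    by (simp_all add: image_module_def)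
  have inv: "inv_into (carrier M) \<phi> (\<phi> x) \<in> carrier M" "\<phi> (inv_into (carrier M) \<phi> (\<phi> x)) = \<phi> x"
    if "x \<in> carrier M" for x
    using that by (auto intro: inv_into_into f_inv_into_f)
  have plus: "\<phi> x \<oplus>\<^bsub>?N\<^esub> \<phi> y = \<phi> (x \<oplus>\<^bsub>M\<^esub> y)" if x: "x \<in> carrier M" and y: "y \<in> carrier M" for x y
  proof -
    let ?x = "inv_into (carrier M) \<phi> (\<phi> x)" and ?y = "inv_into (carrier M) \<phi> (\<phi> y)"
    have "\<phi> x \<oplus>\<^bsub>?N\<^esub> \<phi> y = \<phi> (?x \<oplus>\<^bsub>M\<^esub> ?y)" by (simp add: image_module_def)
    \<comment> \<open>The summands are replaced one at a time, with commutativity in between, as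
      \<open>add\<close> concerns the first summand.\<close>
    also have "\<dots> = \<phi> (x \<oplus>\<^bsub>M\<^esub> ?y)" using inv x y by (intro add) simp_all
    also have "\<dots> = \<phi> (?y \<oplus>\<^bsub>M\<^esub> x)" using inv x y by (simp add: M.a_comm)
    also have "\<dots> = \<phi> (y \<oplus>\<^bsub>M\<^esub> x)" using inv x y by (intro add) simp_all
    finally show ?thesis using x y by (simp add: M.a_comm)
  qed
  have sm: "a \<odot>\<^bsub>?N\<^esub> \<phi> x = \<phi> (a \<odot>\<^bsub>M\<^esub> x)" if "a \<in> carrier R" "x \<in> carrier M" for a x
    using that inv smult[of a "inv_into (carrier M) \<phi> (\<phi> x)" x] by (simp add: image_module_def)
  show "right_module R ?N"
  proof (rule right_moduleI)
    show "abelian_group ?N"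
    proof (rule abelian_groupI)
      fix x assume "x \<in> carrier ?N"
      then obtain u where u: "u \<in> carrier M" "x = \<phi> u" by (auto simp: carr)
      then show "\<exists>y\<in>carrier ?N. y \<oplus>\<^bsub>?N\<^esub> x = \<zero>\<^bsub>?N\<^esub>"
        by (intro bexI[of _ "\<phi> (\<ominus>\<^bsub>M\<^esub> u)"]) (simp_all add: carr zero plus M.l_neg)
    qed (auto simp: carr zero plus M.a_ac)
  qed (auto simp: M.R.ring_axioms carr plus sm M.smult_closed M.smult_distr_ring M.smult_distr_module
      M.smult_assoc M.smult_one)
  show "(\<lambda>x\<in>carrier M. \<phi> x) \<in> rmod_hom R M ?N"
    by (rule rmod_homI) (simp_all add: carr plus sm M.smult_closed)
qed

lemma image_module_inj:
  assumes "right_module R M" "inj_on \<phi> (carrier M)"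
  shows "right_module R (image_module \<phi> M)"
    and "(\<lambda>x\<in>carrier M. \<phi> x) \<in> rmod_hom R M (image_module \<phi> M)"
    and "(\<lambda>u\<in>\<phi> ` carrier M. inv_into (carrier M) \<phi> u) \<in> rmod_hom R (image_module \<phi> M) M"
proof -
  interpret M: right_module R M by fact
  show N: "right_module R (image_module \<phi> M)"
    and "(\<lambda>x\<in>carrier M. \<phi> x) \<in> rmod_hom R M (image_module \<phi> M)"
    by (rule image_module[OF assms(1)]; use assms(2) in \<open>simp add: inj_on_eq_iff\<close>)+
  show "(\<lambda>u\<in>\<phi> ` carrier M. inv_into (carrier M) \<phi> u) \<in> rmod_hom R (image_module \<phi> M) M"
  proof (rule rmod_homI)
    note inv = inv_into_f_f[OF assms(2)]
    have plus: "\<phi> u \<oplus>\<^bsub>image_module \<phi> M\<^esub> \<phi> v = \<phi> (u \<oplus>\<^bsub>M\<^esub> v)" if "u \<in> carrier M" "v \<in> carrier M" for u v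
      using that by (simp add: image_module_def inv)
    have sm: "a \<odot>\<^bsub>image_module \<phi> M\<^esub> \<phi> u = \<phi> (a \<odot>\<^bsub>M\<^esub> u)" if "a \<in> carrier R" "u \<in> carrier M" for a u
      using that by (simp add: image_module_def inv)
    fix x assume "x \<in> carrier (image_module \<phi> M)"
    then obtain u where u: "u \<in> carrier M" "x = \<phi> u" by (auto simp: image_module_def)
    then show "(\<lambda>u\<in>\<phi> ` carrier M. inv_into (carrier M) \<phi> u) x \<in> carrier M" by (simp add: inv)
    show "(\<lambda>u\<in>\<phi> ` carrier M. inv_into (carrier M) \<phi> u) (x \<oplus>\<^bsub>image_module \<phi> M\<^esub> y) =
      (\<lambda>u\<in>\<phi> ` carrier M. inv_into (carrier M) \<phi> u) x \<oplus>\<^bsub>M\<^esub> (\<lambda>u\<in>\<phi> ` carrier M. inv_into (carrier M) \<phi> u) y"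
      if y: "y \<in> carrier (image_module \<phi> M)" for y
    proof -
      obtain v where "v \<in> carrier M" "y = \<phi> v" using y by (auto simp: image_module_def)
      then show ?thesis using u by (simp add: plus inv)
    qed
    show "(\<lambda>u\<in>\<phi> ` carrier M. inv_into (carrier M) \<phi> u) (a \<odot>\<^bsub>image_module \<phi> M\<^esub> x) =
      a \<odot>\<^bsub>M\<^esub> (\<lambda>u\<in>\<phi> ` carrier M. inv_into (carrier M) \<phi> u) x" if "a \<in> carrier R" for a
      using u that by (simp add: sm inv M.smult_closed)
  qed (simp add: image_module_def)
qed

lemma carrier_image_module [simp]: "carrier (image_module \<phi> M) = \<phi> ` carrier M"
  by (simp add: image_module_def)

lemma (in right_module) smult_minus:
  assumes "a \<in> carrier R" "x \<in> carrier M"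
  shows "a \<odot>\<^bsub>M\<^esub> (\<ominus>\<^bsub>M\<^esub> x) = \<ominus>\<^bsub>M\<^esub> (a \<odot>\<^bsub>M\<^esub> x)"
proof -
  have "a \<odot>\<^bsub>M\<^esub> (\<ominus>\<^bsub>M\<^esub> x) \<oplus>\<^bsub>M\<^esub> a \<odot>\<^bsub>M\<^esub> x = \<zero>\<^bsub>M\<^esub>"
    using smult_distr_module[of a "\<ominus>\<^bsub>M\<^esub> x" x] assms by (simp add: M.l_neg smult_zero_right)
  then show ?thesis using assms smult_closed by (intro M.minus_equality[symmetric]) simp_all
qed

text \<open>The quotient keeps the element type of \<open>M\<close>, so that it is an object of the
  same category: each coset is represented by a chosen member.\<close>

lemma (in right_module) quotient_module:
  assumes T: "submodule T R M"
  shows "\<exists>N :: ('a, 'b) module. right_module R N \<and>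
    (\<exists>\<pi>\<in>rmod_hom R M N. \<forall>x\<in>carrier M. \<pi> x = \<zero>\<^bsub>N\<^esub> \<longleftrightarrow> x \<in> T)"
proof -
  have TM: "T \<subseteq> carrier M" and T0: "\<zero>\<^bsub>M\<^esub> \<in> T" and Tadd: "\<And>x y. x \<in> T \<Longrightarrow> y \<in> T \<Longrightarrow> x \<oplus>\<^bsub>M\<^esub> y \<in> T"
    and Tsm: "\<And>a x. a \<in> carrier R \<Longrightarrow> x \<in> T \<Longrightarrow> a \<odot>\<^bsub>M\<^esub> x \<in> T"
    using T by (auto simp: submodule_iff)
  note Tneg = submodule_minus[OF T]
  define r where "r x y \<longleftrightarrow> y \<in> carrier M \<and> x \<ominus>\<^bsub>M\<^esub> y \<in> T" for x y
  define \<pi> where "\<pi> x = (SOME y. r x y)" for x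
  have r_refl: "r x x" if "x \<in> carrier M" for x
    using that T0 by (simp add: r_def M.minus_eq M.r_neg)
  \<comment> \<open>Congruent elements define the same predicate \<open>r\<close>, so
    \<open>SOME\<close> picks the same representative for both.\<close>
  have r_cong: "r x = r y" if xy: "x \<in> carrier M" "y \<in> carrier M" "r x y" for x y
  proof
    fix z
    have t: "x \<ominus>\<^bsub>M\<^esub> y \<in> T" using xy by (simp add: r_def)
    have tri: "u \<ominus>\<^bsub>M\<^esub> w = (u \<ominus>\<^bsub>M\<^esub> v) \<oplus>\<^bsub>M\<^esub> (v \<ominus>\<^bsub>M\<^esub> w)"
      if "u \<in> carrier M" "v \<in> carrier M" "w \<in> carrier M" for u v w
      using that by (simp add: M.minus_eq M.a_assoc M.r_neg1)
    have "y \<ominus>\<^bsub>M\<^esub> x = \<ominus>\<^bsub>M\<^esub> (x \<ominus>\<^bsub>M\<^esub> y)" using xy by (simp add: M.minus_eq M.minus_add M.a_comm)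
    then have t': "y \<ominus>\<^bsub>M\<^esub> x \<in> T" using Tneg[OF t] by simp
    show "r x z = r y z"
      using tri[OF xy(1,2), of z] tri[OF xy(2,1), of z] Tadd[OF t] Tadd[OF t'] unfolding r_def by metis
  qed
  have \<pi>: "\<pi> x = \<pi> y \<longleftrightarrow> x \<ominus>\<^bsub>M\<^esub> y \<in> T" if xy: "x \<in> carrier M" "y \<in> carrier M" for x y
  proof
    assume "\<pi> x = \<pi> y"
    moreover have "r x (\<pi> x)" "r y (\<pi> y)" unfolding \<pi>_def using r_refl xy by (metis someI)+
    ultimately have "r x (\<pi> x)" "r y (\<pi> x)" "\<pi> x \<in> carrier M" by (auto simp: r_def)
    then have "r x y" using r_cong[of x "\<pi> x"] r_cong[of y "\<pi> x"] r_refl[OF xy(2)] xy by simp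
    then show "x \<ominus>\<^bsub>M\<^esub> y \<in> T" by (simp add: r_def)
  next
    assume "x \<ominus>\<^bsub>M\<^esub> y \<in> T"
    then have "r x = r y" using r_cong xy by (simp add: r_def)
    then show "\<pi> x = \<pi> y" by (simp add: \<pi>_def)
  qed
  have cong_add: "\<pi> (x \<oplus>\<^bsub>M\<^esub> y) = \<pi> (x' \<oplus>\<^bsub>M\<^esub> y)"
    if x: "x \<in> carrier M" "x' \<in> carrier M" "y \<in> carrier M" "\<pi> x = \<pi> x'" for x x' y
  proof -
    have "(x \<oplus>\<^bsub>M\<^esub> y) \<ominus>\<^bsub>M\<^esub> (x' \<oplus>\<^bsub>M\<^esub> y) = x \<ominus>\<^bsub>M\<^esub> x'"
      using x by (simp add: M.minus_eq M.a_comm[of x' y] M.minus_add M.a_assoc M.r_neg2)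
    then show ?thesis using x \<pi> by simp
  qed
  have cong_smult: "\<pi> (a \<odot>\<^bsub>M\<^esub> x) = \<pi> (a \<odot>\<^bsub>M\<^esub> x')"
    if x: "a \<in> carrier R" "x \<in> carrier M" "x' \<in> carrier M" "\<pi> x = \<pi> x'" for a x x'
  proof -
    have "a \<odot>\<^bsub>M\<^esub> x \<ominus>\<^bsub>M\<^esub> a \<odot>\<^bsub>M\<^esub> x' = a \<odot>\<^bsub>M\<^esub> (x \<ominus>\<^bsub>M\<^esub> x')"
      using x by (simp add: M.minus_eq smult_distr_module smult_minus)
    then show ?thesis using x \<pi> Tsm smult_closed by simp
  qed
  note N = image_module[OF right_module_axioms cong_add cong_smult]
  have "\<pi> x = \<zero>\<^bsub>image_module \<pi> M\<^esub> \<longleftrightarrow> x \<in> T" if "x \<in> carrier M" for x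
  proof -
    have "\<ominus>\<^bsub>M\<^esub> \<zero>\<^bsub>M\<^esub> = \<zero>\<^bsub>M\<^esub>" by (rule M.minus_equality) simp_all
    then have "x \<ominus>\<^bsub>M\<^esub> \<zero>\<^bsub>M\<^esub> = x" by (simp only: M.minus_eq M.r_zero[OF that])
    then show ?thesis
      using \<pi>[OF that M.zero_closed] by (simp add: image_module_def)
  qed
  then have "\<forall>x\<in>carrier M. (\<lambda>x\<in>carrier M. \<pi> x) x = \<zero>\<^bsub>image_module \<pi> M\<^esub> \<longleftrightarrow> x \<in> T"
    by (metis restrict_apply')
  then show ?thesis using N by blast
qed

text \<open>An infinite type contains a copy of its own square, which makes room for the sum of two
  copies of \<open>N\<close>. The equations are those that recover addition of morphisms from
  composition.\<close>

lemma biproduct: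
  assumes inf: "infinite (UNIV :: 'u set)" and N: "right_module R (N :: ('a, 'u) module)"
  obtains W :: "('a, 'u) module" and i1 i2 p1 p2 where "right_module R W"
    "i1 \<in> rmod_hom R N W" "i2 \<in> rmod_hom R N W" "p1 \<in> rmod_hom R W N" "p2 \<in> rmod_hom R W N"
    "\<And>x. x \<in> carrier N \<Longrightarrow> p1 (i1 x) = x" "\<And>x. x \<in> carrier N \<Longrightarrow> p2 (i1 x) = \<zero>\<^bsub>N\<^esub>"
    "\<And>x. x \<in> carrier N \<Longrightarrow> p1 (i2 x) = \<zero>\<^bsub>N\<^esub>" "\<And>x. x \<in> carrier N \<Longrightarrow> p2 (i2 x) = x"
    "\<And>w. w \<in> carrier W \<Longrightarrow> i1 (p1 w) \<oplus>\<^bsub>W\<^esub> i2 (p2 w) = w"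
proof -
  interpret N: right_module R N by fact
  obtain \<phi> :: "'u \<times> 'u \<Rightarrow> 'u" where \<phi>: "inj \<phi>"
    using card_of_Times_same_infinite[OF inf] by (auto simp: card_of_ordIso[symmetric] bij_betw_def)
  define NN :: "('a, 'u \<times> 'u) module" where
    "NN = \<lparr>carrier = carrier N \<times> carrier N, monoid.mult = undefined, one = undefined,
      ring.zero = (\<zero>\<^bsub>N\<^esub>, \<zero>\<^bsub>N\<^esub>), ring.add = (\<lambda>(x, y) (x', y'). (x \<oplus>\<^bsub>N\<^esub> x', y \<oplus>\<^bsub>N\<^esub> y')),
      smult = (\<lambda>a (x, y). (a \<odot>\<^bsub>N\<^esub> x, a \<odot>\<^bsub>N\<^esub> y))\<rparr>"
  have NN: "right_module R NN"
  proof (rule right_moduleI)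
    show "abelian_group NN"
    proof (rule abelian_groupI)
      fix x assume "x \<in> carrier NN"
      then show "\<exists>y\<in>carrier NN. y \<oplus>\<^bsub>NN\<^esub> x = \<zero>\<^bsub>NN\<^esub>"
        by (intro bexI[of _ "(\<ominus>\<^bsub>N\<^esub> fst x, \<ominus>\<^bsub>N\<^esub> snd x)"]) (auto simp: NN_def N.l_neg)
    qed (auto simp: NN_def N.a_ac)
  qed (auto simp: NN_def N.R.ring_axioms N.smult_closed N.smult_distr_ring N.smult_distr_module N.smult_assoc N.smult_one)
  have inj: "inj_on \<phi> (carrier NN)" using \<phi> by (rule inj_on_subset) simp
  define W where "W = image_module \<phi> NN"
  note W = image_module_inj[OF NN inj, folded W_def]
  interpret W: right_module R W by (rule W)
  let ?\<psi> = "inv_into (carrier NN) \<phi>"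
  have carrW: "carrier W = \<phi> ` carrier NN" by (simp add: W_def)
  have fst: "(\<lambda>x\<in>carrier NN. fst x) \<in> rmod_hom R NN N"
    and snd: "(\<lambda>x\<in>carrier NN. snd x) \<in> rmod_hom R NN N"
    by (rule rmod_homI; auto simp: NN_def N.smult_closed)+
  have inl: "(\<lambda>x\<in>carrier N. (x, \<zero>\<^bsub>N\<^esub>)) \<in> rmod_hom R N NN"
    and inr: "(\<lambda>x\<in>carrier N. (\<zero>\<^bsub>N\<^esub>, x)) \<in> rmod_hom R N NN"
    by (rule rmod_homI; auto simp: NN_def N.smult_closed N.smult_zero_right)+
  note homs = rmod_hom_compose[OF inl W(2) N] rmod_hom_compose[OF inr W(2) N]
    rmod_hom_compose[OF W(3) fst W(1)] rmod_hom_compose[OF W(3) snd W(1)]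
  show ?thesis
  proof (rule that[OF W(1) homs])
    fix w assume "w \<in> carrier W"
    then obtain x y where w: "x \<in> carrier N" "y \<in> carrier N" "w = \<phi> (x, y)" by (auto simp: carrW NN_def)
    have in1: "(x, \<zero>\<^bsub>N\<^esub>) \<in> carrier NN" "(\<zero>\<^bsub>N\<^esub>, y) \<in> carrier NN" "(x, y) \<in> carrier NN"
      using w by (auto simp: NN_def)
    have "\<phi> (x, \<zero>\<^bsub>N\<^esub>) \<oplus>\<^bsub>W\<^esub> \<phi> (\<zero>\<^bsub>N\<^esub>, y) = \<phi> ((x, \<zero>\<^bsub>N\<^esub>) \<oplus>\<^bsub>NN\<^esub> (\<zero>\<^bsub>N\<^esub>, y))"
      using rmod_homD(3)[OF W(2) in1(1,2)] in1 NN by (simp add: right_module_def abelian_group_def abelian_monoid.a_closed)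
    then show "compose (carrier N) (\<lambda>x\<in>carrier NN. \<phi> x) (\<lambda>x\<in>carrier N. (x, \<zero>\<^bsub>N\<^esub>))
        (compose (carrier W) (\<lambda>x\<in>carrier NN. fst x) (\<lambda>u\<in>\<phi> ` carrier NN. ?\<psi> u) w) \<oplus>\<^bsub>W\<^esub>
      compose (carrier N) (\<lambda>x\<in>carrier NN. \<phi> x) (\<lambda>x\<in>carrier N. (\<zero>\<^bsub>N\<^esub>, x))
        (compose (carrier W) (\<lambda>x\<in>carrier NN. snd x) (\<lambda>u\<in>\<phi> ` carrier NN. ?\<psi> u) w) = w"
      using w in1 inj by (simp add: compose_def carrW) (simp add: NN_def)
  qed (use inj in \<open>auto simp: compose_def carrW NN_def\<close>)
qed

section \<open>Fully faithful functors between module categories\<close>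

text \<open>Together with a module whose image is a copy of the regular one, this is all that the
  argument extracts from the Morita equivalence.\<close>

locale full_faithful_functor =
  fixes R :: "('a, 'x) ring_scheme" and S :: "('b, 'y) ring_scheme"
    and F :: "('a, 'u, 'b) rmod_objmap" and f :: "('a, 'u) rmod_mormap"
  assumes functorial: "rmod_functor R S F f"
    and faithful: "\<lbrakk>right_module R M; right_module R N; h \<in> rmod_hom R M N; h' \<in> rmod_hom R M N;
      f M N h = f M N h'\<rbrakk> \<Longrightarrow> h = h'"
    and full: "\<lbrakk>right_module R M; right_module R N; k \<in> rmod_hom S (F M) (F N)\<rbrakk> \<Longrightarrow>
      \<exists>h\<in>rmod_hom R M N. f M N h = k"
begin

lemma F_obj: "right_module R M \<Longrightarrow> right_module S (F M)"
  using functorial by (simp add: rmod_functor_def)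

lemma F_hom:
  assumes "right_module R M" "right_module R N" "h \<in> rmod_hom R M N"
  shows "f M N h \<in> rmod_hom S (F M) (F N)"
  using functorial assms unfolding rmod_functor_def by blast

lemma F_id:
  assumes "right_module R M" "h \<in> rmod_hom R M M" "\<And>x. x \<in> carrier M \<Longrightarrow> h x = x"
    and "y \<in> carrier (F M)"
  shows "f M M h y = y"
proof -
  have "h = (\<lambda>x\<in>carrier M. x)" using assms(2,3) by (intro rmod_hom_eqI[OF _ rmod_hom_id[OF assms(1)]]) simp_all
  then show ?thesis using functorial assms(1,4) by (simp add: rmod_functor_def)
qed

text \<open>Functoriality in pointwise form: the composite may be any morphism that agrees with it
  on the carrier, whatever term denotes it.\<close>

lemma F_comp:
  assumes "right_module R L" "right_module R M" "right_module R N"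
    and h: "h \<in> rmod_hom R L M" and g: "g \<in> rmod_hom R M N" and u: "u \<in> rmod_hom R L N"
    and eq: "\<And>x. x \<in> carrier L \<Longrightarrow> u x = g (h x)"
    and y: "y \<in> carrier (F L)"
  shows "f L N u y = f M N g (f L M h y)"
proof -
  have "u = compose (carrier L) g h"
    by (rule rmod_hom_eqI[OF u rmod_hom_compose[OF h g assms(1)]]) (simp add: eq compose_def)
  moreover have "f L N (compose (carrier L) g h) = compose (carrier (F L)) (f M N g) (f L M h)"
    using functorial assms(1-3) h g unfolding rmod_functor_def by blast
  ultimately show ?thesis using y by (simp add: compose_def)
qed

section \<open>Zero morphisms and sums under a functor not assumed additive\<close>

text \<open>
  A zero morphism is one that equalises every pair of morphisms into its domain, which a full and
  faithful functor preserves.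
\<close>

lemma F_zero:
  assumes M: "right_module R M" and N: "right_module R N"
    and h: "h \<in> rmod_hom R M N" and h0: "\<And>x. x \<in> carrier M \<Longrightarrow> h x = \<zero>\<^bsub>N\<^esub>"
    and y: "y \<in> carrier (F M)"
  shows "f M N h y = \<zero>\<^bsub>F N\<^esub>"
proof -
  interpret M: right_module R M by fact
  interpret N: right_module R N by fact
  interpret FM: right_module S "F M" by (rule F_obj[OF M])
  interpret FN: right_module S "F N" by (rule F_obj[OF N])
  let ?z = "\<lambda>x\<in>carrier M. \<zero>\<^bsub>M\<^esub>" and ?i = "\<lambda>x\<in>carrier M. x"
  let ?k = "\<lambda>x\<in>carrier (F M). \<zero>\<^bsub>F N\<^esub>"
  have z: "?z \<in> rmod_hom R M M" and i: "?i \<in> rmod_hom R M M"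
    by (rule rmod_hom_const_zero[OF M M]) (rule rmod_hom_id[OF M])
  have k: "?k \<in> rmod_hom S (F M) (F N)"
    by (rule rmod_hom_const_zero) (rule FM.right_module_axioms FN.right_module_axioms)+
  \<comment> \<open>The preimage of the zero map between the images. Its composite with the zero
    endomorphism of \<open>M\<close> has the same image, so by faithfulness \<open>k'\<close> is
    itself zero.\<close>
  obtain k' where k': "k' \<in> rmod_hom R M N" "f M N k' = ?k" using full[OF M N k] by blast
  have kz: "compose (carrier M) k' ?z \<in> rmod_hom R M N"
    by (rule rmod_hom_compose[OF z k'(1) M])
  have "f M N (compose (carrier M) k' ?z) = f M N k'"
  proof (rule rmod_hom_eqI[OF F_hom[OF M N kz] F_hom[OF M N k'(1)]])
    fix x assume x: "x \<in> carrier (F M)"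
    have "f M N (compose (carrier M) k' ?z) x = f M N k' (f M M ?z x)"
      by (rule F_comp[OF M M N z k'(1) kz _ x]) (simp add: compose_def)
    then show "f M N (compose (carrier M) k' ?z) x = f M N k' x"
      using k'(2) x rmod_homD(2)[OF F_hom[OF M M z] x] by simp
  qed
  then have "compose (carrier M) k' ?z = k'" using faithful[OF M N kz k'(1)] by blast
  then have "k' x = \<zero>\<^bsub>N\<^esub>" if "x \<in> carrier M" for x
    using that M.rmod_hom_zero[OF N k'(1)] by (metis compose_eq restrict_apply')
  then have "h = k'" using h0 by (intro rmod_hom_eqI[OF h k'(1)]) simp
  then show ?thesis using k'(2) y by simp
qed

text \<open>Addition of morphisms is determined by composition with the structure maps of a biproduct.\<close>

lemma F_plus:
  assumes inf: "infinite (UNIV :: 'u set)" and M: "right_module R M" and N: "right_module R N"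
    and g1: "g1 \<in> rmod_hom R M N" and g2: "g2 \<in> rmod_hom R M N" and g: "g \<in> rmod_hom R M N"
    and g_eq: "\<And>x. x \<in> carrier M \<Longrightarrow> g x = g1 x \<oplus>\<^bsub>N\<^esub> g2 x"
    and y: "y \<in> carrier (F M)"
  shows "f M N g y = f M N g1 y \<oplus>\<^bsub>F N\<^esub> f M N g2 y"
proof -
  obtain W :: "('a, 'u) module" and i1 i2 p1 p2 where W: "right_module R W"
    and i1: "i1 \<in> rmod_hom R N W" and i2: "i2 \<in> rmod_hom R N W"
    and p1: "p1 \<in> rmod_hom R W N" and p2: "p2 \<in> rmod_hom R W N"
    and p1i1: "\<And>x. x \<in> carrier N \<Longrightarrow> p1 (i1 x) = x" and p2i1: "\<And>x. x \<in> carrier N \<Longrightarrow> p2 (i1 x) = \<zero>\<^bsub>N\<^esub>"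
    and p1i2: "\<And>x. x \<in> carrier N \<Longrightarrow> p1 (i2 x) = \<zero>\<^bsub>N\<^esub>" and p2i2: "\<And>x. x \<in> carrier N \<Longrightarrow> p2 (i2 x) = x"
    and split: "\<And>w. w \<in> carrier W \<Longrightarrow> i1 (p1 w) \<oplus>\<^bsub>W\<^esub> i2 (p2 w) = w"
    by (rule biproduct[OF inf N]) blast
  interpret N: right_module R N by fact
  interpret W: right_module R W by fact
  interpret FN: right_module S "F N" by (rule F_obj[OF N])
  interpret FW: right_module S "F W" by (rule F_obj[OF W])
  define a b c e where "a = f N W i1" and "b = f N W i2" and "c = f W N p1" and "e = f W N p2"
  have a: "a \<in> rmod_hom S (F N) (F W)" and b: "b \<in> rmod_hom S (F N) (F W)"
    and c: "c \<in> rmod_hom S (F W) (F N)" and e: "e \<in> rmod_hom S (F W) (F N)"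
    unfolding a_def b_def c_def e_def using F_hom M N W i1 i2 p1 p2 by blast+
  note id = rmod_hom_id[OF N] and zero = rmod_hom_const_zero[OF N N]
  \<comment> \<open>These biproduct equations involve only identities and zero morphisms and pass to
    the images at once. The remaining one, \<open>split_F\<close>, contains a sum of
    morphisms.\<close>
  have ca: "c (a x) = x" and ea: "e (a x) = \<zero>\<^bsub>F N\<^esub>" and cb: "c (b x) = \<zero>\<^bsub>F N\<^esub>" and eb: "e (b x) = x"
    if x: "x \<in> carrier (F N)" for x
    unfolding a_def b_def c_def e_def
    using F_comp[OF N W N i1 p1 id _ x] F_comp[OF N W N i2 p1 zero _ x]
      F_comp[OF N W N i1 p2 zero _ x] F_comp[OF N W N i2 p2 id _ x]
      F_id[OF N id _ x] F_zero[OF N N zero _ x] p1i1 p1i2 p2i1 p2i2 by simp_all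
  \<comment> \<open>The sum that should be the identity of \<open>F W\<close>. Its preimage
    \<open>k'\<close> has the same two projections as the identity of \<open>W\<close>, hence is
    that identity.\<close>
  define k where "k = (\<lambda>w\<in>carrier (F W). a (c w) \<oplus>\<^bsub>F W\<^esub> b (e w))"
  have "k \<in> rmod_hom S (F W) (F W)"
    unfolding k_def
    by (rule rmod_homI)
      (simp_all add: rmod_homD[OF a] rmod_homD[OF b] rmod_homD[OF c] rmod_homD[OF e]
        FW.smult_closed FW.smult_distr_module FW.a_ac)
  then obtain k' where k': "k' \<in> rmod_hom R W W" "f W W k' = k" using full[OF W W] by blast
  have split_F: "a (c w) \<oplus>\<^bsub>F W\<^esub> b (e w) = w" if w: "w \<in> carrier (F W)" for w
  proof -
    have proj: "p (k' x) = p x" if p: "p \<in> rmod_hom R W N"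
      and pk: "\<And>w. w \<in> carrier (F W) \<Longrightarrow> f W N p (k w) = f W N p w" and x: "x \<in> carrier W" for p x
    proof -
      have pk': "compose (carrier W) p k' \<in> rmod_hom R W N"
        by (rule rmod_hom_compose[OF k'(1) p W])
      have "f W N (compose (carrier W) p k') = f W N p"
      proof (rule rmod_hom_eqI[OF F_hom[OF W N pk'] F_hom[OF W N p]])
        fix w assume w: "w \<in> carrier (F W)"
        have "f W N (compose (carrier W) p k') w = f W N p (f W W k' w)"
          by (rule F_comp[OF W W N k'(1) p pk' _ w]) (simp add: compose_def)
        then show "f W N (compose (carrier W) p k') w = f W N p w" using pk[OF w] k'(2) by simp
      qed
      then have "compose (carrier W) p k' = p" using faithful[OF W N pk' p] by blast
      then show ?thesis using x by (metis compose_eq)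
    qed
    have cl: "a (c w) \<in> carrier (F W)" "b (e w) \<in> carrier (F W)" "c w \<in> carrier (F N)" "e w \<in> carrier (F N)"
      if "w \<in> carrier (F W)" for w
      using that rmod_homD(2)[OF a] rmod_homD(2)[OF b] rmod_homD(2)[OF c] rmod_homD(2)[OF e] by blast+
    have "c (k w) = c w" "e (k w) = e w" if "w \<in> carrier (F W)" for w
      using that cl[OF that] rmod_homD(3)[OF c cl(1,2)] rmod_homD(3)[OF e cl(1,2)]
      by (simp_all add: k_def ca cb ea eb)
    then have "p1 (k' x) = p1 x" "p2 (k' x) = p2 x" if "x \<in> carrier W" for x
      using proj[OF p1 _ that] proj[OF p2 _ that] unfolding c_def e_def by blast+
    then have "k' x = x" if "x \<in> carrier W" for x
      using split[OF that] split[OF rmod_homD(2)[OF k'(1) that]] that by metis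
    then have "k w = w" using F_id[OF W k'(1) _ w] k'(2) by simp
    then show ?thesis using w by (simp add: k_def)
  qed
  \<comment> \<open>\<open>\<sigma>\<close> adds the two components and \<open>h\<close> pairs
    \<open>g1\<close> with \<open>g2\<close>. So the sum \<open>g\<close> becomes the composite of
    \<open>\<sigma>\<close> and \<open>h\<close>, and composites are preserved.\<close>
  define \<sigma> where "\<sigma> = (\<lambda>w\<in>carrier W. p1 w \<oplus>\<^bsub>N\<^esub> p2 w)"
  have \<sigma>: "\<sigma> \<in> rmod_hom R W N" unfolding \<sigma>_def by (rule rmod_hom_plus[OF p1 p2 W N])
  define h where "h = (\<lambda>x\<in>carrier M. i1 (g1 x) \<oplus>\<^bsub>W\<^esub> i2 (g2 x))"
  have h: "h \<in> rmod_hom R M W"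
    using rmod_hom_plus[OF rmod_hom_compose[OF g1 i1 M] rmod_hom_compose[OF g2 i2 M] M W]
    by (simp add: h_def compose_def cong: restrict_cong)
  have i_closed: "i1 x \<in> carrier W" "i2 x \<in> carrier W" if "x \<in> carrier N" for x
    using that rmod_homD(2)[OF i1] rmod_homD(2)[OF i2] by blast+
  have g_closed: "g1 x \<in> carrier N" "g2 x \<in> carrier N" if "x \<in> carrier M" for x
    using that rmod_homD(2)[OF g1] rmod_homD(2)[OF g2] by blast+
  have p1h: "p1 (h x) = g1 x" and p2h: "p2 (h x) = g2 x" if "x \<in> carrier M" for x
    using that i_closed g_closed[OF that] by (simp_all add: h_def rmod_homD(3)[OF p1] rmod_homD(3)[OF p2] p1i1 p1i2 p2i1 p2i2)
  have \<sigma>h: "\<sigma> (h x) = g x" if "x \<in> carrier M" for x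
    using that p1h p2h g_eq rmod_homD(2)[OF h that] by (simp add: \<sigma>_def)
  have \<sigma>a: "f W N \<sigma> (a x) = x" and \<sigma>b: "f W N \<sigma> (b x) = x" if x: "x \<in> carrier (F N)" for x
    unfolding a_def b_def
    using F_comp[OF N W N i1 \<sigma> id _ x] F_comp[OF N W N i2 \<sigma> id _ x] F_id[OF N id _ x]
    by (simp_all add: \<sigma>_def i_closed p1i1 p1i2 p2i1 p2i2)
  define w where "w = f M W h y"
  have w: "w \<in> carrier (F W)" unfolding w_def using rmod_homD(2)[OF F_hom[OF M W h] y] .
  have cw: "c w \<in> carrier (F N)" and ew: "e w \<in> carrier (F N)"
    using rmod_homD(2)[OF c w] rmod_homD(2)[OF e w] .
  have "f M N g y = f W N \<sigma> w"
    unfolding w_def by (rule F_comp[OF M W N h \<sigma> g _ y]) (simp add: \<sigma>h)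
  also have "\<dots> = f W N \<sigma> (a (c w) \<oplus>\<^bsub>F W\<^esub> b (e w))" by (simp add: split_F[OF w])
  also have "\<dots> = c w \<oplus>\<^bsub>F N\<^esub> e w"
    using rmod_homD(3)[OF F_hom[OF W N \<sigma>] rmod_homD(2)[OF a cw] rmod_homD(2)[OF b ew]] \<sigma>a[OF cw] \<sigma>b[OF ew] by simp
  also have "c w = f M N g1 y"
    unfolding w_def c_def by (rule F_comp[OF M W N h p1 g1 _ y, symmetric]) (simp add: p1h)
  also have "e w = f M N g2 y"
    unfolding w_def e_def by (rule F_comp[OF M W N h p2 g2 _ y, symmetric]) (simp add: p2h)
  finally show ?thesis .
qed

end

section \<open>Rings of endomorphisms with separating functionals\<close>

lemma (in domain) exists_nonunit:
  assumes "\<not> field R"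
  shows "\<exists>d\<in>carrier R. d \<noteq> \<zero> \<and> d \<notin> Units R"
proof (rule ccontr)
  assume "\<not> ?thesis"
  moreover have "\<zero> \<notin> Units R" by (auto simp: Units_def)
  ultimately have "Units R = carrier R - {\<zero>}" using Units_closed by blast
  then show False using assms cring_fieldI by blast
qed

text \<open>\<open>S\<close> acts on \<open>P\<close> from the left through \<open>\<theta>\<close>,
  commuting with the right action of \<open>D\<close>. The functionals carry questions about
  \<open>P\<close> into the domain.\<close>

locale endo_ring = domain D + P: right_module D P + S: ring S
  for D :: "('d, 'x) ring_scheme" (structure) and P :: "('d, 'u, 'z) module_scheme"
    and S :: "('s, 'y) ring_scheme" +
  fixes \<theta> :: "'s \<Rightarrow> 'u \<Rightarrow> 'u"
  assumes \<theta>_bij: "bij_betw \<theta> (carrier S) (rmod_hom D P P)"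
    and \<theta>_mult: "\<lbrakk>s \<in> carrier S; t \<in> carrier S; p \<in> carrier P\<rbrakk> \<Longrightarrow> \<theta> (s \<otimes>\<^bsub>S\<^esub> t) p = \<theta> s (\<theta> t p)"
    and \<theta>_add: "\<lbrakk>s \<in> carrier S; t \<in> carrier S; p \<in> carrier P\<rbrakk> \<Longrightarrow>
      \<theta> (s \<oplus>\<^bsub>S\<^esub> t) p = \<theta> s p \<oplus>\<^bsub>P\<^esub> \<theta> t p"
    and functional: "\<lbrakk>p \<in> carrier P; p \<noteq> \<zero>\<^bsub>P\<^esub>\<rbrakk> \<Longrightarrow>
      \<exists>q \<in> rmod_hom D P (regular_right_module D). q p \<noteq> \<zero>"
    and nonzero: "carrier P \<noteq> {\<zero>\<^bsub>P\<^esub>}"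
begin

lemma \<theta>_hom: "s \<in> carrier S \<Longrightarrow> \<theta> s \<in> rmod_hom D P P"
  using \<theta>_bij by (auto simp: bij_betw_def)

lemma \<theta>_closed: "s \<in> carrier S \<Longrightarrow> p \<in> carrier P \<Longrightarrow> \<theta> s p \<in> carrier P"
  using rmod_homD(2)[OF \<theta>_hom] .

lemma \<theta>_eqI:
  assumes "s \<in> carrier S" "t \<in> carrier S" "\<And>p. p \<in> carrier P \<Longrightarrow> \<theta> s p = \<theta> t p"
  shows "s = t"
proof -
  have "\<theta> s = \<theta> t" using rmod_hom_eqI[OF \<theta>_hom \<theta>_hom] assms by blast
  then show ?thesis using \<theta>_bij assms by (auto simp: bij_betw_def inj_on_def)
qed

lemma \<theta>_surj: "f \<in> rmod_hom D P P \<Longrightarrow> \<exists>s\<in>carrier S. \<theta> s = f"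
  by (metis \<theta>_bij bij_betw_imp_surj_on imageE)

lemma \<theta>_smult:
  "\<lbrakk>s \<in> carrier S; d \<in> carrier D; p \<in> carrier P\<rbrakk> \<Longrightarrow> \<theta> s (d \<odot>\<^bsub>P\<^esub> p) = d \<odot>\<^bsub>P\<^esub> \<theta> s p"
  using rmod_homD(4)[OF \<theta>_hom] .

lemma \<theta>_zero: "p \<in> carrier P \<Longrightarrow> \<theta> \<zero>\<^bsub>S\<^esub> p = \<zero>\<^bsub>P\<^esub>"
  using \<theta>_add[of "\<zero>\<^bsub>S\<^esub>" "\<zero>\<^bsub>S\<^esub>" p] \<theta>_closed[of "\<zero>\<^bsub>S\<^esub>" p] by (simp add: P.M.add.l_cancel_one)

text \<open>A functional not vanishing at \<open>p\<close> would turn torsion of \<open>p\<close>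
  into zero divisors in the domain.\<close>

lemma torsion_free:
  assumes d: "d \<in> carrier D" "d \<noteq> \<zero>" and p: "p \<in> carrier P" "d \<odot>\<^bsub>P\<^esub> p = \<zero>\<^bsub>P\<^esub>"
  shows "p = \<zero>\<^bsub>P\<^esub>"
proof (rule ccontr)
  assume "p \<noteq> \<zero>\<^bsub>P\<^esub>"
  then obtain q where q: "q \<in> rmod_hom D P (regular_right_module D)" "q p \<noteq> \<zero>"
    using functional p by blast
  have "q p \<otimes> d = q (d \<odot>\<^bsub>P\<^esub> p)" using rmod_homD(4)[OF q(1) d(1) p(1)] by simp
  also have "\<dots> = \<zero>"
    using p P.rmod_hom_zero[OF regular_right_module q(1)] ring_axioms by simp
  finally show False using q rmod_homD(2)[OF q(1)] p d integral by fastforce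
qed

lemma smult_cancel:
  assumes "d \<in> carrier D" "d' \<in> carrier D" "p \<in> carrier P" "p \<noteq> \<zero>\<^bsub>P\<^esub>" "d \<odot>\<^bsub>P\<^esub> p = d' \<odot>\<^bsub>P\<^esub> p"
  shows "d = d'"
proof (rule ccontr)
  assume "d \<noteq> d'"
  have "(d \<ominus> d') \<odot>\<^bsub>P\<^esub> p \<oplus>\<^bsub>P\<^esub> d' \<odot>\<^bsub>P\<^esub> p = (d \<ominus> d' \<oplus> d') \<odot>\<^bsub>P\<^esub> p"
    using assms P.smult_distr_ring by simp
  also have "d \<ominus> d' \<oplus> d' = d" using assms(1,2) by (simp add: minus_eq a_assoc l_neg)
  finally have "(d \<ominus> d') \<odot>\<^bsub>P\<^esub> p = \<zero>\<^bsub>P\<^esub>"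
    using assms P.smult_closed by (simp add: P.M.add.r_cancel_one)
  then have "d \<ominus> d' = \<zero>" using torsion_free[of "d \<ominus> d'" p] assms by auto
  then show False using \<open>d \<noteq> d'\<close> assms by simp
qed

text \<open>Multiplication by \<open>d\<close> is an endomorphism because \<open>D\<close> is
  commutative. This is the embedding of \<open>D\<close> into the centre of \<open>S\<close> that
  makes right ideals of \<open>S\<close> torsion-free over \<open>D\<close>.\<close>

definition scalar :: "'d \<Rightarrow> 's" where
  "scalar d = inv_into (carrier S) \<theta> (\<lambda>p\<in>carrier P. d \<odot>\<^bsub>P\<^esub> p)"

lemma scalar:
  assumes "d \<in> carrier D"
  shows scalar_closed: "scalar d \<in> carrier S"
    and \<theta>_scalar: "p \<in> carrier P \<Longrightarrow> \<theta> (scalar d) p = d \<odot>\<^bsub>P\<^esub> p"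
proof -
  have "(\<lambda>p\<in>carrier P. d \<odot>\<^bsub>P\<^esub> p) \<in> rmod_hom D P P"
  proof (rule rmod_homI)
    fix a x assume a: "a \<in> carrier D" "x \<in> carrier P"
    have "d \<odot>\<^bsub>P\<^esub> (a \<odot>\<^bsub>P\<^esub> x) = a \<odot>\<^bsub>P\<^esub> (d \<odot>\<^bsub>P\<^esub> x)"
      using P.smult_assoc[of a d x] P.smult_assoc[of d a x] a assms m_comm by simp
    then show "(\<lambda>p\<in>carrier P. d \<odot>\<^bsub>P\<^esub> p) (a \<odot>\<^bsub>P\<^esub> x) = a \<odot>\<^bsub>P\<^esub> (\<lambda>p\<in>carrier P. d \<odot>\<^bsub>P\<^esub> p) x"
      using a P.smult_closed by simp
  qed (simp_all add: assms P.smult_closed P.smult_distr_module)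
  then have *: "(\<lambda>p\<in>carrier P. d \<odot>\<^bsub>P\<^esub> p) \<in> \<theta> ` carrier S"
    using \<theta>_bij by (simp add: bij_betw_def)
  show "scalar d \<in> carrier S" unfolding scalar_def by (rule inv_into_into[OF *])
  show "\<theta> (scalar d) p = d \<odot>\<^bsub>P\<^esub> p" if "p \<in> carrier P"
    unfolding scalar_def f_inv_into_f[OF *] using that by simp
qed

lemma \<theta>_mult_scalar:
  assumes "d \<in> carrier D" "s \<in> carrier S" "p \<in> carrier P"
  shows "\<theta> (s \<otimes>\<^bsub>S\<^esub> scalar d) p = d \<odot>\<^bsub>P\<^esub> \<theta> s p"
  using assms by (simp add: \<theta>_mult scalar_closed \<theta>_scalar \<theta>_smult)

lemma scalar_central:
  assumes "d \<in> carrier D" "s \<in> carrier S"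
  shows "s \<otimes>\<^bsub>S\<^esub> scalar d = scalar d \<otimes>\<^bsub>S\<^esub> s"
  using assms by (intro \<theta>_eqI) (simp_all add: scalar_closed \<theta>_mult \<theta>_scalar \<theta>_closed \<theta>_smult)

lemma scalar_cancel:
  assumes "d \<in> carrier D" "d \<noteq> \<zero>" "s \<in> carrier S" "s \<otimes>\<^bsub>S\<^esub> scalar d = \<zero>\<^bsub>S\<^esub>"
  shows "s = \<zero>\<^bsub>S\<^esub>"
proof (rule \<theta>_eqI)
  fix p assume p: "p \<in> carrier P"
  then have "d \<odot>\<^bsub>P\<^esub> \<theta> s p = \<zero>\<^bsub>P\<^esub>" using \<theta>_mult_scalar[of d s p] assms \<theta>_zero by simp
  then show "\<theta> s p = \<theta> \<zero>\<^bsub>S\<^esub> p" using torsion_free assms p \<theta>_closed \<theta>_zero by simp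
qed (use assms in simp_all)

lemma scalar_hom: "scalar \<in> ring_hom D S"
proof (rule ring_hom_memI)
  fix d e assume d: "d \<in> carrier D" "e \<in> carrier D"
  show "scalar (d \<otimes> e) = scalar d \<otimes>\<^bsub>S\<^esub> scalar e"
    using d by (intro \<theta>_eqI)
      (simp_all add: \<theta>_mult \<theta>_scalar scalar_closed m_comm P.smult_assoc P.smult_closed flip: P.smult_assoc)
  show "scalar (d \<oplus> e) = scalar d \<oplus>\<^bsub>S\<^esub> scalar e"
    using d by (intro \<theta>_eqI) (simp_all add: \<theta>_add \<theta>_scalar scalar_closed P.smult_distr_ring)
next
  have "\<theta> (scalar \<one> \<otimes>\<^bsub>S\<^esub> \<one>\<^bsub>S\<^esub>) p = \<theta> \<one>\<^bsub>S\<^esub> p" if "p \<in> carrier P" for p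
    using that by (simp add: \<theta>_mult scalar_closed \<theta>_scalar \<theta>_closed P.smult_one del: S.r_one)
  then show "scalar \<one> = \<one>\<^bsub>S\<^esub>"
    by (intro \<theta>_eqI) (simp_all add: scalar_closed)
qed (simp add: scalar_closed)

section \<open>Semisimple right ideals and the semi-weak-CS condition\<close>

text \<open>
  A semisimple right ideal is divisible by every nonzero \<open>d\<close> in \<open>D\<close>, as \<open>X d\<close> has a complement in
  \<open>X\<close>, which is killed by \<open>d\<close>. But a value \<open>q (x p) = c\<close> of a functional is not divisible by \<open>c d\<close> for
  a nonunit \<open>d\<close>.
\<close>

lemma semisimple_right_ideal_zero:
  assumes d: "d \<in> carrier D" "d \<noteq> \<zero>" "d \<notin> Units D"
    and X: "submodule X S (regular_right_module S)"
    and ss: "semisimple_module S (regular_right_module S\<lparr>carrier := X\<rparr>)"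
  shows "X = {\<zero>\<^bsub>S\<^esub>}"
proof (rule ccontr)
  interpret SS: right_module S "regular_right_module S" by (rule regular_right_module[OF S.ring_axioms])
  have XS: "X \<subseteq> carrier S" and X0: "\<zero>\<^bsub>S\<^esub> \<in> X" and Xadd: "\<And>x y. x \<in> X \<Longrightarrow> y \<in> X \<Longrightarrow> x \<oplus>\<^bsub>S\<^esub> y \<in> X"
    and Xmult: "\<And>x a. x \<in> X \<Longrightarrow> a \<in> carrier S \<Longrightarrow> x \<otimes>\<^bsub>S\<^esub> a \<in> X"
    using X by (auto simp: SS.submodule_iff)
  assume "X \<noteq> {\<zero>\<^bsub>S\<^esub>}"
  then obtain x where x: "x \<in> X" "x \<noteq> \<zero>\<^bsub>S\<^esub>" using X0 by blast
  then obtain p where p: "p \<in> carrier P" "\<theta> x p \<noteq> \<zero>\<^bsub>P\<^esub>"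
    using \<theta>_eqI[of x "\<zero>\<^bsub>S\<^esub>"] \<theta>_zero XS by fastforce
  then obtain q where q: "q \<in> rmod_hom D P (regular_right_module D)" "q (\<theta> x p) \<noteq> \<zero>"
    using functional[of "\<theta> x p"] \<theta>_closed x XS by blast
  define c where "c = q (\<theta> x p)"
  have c: "c \<in> carrier D" "c \<noteq> \<zero>"
    using q rmod_homD(2)[OF q(1), of "\<theta> x p"] \<theta>_closed[of x p] x p XS by (auto simp: c_def)
  \<comment> \<open>The factor \<open>c\<close> anticipates the end: if
    \<open>x = x' \<delta>\<close>, then \<open>c = q (x p) = q (x' p) c d\<close>, where
    \<open>c\<close> cancels and \<open>d\<close> becomes a unit.\<close>
  define \<delta> where "\<delta> = scalar (c \<otimes> d)"
  have cd: "c \<otimes> d \<in> carrier D" "c \<otimes> d \<noteq> \<zero>" using c d integral by auto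
  have \<delta>: "\<delta> \<in> carrier S" using scalar_closed cd by (simp add: \<delta>_def)
  \<comment> \<open>\<open>X \<delta>\<close> is again a right ideal because \<open>\<delta>\<close>
    is central.\<close>
  define N where "N = (\<lambda>y. y \<otimes>\<^bsub>S\<^esub> \<delta>) ` X"
  have NX: "N \<subseteq> X" using Xmult \<delta> by (auto simp: N_def)
  have "submodule N S (regular_right_module S)"
    unfolding SS.submodule_iff
  proof (intro conjI ballI)
    show "N \<subseteq> carrier (regular_right_module S)" using NX XS by auto
    show "\<zero>\<^bsub>regular_right_module S\<^esub> \<in> N" using X0 \<delta> by (auto simp: N_def intro!: image_eqI[of _ _ "\<zero>\<^bsub>S\<^esub>"])
    fix y assume "y \<in> N"
    then obtain u where u: "u \<in> X" "y = u \<otimes>\<^bsub>S\<^esub> \<delta>" by (auto simp: N_def)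
    show "y \<oplus>\<^bsub>regular_right_module S\<^esub> z \<in> N" if z: "z \<in> N" for z
    proof -
      obtain v where v: "v \<in> X" "z = v \<otimes>\<^bsub>S\<^esub> \<delta>" using z by (auto simp: N_def)
      then have "y \<oplus>\<^bsub>S\<^esub> z = (u \<oplus>\<^bsub>S\<^esub> v) \<otimes>\<^bsub>S\<^esub> \<delta>" using u XS \<delta> by (simp add: S.l_distr subset_iff)
      then show ?thesis using Xadd u v by (simp add: N_def)
    qed
    show "a \<odot>\<^bsub>regular_right_module S\<^esub> y \<in> N" if a: "a \<in> carrier S" for a
    proof -
      have "y \<otimes>\<^bsub>S\<^esub> a = (u \<otimes>\<^bsub>S\<^esub> a) \<otimes>\<^bsub>S\<^esub> \<delta>"
        using u a XS \<delta> scalar_central[OF cd(1) a] by (simp add: S.m_assoc subset_iff \<delta>_def)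
      then show ?thesis using Xmult u a by (simp add: N_def)
    qed
  qed
  then have "direct_summand S (regular_right_module S\<lparr>carrier := X\<rparr>) N"
    using ss NX unfolding semisimple_module_def SS.submodule_carrier_update[OF X] by blast
  then obtain Y where Y: "internal_direct_sum S (regular_right_module S\<lparr>carrier := X\<rparr>) N Y"
    by (auto simp: direct_summand_def)
  note Y' = SS.internal_direct_sum_subD[OF X Y]
  \<comment> \<open>\<open>Y \<delta>\<close> lies in both \<open>N\<close> and \<open>Y\<close>, so
    it is zero, and \<open>\<delta>\<close> cancels.\<close>
  have "Y \<subseteq> {\<zero>\<^bsub>S\<^esub>}"
  proof
    fix y assume y: "y \<in> Y"
    then have "y \<otimes>\<^bsub>S\<^esub> \<delta> \<in> N \<inter> Y" using Y'(3,4) \<delta> by (auto simp: SS.submodule_iff N_def)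
    then have "y \<otimes>\<^bsub>S\<^esub> \<delta> = \<zero>\<^bsub>S\<^esub>" using Y'(5) by simp
    then show "y \<in> {\<zero>\<^bsub>S\<^esub>}" using scalar_cancel cd y Y'(4) XS by (auto simp: \<delta>_def)
  qed
  moreover obtain n y where n: "n \<in> N" "y \<in> Y" "x = n \<oplus>\<^bsub>S\<^esub> y" using Y'(6)[OF x(1)] by auto
  ultimately have "y = \<zero>\<^bsub>S\<^esub>" by blast
  then have "x = n" using n NX XS by auto
  then obtain x' where x': "x' \<in> X" "x = x' \<otimes>\<^bsub>S\<^esub> \<delta>" using n by (auto simp: N_def)
  have x'S: "x' \<in> carrier S" using x' XS by blast
  have "c = q ((c \<otimes> d) \<odot>\<^bsub>P\<^esub> \<theta> x' p)"
    unfolding c_def using x' x'S p cd \<theta>_mult_scalar[of "c \<otimes> d" x' p] by (simp add: \<delta>_def c_def)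
  also have "\<dots> = q (\<theta> x' p) \<otimes> (c \<otimes> d)"
    using rmod_homD(4)[OF q(1)] cd \<theta>_closed[OF x'S p(1)] by simp
  finally have "c = q (\<theta> x' p) \<otimes> (c \<otimes> d)" .
  moreover have q': "q (\<theta> x' p) \<in> carrier D"
    using rmod_homD(2)[OF q(1)] \<theta>_closed[OF x'S p(1)] by simp
  ultimately have "c \<otimes> \<one> = c \<otimes> (d \<otimes> q (\<theta> x' p))" using c(1) d(1) by (simp add: m_ac)
  then have "\<one> = d \<otimes> q (\<theta> x' p)"
    using c d q' by (subst (asm) m_lcancel) auto
  then have "d divides \<one>" using q' by (intro dividesI) auto
  then show False using d divides_one by blast
qed

lemma semi_weak_CS:
  assumes "\<not> field D"
  shows "right_semi_weak_CS_ring S"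
  unfolding right_semi_weak_CS_ring_def semi_weak_CS_module_def
proof (intro allI impI)
  interpret SS: right_module S "regular_right_module S" by (rule regular_right_module[OF S.ring_axioms])
  obtain d where d: "d \<in> carrier D" "d \<noteq> \<zero>" "d \<notin> Units D"
    using assms exists_nonunit by blast
  fix C assume C: "C \<subseteq> semisimple_triples S (regular_right_module S)"
  have "X = {\<zero>\<^bsub>S\<^esub>} \<and> Y = {\<zero>\<^bsub>S\<^esub>}" if "(X, Y, \<phi>) \<in> C" for X Y \<phi>
    using subsetD[OF C that] semisimple_right_ideal_zero[OF d]
    by (auto simp: semisimple_triples_def direct_summand_def SS.internal_direct_sum_iff)
  \<comment> \<open>For the empty chain it is the inserted zero that gives these equalities.\<close>
  then have "chain_dom (regular_right_module S) C = {\<zero>\<^bsub>S\<^esub>}"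
    "chain_cod (regular_right_module S) C = {\<zero>\<^bsub>S\<^esub>}"
    by (force simp: chain_dom_def chain_cod_def)+
  moreover have "essential_in S (regular_right_module S) {\<zero>\<^bsub>S\<^esub>} {\<zero>\<^bsub>S\<^esub>}"
    using SS.submodule_zero SS.submodule_carrier_update[of "{\<zero>\<^bsub>S\<^esub>}"]
    by (auto simp: essential_in_def SS.submodule_iff)
  moreover have "direct_summand S (regular_right_module S) {\<zero>\<^bsub>S\<^esub>}"
    using SS.direct_summand_zero by simp
  ultimately show "\<exists>A B. direct_summand S (regular_right_module S) A \<and>
      direct_summand S (regular_right_module S) B \<and>
      essential_in S (regular_right_module S) (chain_dom (regular_right_module S) C) A \<and>
      essential_in S (regular_right_module S) (chain_cod (regular_right_module S) C) B"
    by auto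
qed

text \<open>The hypothesis makes \<open>scalar\<close> surjective; it is injective because a nonzero
  element of \<open>P\<close> has no torsion.\<close>

lemma iso_if_scalars:
  assumes "\<And>g. g \<in> rmod_hom D P P \<Longrightarrow> \<exists>r\<in>carrier D. \<forall>p\<in>carrier P. g p = r \<odot>\<^bsub>P\<^esub> p"
  shows "S \<simeq> D"
proof -
  obtain p where p: "p \<in> carrier P" "p \<noteq> \<zero>\<^bsub>P\<^esub>" using nonzero by blast
  have "inj_on scalar (carrier D)"
  proof (rule inj_onI)
    fix d e assume d: "d \<in> carrier D" "e \<in> carrier D" "scalar d = scalar e"
    then have "d \<odot>\<^bsub>P\<^esub> p = e \<odot>\<^bsub>P\<^esub> p" using \<theta>_scalar[of d p] \<theta>_scalar[of e p] p by simp
    then show "d = e" using smult_cancel d p by blast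
  qed
  moreover have "s \<in> scalar ` carrier D" if s: "s \<in> carrier S" for s
  proof -
    obtain r where r: "r \<in> carrier D" "\<forall>p\<in>carrier P. \<theta> s p = r \<odot>\<^bsub>P\<^esub> p"
      using assms[OF \<theta>_hom[OF s]] by blast
    then have "s = scalar r" using s by (intro \<theta>_eqI) (simp_all add: scalar_closed \<theta>_scalar)
    then show ?thesis using r by blast
  qed
  ultimately have "scalar \<in> ring_iso D S"
    using scalar_hom scalar_closed by (auto simp: ring_iso_def bij_betw_def)
  then have "D \<simeq> S" by (auto simp: is_ring_iso_def)
  then show ?thesis using ring_iso_sym ring_axioms by blast
qed

end

section \<open>A nonzero functional and its invertible image ideal\<close>

locale dedekind_endo_ring = endo_ring + dedekind_domain D
begin

context
  fixes q p0
  assumes q: "q \<in> rmod_hom D P (regular_right_module D)"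
    and p0: "p0 \<in> carrier P" "q p0 \<noteq> \<zero>"
begin

lemma functional_closed: "p \<in> carrier P \<Longrightarrow> q p \<in> carrier D"
  using rmod_homD(2)[OF q] by simp

lemma functional_add: "\<lbrakk>x \<in> carrier P; y \<in> carrier P\<rbrakk> \<Longrightarrow> q (x \<oplus>\<^bsub>P\<^esub> y) = q x \<oplus> q y"
  using rmod_homD(3)[OF q] by simp

lemma functional_smult: "\<lbrakk>a \<in> carrier D; x \<in> carrier P\<rbrakk> \<Longrightarrow> q (a \<odot>\<^bsub>P\<^esub> x) = q x \<otimes> a"
  using rmod_homD(4)[OF q] by simp

lemma functional_zero: "q \<zero>\<^bsub>P\<^esub> = \<zero>"
  using P.rmod_hom_zero[OF regular_right_module q] ring_axioms by simp

lemma functional_base_closed: "q p0 \<in> carrier D"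
  using functional_closed p0 by simp

text \<open>The pattern of use below: a property of all elements of the product is proved by
  induction over sums of products and then read off at \<open>q p0\<close>, where the common factor
  \<open>q p0\<close> cancels.\<close>

lemma image_invertible: "q p0 \<in> q ` carrier P \<cdot> colon (q ` carrier P) (q p0)"
proof (rule ideal_invertible)
  show "ideal (q ` carrier P) D"
  proof (rule idealI_comm)
    show "q ` carrier P \<subseteq> carrier D" using functional_closed by blast
    show "\<zero> \<in> q ` carrier P" using functional_zero by (metis P.M.zero_closed image_eqI)
    fix x assume "x \<in> q ` carrier P"
    then obtain u where u: "u \<in> carrier P" "x = q u" by blast
    show "x \<oplus> y \<in> q ` carrier P" if "y \<in> q ` carrier P" for y
    proof -
      obtain v where v: "v \<in> carrier P" "y = q v" using \<open>y \<in> q ` carrier P\<close> by blast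
      then show ?thesis using u functional_add[of u v] by (intro image_eqI[of _ _ "u \<oplus>\<^bsub>P\<^esub> v"]) simp_all
    qed
    show "a \<otimes> x \<in> q ` carrier P" if "a \<in> carrier D" for a
      using that u functional_smult functional_closed m_comm P.smult_closed by (intro image_eqI[of _ _ "a \<odot>\<^bsub>P\<^esub> u"]) simp_all
  qed
qed (use p0 in auto)

text \<open>For \<open>z = q p0\<close> this splits \<open>q\<close> onto its image.\<close>

lemma lift_through_functional:
  assumes "z \<in> q ` carrier P \<cdot> colon (q ` carrier P) (q p0)"
  shows "z \<in> carrier D \<and> (\<exists>h\<in>rmod_hom D P P.
    (\<forall>p\<in>carrier P. q (h p) \<otimes> q p0 = z \<otimes> q p) \<and>
    (\<forall>p\<in>carrier P. \<forall>p'\<in>carrier P. q p = q p' \<longrightarrow> h p = h p'))"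
  using assms
proof (induction z rule: ideal_prod.induct)
  case (prod i y)
  then obtain u where u: "u \<in> carrier P" "i = q u" by blast
  have y: "y \<in> carrier D" using prod by (simp add: colon_def)
  have "\<forall>x\<in>q ` carrier P. \<exists>w\<in>carrier D. x \<otimes> y = q p0 \<otimes> w"
    using prod by (simp add: colon_def factor_def)
  \<comment> \<open>\<open>w x\<close> is the quotient \<open>x y / q p0\<close>, which exists as
    \<open>y\<close> lies in the colon ideal; \<open>wu\<close> gives its uniqueness and thereby its
    linearity.\<close>
  then obtain w where w: "\<And>x. x \<in> q ` carrier P \<Longrightarrow> w x \<in> carrier D \<and> x \<otimes> y = q p0 \<otimes> w x"
    by metis
  have wu: "w x = v" if "x \<in> q ` carrier P" "v \<in> carrier D" "x \<otimes> y = q p0 \<otimes> v" for x v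
  proof -
    have "q p0 \<otimes> w x = q p0 \<otimes> v" using w[OF that(1)] that by simp
    then show ?thesis using m_lcancel[OF p0(2) functional_base_closed, of "w x" v] w[OF that(1)] that(2) by simp
  qed
  \<comment> \<open>Here \<open>q (h p) = (i y / q p0) q p\<close>. When \<open>q p0\<close> is
    written as a sum of such products \<open>i y\<close>, the sum of these maps preserves
    \<open>q\<close>.\<close>
  define h where "h = (\<lambda>p\<in>carrier P. w (q p) \<odot>\<^bsub>P\<^esub> u)"
  have "h \<in> rmod_hom D P P"
  proof (rule rmod_homI)
    fix x x' assume x: "x \<in> carrier P" "x' \<in> carrier P"
    have "w (q (x \<oplus>\<^bsub>P\<^esub> x')) = w (q x) \<oplus> w (q x')"
    proof (rule wu)
      show "q (x \<oplus>\<^bsub>P\<^esub> x') \<otimes> y = q p0 \<otimes> (w (q x) \<oplus> w (q x'))"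
        using x w[of "q x"] w[of "q x'"] y functional_base_closed by (simp add: functional_add functional_closed l_distr r_distr)
    qed (use x w in auto)
    then show "h (x \<oplus>\<^bsub>P\<^esub> x') = h x \<oplus>\<^bsub>P\<^esub> h x'"
      using x w[of "q x"] w[of "q x'"] u by (simp add: h_def P.smult_distr_ring)
  next
    fix a x assume x: "a \<in> carrier D" "x \<in> carrier P"
    have "w (q (a \<odot>\<^bsub>P\<^esub> x)) = w (q x) \<otimes> a"
    proof (rule wu)
      have "q (a \<odot>\<^bsub>P\<^esub> x) \<otimes> y = (q x \<otimes> y) \<otimes> a"
        using x y by (simp add: functional_smult functional_closed m_ac)
      then show "q (a \<odot>\<^bsub>P\<^esub> x) \<otimes> y = q p0 \<otimes> (w (q x) \<otimes> a)"
        using x w[of "q x"] functional_base_closed by (simp add: m_assoc)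
    qed (use x w P.smult_closed in auto)
    then show "h (a \<odot>\<^bsub>P\<^esub> x) = a \<odot>\<^bsub>P\<^esub> h x"
      using x w[of "q x"] u by (simp add: h_def P.smult_assoc P.smult_closed)
  qed (use w u in \<open>auto simp: h_def P.smult_closed\<close>)
  moreover have "q (h p) \<otimes> q p0 = (i \<otimes> y) \<otimes> q p" if p: "p \<in> carrier P" for p
  proof -
    have wp: "w (q p) \<in> carrier D" "q p \<otimes> y = q p0 \<otimes> w (q p)" using w p by auto
    have "q (h p) \<otimes> q p0 = q u \<otimes> (q p0 \<otimes> w (q p))"
      using p u wp functional_base_closed by (simp add: h_def functional_smult functional_closed m_ac)
    also have "\<dots> = (i \<otimes> y) \<otimes> q p"
      unfolding wp(2)[symmetric] using u p y by (simp add: functional_closed m_ac)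
    finally show ?thesis .
  qed
  moreover have "i \<otimes> y \<in> carrier D" using u y functional_closed by simp
  ultimately show ?case by (auto simp: h_def intro!: bexI[of _ h])
next
  case (sum z1 z2)
  then obtain h1 h2 where z: "z1 \<in> carrier D" "z2 \<in> carrier D"
    and h1: "h1 \<in> rmod_hom D P P" "\<forall>p\<in>carrier P. q (h1 p) \<otimes> q p0 = z1 \<otimes> q p"
    "\<forall>p\<in>carrier P. \<forall>p'\<in>carrier P. q p = q p' \<longrightarrow> h1 p = h1 p'"
    and h2: "h2 \<in> rmod_hom D P P" "\<forall>p\<in>carrier P. q (h2 p) \<otimes> q p0 = z2 \<otimes> q p"
    "\<forall>p\<in>carrier P. \<forall>p'\<in>carrier P. q p = q p' \<longrightarrow> h2 p = h2 p'"
    by blast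
  define h where "h = (\<lambda>p\<in>carrier P. h1 p \<oplus>\<^bsub>P\<^esub> h2 p)"
  have "h \<in> rmod_hom D P P"
    unfolding h_def by (rule rmod_hom_plus[OF h1(1) h2(1)]) (rule P.right_module_axioms)+
  moreover have "\<forall>p\<in>carrier P. q (h p) \<otimes> q p0 = (z1 \<oplus> z2) \<otimes> q p"
  proof
    fix p assume p: "p \<in> carrier P"
    then have "q (h p) \<otimes> q p0 = q (h1 p) \<otimes> q p0 \<oplus> q (h2 p) \<otimes> q p0"
      using rmod_homD(2)[OF h1(1) p] rmod_homD(2)[OF h2(1) p] functional_base_closed
      by (simp add: h_def functional_add functional_closed l_distr)
    then show "q (h p) \<otimes> q p0 = (z1 \<oplus> z2) \<otimes> q p"
      using p h1(2) h2(2) z functional_closed by (simp add: l_distr)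
  qed
  moreover have "\<forall>p\<in>carrier P. \<forall>p'\<in>carrier P. q p = q p' \<longrightarrow> h p = h p'"
  proof (intro ballI impI)
    fix p p' assume p: "p \<in> carrier P" "p' \<in> carrier P" "q p = q p'"
    then have "h1 p = h1 p'" "h2 p = h2 p'" using h1(3) h2(3) by blast+
    then show "h p = h p'" using p by (simp add: h_def)
  qed
  ultimately show ?case using z by blast
qed

text \<open>\<open>e\<close> is \<open>q\<close> followed by a section, written as an endomorphism
  of \<open>P\<close> so that it corresponds to an element of \<open>S\<close>. It is idempotent,
  since \<open>e p\<close> depends only on \<open>q p\<close>, and it has the same kernel as
  \<open>q\<close>.\<close>

lemma splitting:
  "\<exists>e\<in>rmod_hom D P P. (\<forall>p\<in>carrier P. q (e p) = q p) \<and>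
    (\<forall>p\<in>carrier P. \<forall>p'\<in>carrier P. q p = q p' \<longrightarrow> e p = e p')"
proof -
  obtain e where e: "e \<in> rmod_hom D P P" "\<forall>p\<in>carrier P. q (e p) \<otimes> q p0 = q p0 \<otimes> q p"
    "\<forall>p\<in>carrier P. \<forall>p'\<in>carrier P. q p = q p' \<longrightarrow> e p = e p'"
    using lift_through_functional[OF image_invertible] by blast
  have "q (e p) = q p" if p: "p \<in> carrier P" for p
  proof -
    have "q p0 \<otimes> q (e p) = q p0 \<otimes> q p"
      using e(2) p m_comm[OF functional_base_closed functional_closed[OF rmod_homD(2)[OF e(1) p]]] by simp
    then show ?thesis
      using m_lcancel[OF p0(2) functional_base_closed] functional_closed rmod_homD(2)[OF e(1) p] p by blast
  qed
  then show ?thesis using e by blast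
qed

text \<open>Identify \<open>P\<close> with its image ideal. Linearity gives
  \<open>g x * u = g u * x\<close>, so \<open>g\<close> is multiplication by the fraction
  \<open>g u / u\<close>. As \<open>1\<close> is a sum of products of members of the ideal and of
  its inverse, that fraction lies in \<open>D\<close>.\<close>

lemma endo_of_ideal_scalar:
  assumes inj: "inj_on q (carrier P)" and g: "g \<in> rmod_hom D P P"
  shows "\<exists>r\<in>carrier D. \<forall>p\<in>carrier P. g p = r \<odot>\<^bsub>P\<^esub> p"
proof -
  have gP: "g p \<in> carrier P" if "p \<in> carrier P" for p using rmod_homD(2)[OF g that] .
  have "z \<in> carrier D \<and> (\<exists>r\<in>carrier D. \<forall>p\<in>carrier P. q (g p) \<otimes> z = r \<otimes> q p0 \<otimes> q p)"
    if "z \<in> q ` carrier P \<cdot> colon (q ` carrier P) (q p0)" for z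
    using that
  proof (induction z rule: ideal_prod.induct)
    case (prod i y)
    then obtain u where u: "u \<in> carrier P" "i = q u" by blast
    have y: "y \<in> carrier D" using prod by (simp add: colon_def)
    obtain r where r: "r \<in> carrier D" "q (g u) \<otimes> y = q p0 \<otimes> r"
      using prod gP[OF u(1)] by (auto simp: colon_def factor_def)
    have "q (g p) \<otimes> (i \<otimes> y) = r \<otimes> q p0 \<otimes> q p" if p: "p \<in> carrier P" for p
    proof -
      \<comment> \<open>Commutativity inside the ideal, which injectivity of \<open>q\<close> pulls
        back to \<open>P\<close>.\<close>
      have "q (q u \<odot>\<^bsub>P\<^esub> p) = q (q p \<odot>\<^bsub>P\<^esub> u)"
        using p u by (simp add: functional_smult functional_closed m_comm)
      then have "q u \<odot>\<^bsub>P\<^esub> p = q p \<odot>\<^bsub>P\<^esub> u"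
        using inj p u P.smult_closed functional_closed by (auto simp: inj_on_def)
      then have "q u \<odot>\<^bsub>P\<^esub> g p = q p \<odot>\<^bsub>P\<^esub> g u"
        using rmod_homD(4)[OF g, of "q u" p] rmod_homD(4)[OF g, of "q p" u] p u functional_closed by simp
      then have eq: "q (g p) \<otimes> q u = q (g u) \<otimes> q p"
        using functional_smult[of "q u" "g p"] functional_smult[of "q p" "g u"] p u gP functional_closed by simp
      have "q (g p) \<otimes> (i \<otimes> y) = (q (g p) \<otimes> q u) \<otimes> y"
        using u p y gP functional_closed by (simp add: m_assoc)
      also have "\<dots> = (q (g u) \<otimes> y) \<otimes> q p"
        unfolding eq using u p y gP functional_closed by (simp add: m_ac)
      also have "\<dots> = r \<otimes> q p0 \<otimes> q p"
        unfolding r(2) using r functional_base_closed p functional_closed by (simp add: m_ac)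
      finally show ?thesis .
    qed
    then show ?case using r u y functional_closed by blast
  next
    case (sum z1 z2)
    then obtain r1 r2 where z: "z1 \<in> carrier D" "z2 \<in> carrier D"
      and r: "r1 \<in> carrier D" "r2 \<in> carrier D"
      "\<forall>p\<in>carrier P. q (g p) \<otimes> z1 = r1 \<otimes> q p0 \<otimes> q p"
      "\<forall>p\<in>carrier P. q (g p) \<otimes> z2 = r2 \<otimes> q p0 \<otimes> q p" by blast
    have "q (g p) \<otimes> (z1 \<oplus> z2) = (r1 \<oplus> r2) \<otimes> q p0 \<otimes> q p" if "p \<in> carrier P" for p
      using that z r gP functional_closed functional_base_closed by (simp add: l_distr r_distr)
    then show ?case using z r by blast
  qed
  from this[OF image_invertible] obtain r where r: "r \<in> carrier D"
    "\<forall>p\<in>carrier P. q (g p) \<otimes> q p0 = r \<otimes> q p0 \<otimes> q p" by blast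
  have "g p = r \<odot>\<^bsub>P\<^esub> p" if p: "p \<in> carrier P" for p
  proof -
    have "q p0 \<otimes> q (g p) = q p0 \<otimes> (q p \<otimes> r)"
    proof -
      have "q p0 \<otimes> q (g p) = r \<otimes> q p0 \<otimes> q p"
        using r(2) p m_comm[OF functional_base_closed functional_closed[OF gP[OF p]]] by simp
      then show ?thesis using r(1) p functional_closed functional_base_closed by (simp add: m_ac)
    qed
    then have "q (g p) = q p \<otimes> r"
      using m_lcancel[OF p0(2) functional_base_closed functional_closed[OF gP[OF p]], of "q p \<otimes> r"] functional_closed p r by simp
    then have "q (g p) = q (r \<odot>\<^bsub>P\<^esub> p)" using functional_smult p r by simp
    then show ?thesis using inj p gP r P.smult_closed by (auto simp: inj_on_def)
  qed
  then show ?thesis using r by blast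
qed

text \<open>The image ideal \<open>I\<close> would satisfy \<open>I \<subseteq> I d\<close>;
  multiplying by its inverse leaves \<open>1 \<in> d D\<close>.\<close>

lemma image_not_divisible:
  assumes d: "d \<in> carrier D" "d \<notin> Units D"
    and div: "\<And>p. p \<in> carrier P \<Longrightarrow> \<exists>p'\<in>carrier P. q p = q p' \<otimes> d"
  shows False
proof -
  have "\<exists>r\<in>carrier D. z = q p0 \<otimes> (d \<otimes> r)"
    if "z \<in> q ` carrier P \<cdot> colon (q ` carrier P) (q p0)" for z
    using that
  proof (induction z rule: ideal_prod.induct)
    case (prod i y)
    then obtain u where u: "u \<in> carrier P" "i = q u" by blast
    then obtain u' where u': "u' \<in> carrier P" "i = q u' \<otimes> d" using div by metis
    have y: "y \<in> carrier D" using prod by (simp add: colon_def)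
    obtain r where r: "r \<in> carrier D" "q u' \<otimes> y = q p0 \<otimes> r"
      using prod u' by (auto simp: colon_def factor_def)
    have "i \<otimes> y = (q u' \<otimes> y) \<otimes> d" using u' y d functional_closed by (simp add: m_ac)
    also have "\<dots> = q p0 \<otimes> (d \<otimes> r)" unfolding r(2) using r d functional_base_closed by (simp add: m_ac)
    finally show ?case using r by blast
  next
    case (sum z1 z2)
    then obtain r1 r2 where "r1 \<in> carrier D" "z1 = q p0 \<otimes> (d \<otimes> r1)"
      "r2 \<in> carrier D" "z2 = q p0 \<otimes> (d \<otimes> r2)" by blast
    then show ?case using d functional_base_closed by (intro bexI[of _ "r1 \<oplus> r2"]) (simp_all add: r_distr)
  qed
  from this[OF image_invertible] obtain r where r: "r \<in> carrier D" "q p0 = q p0 \<otimes> (d \<otimes> r)" by blast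
  then have "q p0 \<otimes> \<one> = q p0 \<otimes> (d \<otimes> r)" using functional_base_closed by simp
  then have "\<one> = d \<otimes> r" using m_lcancel[OF p0(2) functional_base_closed] r d by blast
  then have "d divides \<one>" using r by (intro dividesI) auto
  then show False using d divides_one by blast
qed

end

text \<open>The splitting of \<open>P\<close> is translated to \<open>S\<close>: the endomorphisms
  with values in the image of \<open>e\<close>, and those with values in the kernel of
  \<open>q\<close>, form the right ideals \<open>\<epsilon> S\<close> and
  \<open>(1 - \<epsilon>) S\<close>. A map from the first summand of \<open>P\<close> to the second
  acts on them by left multiplication.\<close>

lemma iso_if_C4:
  assumes nf: "\<not> field D" and C4: "right_C4_ring S"
  shows "S \<simeq> D"
proof -
  interpret SS: right_module S "regular_right_module S" by (rule regular_right_module[OF S.ring_axioms])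
  obtain p0 where "p0 \<in> carrier P" "p0 \<noteq> \<zero>\<^bsub>P\<^esub>" using nonzero by blast
  then obtain q where q: "q \<in> rmod_hom D P (regular_right_module D)" and p0: "p0 \<in> carrier P" "q p0 \<noteq> \<zero>"
    using functional by blast
  note qs = functional_closed[OF q p0] functional_add[OF q p0] functional_smult[OF q p0] functional_zero[OF q p0]
  obtain d where d: "d \<in> carrier D" "d \<noteq> \<zero>" "d \<notin> Units D"
    using nf exists_nonunit by blast
  obtain e where e: "e \<in> rmod_hom D P P" and qe: "\<And>p. p \<in> carrier P \<Longrightarrow> q (e p) = q p"
    and econg: "\<And>p p'. \<lbrakk>p \<in> carrier P; p' \<in> carrier P; q p = q p'\<rbrakk> \<Longrightarrow> e p = e p'"
    using splitting[OF q p0] by meson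
  have eP: "e p \<in> carrier P" if "p \<in> carrier P" for p using rmod_homD(2)[OF e that] .
  have ee: "e (e p) = e p" if "p \<in> carrier P" for p using econg[OF eP[OF that] that qe[OF that]] .
  have e0: "e \<zero>\<^bsub>P\<^esub> = \<zero>\<^bsub>P\<^esub>" using P.rmod_hom_zero[OF P.right_module_axioms e] .
  obtain \<epsilon> where \<epsilon>: "\<epsilon> \<in> carrier S" "\<theta> \<epsilon> = e" using \<theta>_surj[OF e] by blast
  have \<epsilon>\<epsilon>: "\<epsilon> \<otimes>\<^bsub>S\<^esub> \<epsilon> = \<epsilon>"
    by (rule \<theta>_eqI) (simp_all add: \<epsilon> \<theta>_mult ee)
  have "b = \<zero>\<^bsub>P\<^esub>" if b: "b \<in> carrier P" "q b = \<zero>" for b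
  proof (rule ccontr)
    assume b0: "b \<noteq> \<zero>\<^bsub>P\<^esub>"
    have "(\<lambda>p\<in>carrier P. q p \<odot>\<^bsub>P\<^esub> b) \<in> rmod_hom D P P"
      by (rule rmod_homI)
        (simp_all add: qs b P.smult_closed P.smult_distr_ring P.smult_assoc)
    \<comment> \<open>The map \<open>p \<mapsto> b q(p)\<close>. Its multiple \<open>s\<close> by
      the nonunit \<open>d\<close> induces the homomorphism to which C4 is applied;
      \<open>s0\<close> itself serves to show that the image is not a summand.\<close>
    from \<theta>_surj[OF this] obtain s0 where s0S: "s0 \<in> carrier S"
      and \<theta>s0: "\<theta> s0 = (\<lambda>p\<in>carrier P. q p \<odot>\<^bsub>P\<^esub> b)" by (rule bexE)
    have s0: "s0 \<in> carrier S" "\<And>p. p \<in> carrier P \<Longrightarrow> \<theta> s0 p = q p \<odot>\<^bsub>P\<^esub> b"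
      by (simp_all add: s0S \<theta>s0)
    define s where "s = s0 \<otimes>\<^bsub>S\<^esub> scalar d"
    have s: "s \<in> carrier S" using s0 d scalar_closed by (simp add: s_def)
    have \<theta>s: "\<theta> s p = (q p \<otimes> d) \<odot>\<^bsub>P\<^esub> b" if "p \<in> carrier P" for p
      unfolding s_def using that s0 d b by (simp add: \<theta>_mult_scalar P.smult_assoc qs)
    define A B where "A = {x \<in> carrier S. \<epsilon> \<otimes>\<^bsub>S\<^esub> x = x}" and "B = {x \<in> carrier S. \<epsilon> \<otimes>\<^bsub>S\<^esub> x = \<zero>\<^bsub>S\<^esub>}"
    have A: "submodule A S (regular_right_module S)" and B: "submodule B S (regular_right_module S)"
      unfolding SS.submodule_iff A_def B_def using \<epsilon>(1)
      by (auto simp: S.r_distr simp flip: S.m_assoc)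
    have eb: "e b = \<zero>\<^bsub>P\<^esub>" using econg[OF b(1) P.M.zero_closed] b qs e0 by simp
    have \<epsilon>s0: "\<epsilon> \<otimes>\<^bsub>S\<^esub> s0 = \<zero>\<^bsub>S\<^esub>"
    proof (rule \<theta>_eqI)
      fix p assume p: "p \<in> carrier P"
      have "\<theta> (\<epsilon> \<otimes>\<^bsub>S\<^esub> s0) p = q p \<odot>\<^bsub>P\<^esub> e b"
        using p \<epsilon> s0 rmod_homD(4)[OF e, of "q p" b] qs(1) b by (simp add: \<theta>_mult)
      then show "\<theta> (\<epsilon> \<otimes>\<^bsub>S\<^esub> s0) p = \<theta> \<zero>\<^bsub>S\<^esub> p"
        using p qs(1) by (simp add: eb P.smult_zero_right \<theta>_zero)
    qed (use \<epsilon> s0 in simp_all)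
    \<comment> \<open>\<open>s0\<close> depends on \<open>p\<close> only through \<open>q p\<close>,
      which \<open>e\<close> preserves.\<close>
    have s0\<epsilon>: "s0 \<otimes>\<^bsub>S\<^esub> \<epsilon> = s0"
      using s0 \<epsilon> by (intro \<theta>_eqI) (simp_all add: \<theta>_mult eP qe)
    have s\<epsilon>: "s \<otimes>\<^bsub>S\<^esub> \<epsilon> = s"
      using s0 \<epsilon> d scalar_closed[OF d(1)] scalar_central[OF d(1) \<epsilon>(1)]
      by (simp add: s_def S.m_assoc flip: scalar_central[OF d(1) \<epsilon>(1)]) (simp add: s0\<epsilon> flip: S.m_assoc)
    have AB: "internal_direct_sum S (regular_right_module S) A B"
      unfolding SS.internal_direct_sum_iff
    proof (intro conjI ballI A B)
      show "A \<inter> B = {\<zero>\<^bsub>regular_right_module S\<^esub>}" using \<epsilon> by (auto simp: A_def B_def)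
      fix x assume "x \<in> carrier (regular_right_module S)"
      then have x: "x \<in> carrier S" by simp
      have "\<epsilon> \<otimes>\<^bsub>S\<^esub> x \<in> A" using x \<epsilon> \<epsilon>\<epsilon> by (simp add: A_def flip: S.m_assoc)
      moreover have "x \<ominus>\<^bsub>S\<^esub> \<epsilon> \<otimes>\<^bsub>S\<^esub> x \<in> B"
        using x \<epsilon> \<epsilon>\<epsilon> by (simp add: B_def S.minus_eq S.r_distr S.r_minus S.r_neg flip: S.m_assoc)
      moreover have "x = \<epsilon> \<otimes>\<^bsub>S\<^esub> x \<oplus>\<^bsub>S\<^esub> (x \<ominus>\<^bsub>S\<^esub> \<epsilon> \<otimes>\<^bsub>S\<^esub> x)"
        using x \<epsilon> S.a_lcomm[of "\<epsilon> \<otimes>\<^bsub>S\<^esub> x" x "\<ominus>\<^bsub>S\<^esub> (\<epsilon> \<otimes>\<^bsub>S\<^esub> x)"]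
        by (simp add: S.minus_eq S.r_neg)
      ultimately show "\<exists>a\<in>A. \<exists>b\<in>B. x = a \<oplus>\<^bsub>regular_right_module S\<^esub> b" by auto
    qed
    define f where "f = (\<lambda>x\<in>A. s \<otimes>\<^bsub>S\<^esub> x)"
    have \<epsilon>s: "\<epsilon> \<otimes>\<^bsub>S\<^esub> s = \<zero>\<^bsub>S\<^esub>"
      using \<epsilon> s0 \<epsilon>s0 scalar_closed[OF d(1)] by (simp add: s_def flip: S.m_assoc)
    have f: "f \<in> rmod_hom S (regular_right_module S\<lparr>carrier := A\<rparr>) (regular_right_module S\<lparr>carrier := B\<rparr>)"
    proof (rule rmod_homI)
      fix x assume "x \<in> carrier (regular_right_module S\<lparr>carrier := A\<rparr>)"
      then have x: "x \<in> A" "x \<in> carrier S" by (auto simp: A_def)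
      have "\<epsilon> \<otimes>\<^bsub>S\<^esub> (s \<otimes>\<^bsub>S\<^esub> x) = \<zero>\<^bsub>S\<^esub>" using x \<epsilon> s \<epsilon>s by (simp flip: S.m_assoc)
      then show "f x \<in> carrier (regular_right_module S\<lparr>carrier := B\<rparr>)"
        using x s by (simp add: f_def B_def)
    qed (use A s in \<open>auto simp: f_def SS.submodule_iff S.r_distr S.m_assoc subset_iff\<close>)
    \<comment> \<open>If \<open>s x = 0\<close>, then \<open>q\<close> vanishes on the values of
      \<open>x\<close>, so \<open>\<epsilon> x = 0\<close>, while \<open>\<epsilon> x = x\<close> on
      \<open>A\<close>. Thus \<open>f\<close> has zero kernel.\<close>
    have "x = \<zero>\<^bsub>S\<^esub>" if x: "x \<in> A" "s \<otimes>\<^bsub>S\<^esub> x = \<zero>\<^bsub>S\<^esub>" for x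
    proof -
      have xS: "x \<in> carrier S" "\<epsilon> \<otimes>\<^bsub>S\<^esub> x = x" using x by (auto simp: A_def)
      have "\<epsilon> \<otimes>\<^bsub>S\<^esub> x = \<zero>\<^bsub>S\<^esub>"
      proof (rule \<theta>_eqI)
        fix p assume p: "p \<in> carrier P"
        have xp: "\<theta> x p \<in> carrier P" using \<theta>_closed xS p by blast
        have "(q (\<theta> x p) \<otimes> d) \<odot>\<^bsub>P\<^esub> b = \<zero>\<^bsub>P\<^esub>"
          using \<theta>s[OF xp] \<theta>_mult[OF s xS(1) p] x \<theta>_zero[OF p] by simp
        then have "q (\<theta> x p) \<otimes> d = \<zero>"
          using torsion_free[of "q (\<theta> x p) \<otimes> d" b] b b0 d qs(1)[OF xp] by blast
        then have "q (\<theta> x p) = \<zero>" using d qs(1)[OF xp] integral by blast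
        then have "e (\<theta> x p) = \<zero>\<^bsub>P\<^esub>" using econg[OF xp P.M.zero_closed] qs(4) e0 by simp
        then show "\<theta> (\<epsilon> \<otimes>\<^bsub>S\<^esub> x) p = \<theta> \<zero>\<^bsub>S\<^esub> p"
          using \<theta>_mult[OF \<epsilon>(1) xS(1) p] \<epsilon>(2) \<theta>_zero[OF p] by simp
      qed (use \<epsilon> xS in simp_all)
      then show ?thesis using xS by simp
    qed
    moreover have "\<zero>\<^bsub>S\<^esub> \<in> A" using \<epsilon> by (simp add: A_def)
    ultimately have "a_kernel (regular_right_module S\<lparr>carrier := A\<rparr>) (regular_right_module S\<lparr>carrier := B\<rparr>) f = {\<zero>\<^bsub>S\<^esub>}"
      using s by (auto simp: a_kernel_def' f_def)
    moreover have "direct_summand S (regular_right_module S\<lparr>carrier := A\<rparr>) {\<zero>\<^bsub>S\<^esub>}"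
      using right_module.direct_summand_zero[OF SS.submodule_right_module[OF A]] by simp
    ultimately have "direct_summand S (regular_right_module S\<lparr>carrier := B\<rparr>) (f ` A)"
      using C4 AB f unfolding right_C4_ring_def C4_module_def by simp
    then obtain C where C: "internal_direct_sum S (regular_right_module S\<lparr>carrier := B\<rparr>) (f ` A) C"
      by (auto simp: direct_summand_def)
    note C' = SS.internal_direct_sum_subD[OF B C]
    \<comment> \<open>Decompose \<open>s0 = s a + c\<close> along the supposed summand. Multiplying
      by \<open>d\<close> gives \<open>s = s a d + c d\<close>, so \<open>c d\<close> lies both in
      the image and in the complement. Hence \<open>c = 0\<close> and
      \<open>s0 = s a\<close>.\<close>
    have "s0 \<in> B" using s0(1) \<epsilon>s0 by (simp add: B_def)
    then obtain a c where a: "a \<in> A" and c: "c \<in> C" and s0_eq: "s0 = s \<otimes>\<^bsub>S\<^esub> a \<oplus>\<^bsub>S\<^esub> c"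
      using C'(6)[of s0] by (auto simp: f_def)
    have aS: "a \<in> carrier S" and cS: "c \<in> carrier S" using a c C'(4) by (auto simp: A_def B_def)
    let ?\<delta> = "scalar d"
    have \<delta>: "?\<delta> \<in> carrier S" using scalar_closed d by simp
    have "\<epsilon> \<in> A" using \<epsilon> \<epsilon>\<epsilon> by (simp add: A_def)
    moreover have "a \<otimes>\<^bsub>S\<^esub> ?\<delta> \<in> A" using A a \<delta> by (auto simp: SS.submodule_iff)
    moreover have "\<ominus>\<^bsub>S\<^esub> (a \<otimes>\<^bsub>S\<^esub> ?\<delta>) \<in> A"
      using \<epsilon> \<delta> aS a by (simp add: A_def S.r_minus flip: S.m_assoc)
    ultimately have "\<epsilon> \<ominus>\<^bsub>S\<^esub> a \<otimes>\<^bsub>S\<^esub> ?\<delta> \<in> A"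
      using A by (simp add: SS.submodule_iff S.minus_eq)
    \<comment> \<open>\<open>\<epsilon>\<close> replaces the identity: since
      \<open>s = s \<epsilon>\<close> and \<open>\<epsilon> \<in> A\<close>, the element
      \<open>s\<close> is a value of \<open>f\<close>.\<close>
    moreover have "c \<otimes>\<^bsub>S\<^esub> ?\<delta> = s \<otimes>\<^bsub>S\<^esub> (\<epsilon> \<ominus>\<^bsub>S\<^esub> a \<otimes>\<^bsub>S\<^esub> ?\<delta>)"
    proof -
      have sa: "s \<otimes>\<^bsub>S\<^esub> (a \<otimes>\<^bsub>S\<^esub> ?\<delta>) \<in> carrier S" "c \<otimes>\<^bsub>S\<^esub> ?\<delta> \<in> carrier S"
        using s aS cS \<delta> by simp_all
      have "s = (s \<otimes>\<^bsub>S\<^esub> a \<oplus>\<^bsub>S\<^esub> c) \<otimes>\<^bsub>S\<^esub> ?\<delta>"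
        unfolding s0_eq[symmetric] by (rule s_def)
      also have "\<dots> = s \<otimes>\<^bsub>S\<^esub> (a \<otimes>\<^bsub>S\<^esub> ?\<delta>) \<oplus>\<^bsub>S\<^esub> c \<otimes>\<^bsub>S\<^esub> ?\<delta>"
        using s aS cS \<delta> by (simp add: S.l_distr S.m_assoc)
      finally have "s \<ominus>\<^bsub>S\<^esub> s \<otimes>\<^bsub>S\<^esub> (a \<otimes>\<^bsub>S\<^esub> ?\<delta>) =
          (s \<otimes>\<^bsub>S\<^esub> (a \<otimes>\<^bsub>S\<^esub> ?\<delta>) \<oplus>\<^bsub>S\<^esub> c \<otimes>\<^bsub>S\<^esub> ?\<delta>) \<ominus>\<^bsub>S\<^esub> s \<otimes>\<^bsub>S\<^esub> (a \<otimes>\<^bsub>S\<^esub> ?\<delta>)"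
        by (rule arg_cong)
      also have "\<dots> = c \<otimes>\<^bsub>S\<^esub> ?\<delta>"
        using sa by (simp add: S.minus_eq S.a_comm[of _ "c \<otimes>\<^bsub>S\<^esub> ?\<delta>"] S.a_assoc S.r_neg)
      also have "s \<ominus>\<^bsub>S\<^esub> s \<otimes>\<^bsub>S\<^esub> (a \<otimes>\<^bsub>S\<^esub> ?\<delta>) = s \<otimes>\<^bsub>S\<^esub> (\<epsilon> \<ominus>\<^bsub>S\<^esub> a \<otimes>\<^bsub>S\<^esub> ?\<delta>)"
        using s \<epsilon>(1) aS \<delta> by (simp add: S.minus_eq S.r_distr S.r_minus s\<epsilon>)
      finally show ?thesis by (rule sym)
    qed
    ultimately have "c \<otimes>\<^bsub>S\<^esub> ?\<delta> \<in> f ` A"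
      by (intro image_eqI[of _ _ "\<epsilon> \<ominus>\<^bsub>S\<^esub> a \<otimes>\<^bsub>S\<^esub> ?\<delta>"]) (simp_all add: f_def)
    moreover have "c \<otimes>\<^bsub>S\<^esub> ?\<delta> \<in> C"
      using C'(3) c \<delta> by (auto simp: SS.submodule_iff)
    ultimately have "c \<otimes>\<^bsub>S\<^esub> ?\<delta> \<in> f ` A \<inter> C" by blast
    then have "c \<otimes>\<^bsub>S\<^esub> ?\<delta> = \<zero>\<^bsub>S\<^esub>" using C'(5) by simp
    then have "c = \<zero>\<^bsub>S\<^esub>" using scalar_cancel d cS by blast
    then have s0_eq': "s0 = s \<otimes>\<^bsub>S\<^esub> a" using s0_eq s aS by simp
    show False
    \<comment> \<open>Cancelling \<open>b\<close> in \<open>s0 = s a\<close> gives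
      \<open>q p = q (a p) d\<close>.\<close>
    proof (rule image_not_divisible[OF q p0 d(1,3)])
      fix p assume p: "p \<in> carrier P"
      have ap: "\<theta> a p \<in> carrier P" using \<theta>_closed aS p by blast
      have "q p \<odot>\<^bsub>P\<^esub> b = (q (\<theta> a p) \<otimes> d) \<odot>\<^bsub>P\<^esub> b"
        using s0(2)[OF p] \<theta>s[OF ap] \<theta>_mult[OF s aS p] s0_eq' by simp
      then have "q p = q (\<theta> a p) \<otimes> d"
        using smult_cancel[of "q p" "q (\<theta> a p) \<otimes> d" b] qs(1)[OF p] qs(1)[OF ap] d b b0 by blast
      then show "\<exists>p'\<in>carrier P. q p = q p' \<otimes> d" using ap by blast
    qed
  qed
  then have kernel: "\<And>b. b \<in> carrier P \<Longrightarrow> q b = \<zero> \<Longrightarrow> b = \<zero>\<^bsub>P\<^esub>" .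
  have "inj_on q (carrier P)"
  proof (rule inj_onI)
    fix x y assume xy: "x \<in> carrier P" "y \<in> carrier P" "q x = q y"
    have "q (x \<oplus>\<^bsub>P\<^esub> (\<ominus> \<one>) \<odot>\<^bsub>P\<^esub> y) = \<zero>"
      using xy P.smult_closed[of "\<ominus> \<one>" y] by (simp add: qs r_minus r_neg)
    then have "x \<oplus>\<^bsub>P\<^esub> (\<ominus>\<^bsub>P\<^esub> y) = \<zero>\<^bsub>P\<^esub>"
      using kernel[of "x \<oplus>\<^bsub>P\<^esub> (\<ominus>\<^bsub>P\<^esub> y)"] xy by (simp add: P.smult_minus_one)
    then have "\<ominus>\<^bsub>P\<^esub> (\<ominus>\<^bsub>P\<^esub> y) = x" using xy by (intro P.M.minus_equality) simp_all
    then show "x = y" using xy by simp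
  qed
  then show ?thesis using iso_if_scalars endo_of_ideal_scalar[OF q p0] by blast
qed

end

section \<open>Morita equivalence with a domain\<close>

lemma rmod_iso_inverse:
  assumes "right_module R M" "right_module R N" "\<phi> \<in> rmod_iso R M N"
  obtains \<psi> where "\<psi> \<in> rmod_hom R N M" "\<And>x. x \<in> carrier M \<Longrightarrow> \<psi> (\<phi> x) = x"
    "\<And>y. y \<in> carrier N \<Longrightarrow> \<phi> (\<psi> y) = y"
proof -
  interpret M: right_module R M by fact
  interpret N: right_module R N by fact
  have \<phi>: "\<phi> \<in> rmod_hom R M N" and bij: "bij_betw \<phi> (carrier M) (carrier N)"
    using assms(3) by (auto simp: rmod_iso_def)
  define \<psi> where "\<psi> = (\<lambda>y\<in>carrier N. inv_into (carrier M) \<phi> y)"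
  have \<psi>M: "\<psi> y \<in> carrier M" and \<phi>\<psi>: "\<phi> (\<psi> y) = y" if "y \<in> carrier N" for y
    using that bij by (auto simp: \<psi>_def bij_betw_def inv_into_into f_inv_into_f)
  have \<psi>\<phi>: "\<psi> (\<phi> x) = x" if "x \<in> carrier M" for x
    using that bij rmod_homD(2)[OF \<phi> that] by (simp add: \<psi>_def bij_betw_def)
  have "\<psi> \<in> rmod_hom R N M"
  proof (rule rmod_homI)
    fix x y assume xy: "x \<in> carrier N" "y \<in> carrier N"
    have "\<psi> (\<phi> (\<psi> x \<oplus>\<^bsub>M\<^esub> \<psi> y)) = \<psi> x \<oplus>\<^bsub>M\<^esub> \<psi> y" using xy \<psi>M by (intro \<psi>\<phi>) simp
    then show "\<psi> (x \<oplus>\<^bsub>N\<^esub> y) = \<psi> x \<oplus>\<^bsub>M\<^esub> \<psi> y"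
      using rmod_homD(3)[OF \<phi> \<psi>M[OF xy(1)] \<psi>M[OF xy(2)]] \<phi>\<psi> xy by simp
  next
    fix a x assume ax: "a \<in> carrier R" "x \<in> carrier N"
    have "\<psi> (\<phi> (a \<odot>\<^bsub>M\<^esub> \<psi> x)) = a \<odot>\<^bsub>M\<^esub> \<psi> x" using ax \<psi>M by (intro \<psi>\<phi> M.smult_closed) simp_all
    then show "\<psi> (a \<odot>\<^bsub>N\<^esub> x) = a \<odot>\<^bsub>M\<^esub> \<psi> x"
      using rmod_homD(4)[OF \<phi> ax(1) \<psi>M[OF ax(2)]] \<phi>\<psi> ax by simp
  qed (simp_all add: \<psi>M, simp add: \<psi>_def)
  then show ?thesis using \<psi>\<phi> \<phi>\<psi> by (rule that)
qed

lemma rmod_nat_isoD: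
  assumes "rmod_nat_iso R S F f G g \<eta>" "right_module R M" "right_module R N"
    and "h \<in> rmod_hom R M N" "x \<in> carrier (F M)"
  shows "g M N h (\<eta> M x) = \<eta> N (f M N h x)"
proof -
  have "compose (carrier (F M)) (g M N h) (\<eta> M) = compose (carrier (F M)) (\<eta> N) (f M N h)"
    using assms(1-4) unfolding rmod_nat_iso_def by blast
  from fun_cong[OF this, of x] show ?thesis using assms(5) by (simp add: compose_def)
qed

text \<open>\<open>\<eta>\<close> makes \<open>F\<close> faithful and \<open>\<epsilon>\<close>
  makes \<open>G\<close> faithful. A preimage of \<open>k\<close> is \<open>G k\<close> conjugated
  by \<open>\<eta>\<close>: its image under \<open>F\<close> agrees with \<open>k\<close> after
  applying \<open>G\<close>.\<close>

lemma full_faithful_if_equivalence: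
  assumes F: "rmod_functor R S F f" and G: "rmod_functor S R G g"
    and \<eta>: "rmod_nat_iso R R (\<lambda>M. M) (\<lambda>M N h. h) (\<lambda>M. G (F M)) (\<lambda>M N h. g (F M) (F N) (f M N h)) \<eta>"
    and \<epsilon>: "rmod_nat_iso S S (\<lambda>M. F (G M)) (\<lambda>M N h. f (G M) (G N) (g M N h)) (\<lambda>M. M) (\<lambda>M N h. h) \<epsilon>"
  shows "full_faithful_functor R S F f"
proof
  show "rmod_functor R S F f" by fact
next
  fix M N h h'
  assume M: "right_module R M" and N: "right_module R N" and h: "h \<in> rmod_hom R M N"
    and h': "h' \<in> rmod_hom R M N" and eq: "f M N h = f M N h'"
  have nat: "g (F M) (F N) (f M N k) (\<eta> M x) = \<eta> N (k x)" if "k \<in> rmod_hom R M N" "x \<in> carrier M" for k x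
    using rmod_nat_isoD[OF \<eta> M N that] .
  have "inj_on (\<eta> N) (carrier N)" using \<eta> N by (simp add: rmod_nat_iso_def rmod_iso_def bij_betw_def)
  then show "h = h'"
    using nat[OF h] nat[OF h'] eq rmod_homD(2)[OF h] rmod_homD(2)[OF h']
    by (intro rmod_hom_eqI[OF h h']) (auto simp: inj_on_def)
next
  fix M N k
  assume M: "right_module R M" and N: "right_module R N" and k: "k \<in> rmod_hom S (F M) (F N)"
  have FM: "right_module S (F M)" and FN: "right_module S (F N)"
    using F M N by (simp_all add: rmod_functor_def)
  have GFM: "right_module R (G (F M))" and GFN: "right_module R (G (F N))"
    using G FM FN by (simp_all add: rmod_functor_def)
  have G_hom: "g (F M) (F N) l \<in> rmod_hom R (G (F M)) (G (F N))" if "l \<in> rmod_hom S (F M) (F N)" for l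
    using G FM FN that unfolding rmod_functor_def by blast
  have F_hom: "f M N h \<in> rmod_hom S (F M) (F N)" if "h \<in> rmod_hom R M N" for h
    using F M N that unfolding rmod_functor_def by blast
  have G_faithful: "l = l'" if l: "l \<in> rmod_hom S (F M) (F N)" and l': "l' \<in> rmod_hom S (F M) (F N)"
    and eq: "g (F M) (F N) l = g (F M) (F N) l'" for l l'
  proof (rule rmod_hom_eqI[OF l l'])
    fix y assume "y \<in> carrier (F M)"
    then obtain z where z: "z \<in> carrier (F (G (F M)))" "y = \<epsilon> (F M) z"
      using \<epsilon> FM unfolding rmod_nat_iso_def rmod_iso_def bij_betw_def by blast
    have "l (\<epsilon> (F M) z) = \<epsilon> (F N) (f (G (F M)) (G (F N)) (g (F M) (F N) l) z)"
      if "l \<in> rmod_hom S (F M) (F N)" for l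
      using rmod_nat_isoD[OF \<epsilon> FM FN that z(1)] .
    from this[OF l] this[OF l'] show "l y = l' y" using eq z by simp
  qed
  have iso: "\<eta> M \<in> rmod_iso R M (G (F M))" "\<eta> N \<in> rmod_iso R N (G (F N))"
    using \<eta> M N by (simp_all add: rmod_nat_iso_def)
  have \<eta>M: "\<eta> M \<in> rmod_hom R M (G (F M))" using iso by (simp add: rmod_iso_def)
  obtain \<psi> where \<psi>: "\<psi> \<in> rmod_hom R (G (F N)) N" "\<And>y. y \<in> carrier (G (F N)) \<Longrightarrow> \<eta> N (\<psi> y) = y"
    using rmod_iso_inverse[OF N GFN iso(2)] by metis
  define h where "h = compose (carrier M) \<psi> (compose (carrier M) (g (F M) (F N) k) (\<eta> M))"
  have h: "h \<in> rmod_hom R M N"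
    unfolding h_def by (rule rmod_hom_compose[OF rmod_hom_compose[OF \<eta>M G_hom[OF k] M] \<psi>(1) M])
  have "g (F M) (F N) (f M N h) = g (F M) (F N) k"
  proof (rule rmod_hom_eqI[OF G_hom[OF F_hom[OF h]] G_hom[OF k]])
    fix y assume "y \<in> carrier (G (F M))"
    then obtain x where x: "x \<in> carrier M" "y = \<eta> M x"
      using iso(1) unfolding rmod_iso_def bij_betw_def by blast
    have "g (F M) (F N) (f M N h) (\<eta> M x) = \<eta> N (h x)"
      using rmod_nat_isoD[OF \<eta> M N h x(1)] .
    also have "\<dots> = g (F M) (F N) k (\<eta> M x)"
      using x(1) \<psi>(2) rmod_homD(2)[OF G_hom[OF k] rmod_homD(2)[OF \<eta>M x(1)]]
      by (simp add: h_def compose_def)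
    finally show "g (F M) (F N) (f M N h) y = g (F M) (F N) k y" using x by simp
  qed
  then have "f M N h = k" by (rule G_faithful[OF F_hom[OF h] k])
  then show "\<exists>h\<in>rmod_hom R M N. f M N h = k" using h by blast
qed

section \<open>The regular module in the universe and its points\<close>

text \<open>
  \<open>U\<close> is a copy in the universe of the regular module, and \<open>Q\<close> is the module that \<open>F\<close> maps to the
  regular module of \<open>D\<close>.
\<close>

locale regular_preimage = domain D + S: ring S + full_faithful_functor S D F f
  for D :: "('d, 'x) ring_scheme" (structure) and S :: "('s, 'y) ring_scheme"
    and F :: "('s, 'u, 'd) rmod_objmap" and f +
  fixes i :: "'s \<Rightarrow> 'u" and Q :: "('s, 'u) module" and \<epsilon> :: "'u \<Rightarrow> 'd"
  assumes infinite_univ: "infinite (UNIV :: 'u set)"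
    and i_inj: "inj_on i (carrier S)"
    and Q: "right_module S Q"
    and \<epsilon>: "\<epsilon> \<in> rmod_iso D (F Q) (regular_right_module D)"
begin

definition U :: "('s, 'u) module" where
  "U = image_module i (regular_right_module S)"

definition \<kappa> :: "'u \<Rightarrow> 's" where
  "\<kappa> u = inv_into (carrier S) i u"

lemma U: "right_module S U"
  unfolding U_def using image_module_inj(1)[OF regular_right_module[OF S.ring_axioms]] i_inj by simp

lemma carrier_U: "carrier U = i ` carrier S"
  by (simp add: U_def)

lemma i_closed: "s \<in> carrier S \<Longrightarrow> i s \<in> carrier U"
  by (simp add: carrier_U)

lemma \<kappa>_i: "s \<in> carrier S \<Longrightarrow> \<kappa> (i s) = s"
  using i_inj by (simp add: \<kappa>_def)

lemma i_\<kappa>: "u \<in> carrier U \<Longrightarrow> i (\<kappa> u) = u"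
  by (simp add: \<kappa>_def carrier_U f_inv_into_f)

lemma \<kappa>_closed: "u \<in> carrier U \<Longrightarrow> \<kappa> u \<in> carrier S"
  by (simp add: \<kappa>_def carrier_U inv_into_into)

lemma U_add: "\<lbrakk>s \<in> carrier S; t \<in> carrier S\<rbrakk> \<Longrightarrow> i s \<oplus>\<^bsub>U\<^esub> i t = i (s \<oplus>\<^bsub>S\<^esub> t)"
  using i_inj by (simp add: U_def image_module_def)

lemma U_smult: "\<lbrakk>a \<in> carrier S; s \<in> carrier S\<rbrakk> \<Longrightarrow> a \<odot>\<^bsub>U\<^esub> i s = i (s \<otimes>\<^bsub>S\<^esub> a)"
  using i_inj by (simp add: U_def image_module_def)

text \<open>A morphism from the free module \<open>U\<close> is determined by the image of the copy
  of \<open>1\<close>; this one sends it to \<open>y\<close>. In particular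
  \<open>pt U (i s)\<close> is left multiplication by \<open>s\<close>.\<close>

definition pt :: "('s, 'u) module \<Rightarrow> 'u \<Rightarrow> 'u \<Rightarrow> 'u" where
  "pt N y = (\<lambda>u\<in>carrier U. \<kappa> u \<odot>\<^bsub>N\<^esub> y)"

lemma pt_i: "s \<in> carrier S \<Longrightarrow> pt N y (i s) = s \<odot>\<^bsub>N\<^esub> y"
  by (simp add: pt_def i_closed \<kappa>_i)

lemma U_cases:
  assumes "u \<in> carrier U"
  obtains s where "s \<in> carrier S" "u = i s"
  using assms by (auto simp: carrier_U)

lemma pt_hom:
  assumes "right_module S N" "y \<in> carrier N"
  shows "pt N y \<in> rmod_hom S U N"
proof -
  interpret N: right_module S N by fact
  show ?thesis
  proof (rule rmod_homI)
    show "pt N y \<in> extensional (carrier U)" by (simp add: pt_def)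
    fix u assume "u \<in> carrier U"
    then obtain s where s: "s \<in> carrier S" "u = i s" by (rule U_cases)
    show "pt N y u \<in> carrier N" using s assms(2) by (simp add: pt_i N.smult_closed)
    show "pt N y (u \<oplus>\<^bsub>U\<^esub> v) = pt N y u \<oplus>\<^bsub>N\<^esub> pt N y v" if "v \<in> carrier U" for v
    proof -
      from that obtain t where "t \<in> carrier S" "v = i t" by (auto simp: carrier_U)
      then show ?thesis using s assms(2) by (simp add: pt_i U_add N.smult_distr_ring)
    qed
    show "pt N y (a \<odot>\<^bsub>U\<^esub> u) = a \<odot>\<^bsub>N\<^esub> pt N y u" if "a \<in> carrier S" for a
      using that s assms(2) by (simp add: pt_i U_smult N.smult_assoc)
  qed
qed

lemma pt_unique:
  assumes N: "right_module S N" and h: "h \<in> rmod_hom S U N"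
  shows "h = pt N (h (i \<one>\<^bsub>S\<^esub>))"
proof (rule rmod_hom_eqI[OF h pt_hom[OF N]])
  show "h (i \<one>\<^bsub>S\<^esub>) \<in> carrier N" using rmod_homD(2)[OF h] by (simp add: i_closed)
  fix u assume "u \<in> carrier U"
  then obtain s where s: "s \<in> carrier S" "u = i s" by (rule U_cases)
  have "h (s \<odot>\<^bsub>U\<^esub> i \<one>\<^bsub>S\<^esub>) = s \<odot>\<^bsub>N\<^esub> h (i \<one>\<^bsub>S\<^esub>)"
    using rmod_homD(4)[OF h] s by (simp add: i_closed)
  then show "h u = pt N (h (i \<one>\<^bsub>S\<^esub>)) u" using s by (simp add: pt_i U_smult)
qed

lemma pt_one: "right_module S N \<Longrightarrow> y \<in> carrier N \<Longrightarrow> pt N y (i \<one>\<^bsub>S\<^esub>) = y"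
  by (simp add: pt_i right_module.smult_one)

abbreviation P :: "('d, 'u) module" where "P \<equiv> F U"

lemma P: "right_module D P"
  by (rule F_obj[OF U])

lemma FQ: "right_module D (F Q)"
  by (rule F_obj[OF Q])

lemma \<epsilon>_hom: "\<epsilon> \<in> rmod_hom D (F Q) (regular_right_module D)"
  using \<epsilon> by (simp add: rmod_iso_def)

lemma \<epsilon>_zero_iff: "y \<in> carrier (F Q) \<Longrightarrow> \<epsilon> y = \<zero> \<longleftrightarrow> y = \<zero>\<^bsub>F Q\<^esub>"
proof -
  interpret FQ: right_module D "F Q" by (rule FQ)
  have "\<epsilon> \<zero>\<^bsub>F Q\<^esub> = \<zero>"
    using FQ.rmod_hom_zero[OF regular_right_module[OF ring_axioms] \<epsilon>_hom] by simp
  then show "y \<in> carrier (F Q) \<Longrightarrow> \<epsilon> y = \<zero> \<longleftrightarrow> y = \<zero>\<^bsub>F Q\<^esub>"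
    using \<epsilon> FQ.M.zero_closed unfolding rmod_iso_def bij_betw_def inj_on_def by force
qed

lemma \<epsilon>_unit: obtains y1 where "y1 \<in> carrier (F Q)" "\<epsilon> y1 = \<one>"
proof -
  have "\<one> \<in> \<epsilon> ` carrier (F Q)" using \<epsilon> by (simp add: rmod_iso_def bij_betw_def)
  then show ?thesis using that by (metis imageE)
qed

text \<open>\<open>F Q\<close> is free on the element that \<open>\<epsilon>\<close> sends to
  \<open>1\<close>, so \<open>p\<close> is a value of a morphism from \<open>F Q\<close> to
  \<open>P\<close>, and fullness lifts that morphism.\<close>

lemma lift_point:
  assumes p: "p \<in> carrier P"
  obtains k where "k \<in> rmod_hom S Q U" "\<And>y. y \<in> carrier (F Q) \<Longrightarrow> f Q U k y = \<epsilon> y \<odot>\<^bsub>P\<^esub> p"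
proof -
  interpret P: right_module D P by (rule P)
  interpret FQ: right_module D "F Q" by (rule FQ)
  have "(\<lambda>y\<in>carrier (F Q). \<epsilon> y \<odot>\<^bsub>P\<^esub> p) \<in> rmod_hom D (F Q) P"
    using rmod_homD[OF \<epsilon>_hom] p
    by (intro rmod_homI) (simp_all add: P.smult_closed FQ.smult_closed P.smult_distr_ring P.smult_assoc)
  then obtain k where "k \<in> rmod_hom S Q U" "f Q U k = (\<lambda>y\<in>carrier (F Q). \<epsilon> y \<odot>\<^bsub>P\<^esub> p)"
    using full[OF Q U] by blast
  then show ?thesis by (intro that[of k]) simp_all
qed

section \<open>The generator property of \<open>Q\<close> and separation of points\<close>

text \<open>
  The morphisms from \<open>Q\<close> to \<open>U\<close> are jointly epimorphic, as those from the regular module of \<open>D\<close> to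
  \<open>P\<close> are.
\<close>

lemma trace_full:
  assumes T: "submodule T S U" and trace: "\<And>t y. \<lbrakk>t \<in> rmod_hom S Q U; y \<in> carrier Q\<rbrakk> \<Longrightarrow> t y \<in> T"
  shows "T = carrier U"
proof -
  interpret U: right_module S U by (rule U)
  obtain N :: "('s, 'u) module" and \<pi> where N: "right_module S N" and \<pi>: "\<pi> \<in> rmod_hom S U N"
    and ker: "\<And>u. u \<in> carrier U \<Longrightarrow> \<pi> u = \<zero>\<^bsub>N\<^esub> \<longleftrightarrow> u \<in> T"
    using U.quotient_module[OF T] by blast
  note zero = rmod_hom_const_zero[OF U N]
  interpret P: right_module D P by (rule P)
  obtain y1 where y1: "y1 \<in> carrier (F Q)" "\<epsilon> y1 = \<one>" by (rule \<epsilon>_unit)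
  \<comment> \<open>Each \<open>p\<close> is the value at \<open>y1\<close> of the image of some
    \<open>k : Q \<rightarrow> U\<close>, and the quotient map \<open>\<pi>\<close> kills the values
    of \<open>k\<close>. So the image of \<open>\<pi>\<close> is zero, and faithfulness
    applies.\<close>
  have "f U N \<pi> = f U N (\<lambda>u\<in>carrier U. \<zero>\<^bsub>N\<^esub>)"
  proof (rule rmod_hom_eqI[OF F_hom[OF U N \<pi>] F_hom[OF U N zero]])
    fix p assume p: "p \<in> carrier P"
    obtain k where k: "k \<in> rmod_hom S Q U"
      and fk: "\<And>y. y \<in> carrier (F Q) \<Longrightarrow> f Q U k y = \<epsilon> y \<odot>\<^bsub>P\<^esub> p"
      using lift_point[OF p] by blast
    note \<pi>k = rmod_hom_compose[OF k \<pi> Q]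
    have "f U N \<pi> p = f U N \<pi> (f Q U k y1)" using fk[OF y1(1)] y1 p by (simp add: P.smult_one)
    also have "\<dots> = f Q N (compose (carrier Q) \<pi> k) y1"
      by (rule F_comp[OF Q U N k \<pi> \<pi>k _ y1(1), symmetric]) (simp add: compose_def)
    also have "\<dots> = \<zero>\<^bsub>F N\<^esub>"
      using trace[OF k] ker rmod_homD(2)[OF k]
      by (intro F_zero[OF Q N \<pi>k _ y1(1)]) (simp add: compose_def)
    also have "\<dots> = f U N (\<lambda>u\<in>carrier U. \<zero>\<^bsub>N\<^esub>) p"
      using F_zero[OF U N zero _ p] by simp
    finally show "f U N \<pi> p = f U N (\<lambda>u\<in>carrier U. \<zero>\<^bsub>N\<^esub>) p" .
  qed
  then have "\<pi> = (\<lambda>u\<in>carrier U. \<zero>\<^bsub>N\<^esub>)" by (rule faithful[OF U N \<pi> zero])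
  then have "u \<in> T" if "u \<in> carrier U" for u using ker[OF that] that by simp
  moreover have "T \<subseteq> carrier U" using T by (simp add: U.submodule_iff)
  ultimately show ?thesis by blast
qed

lemma functionals_separate:
  assumes p: "p \<in> carrier P" "p \<noteq> \<zero>\<^bsub>P\<^esub>"
  shows "\<exists>q\<in>rmod_hom D P (regular_right_module D). q p \<noteq> \<zero>"
proof (rule ccontr)
  assume "\<not> ?thesis"
  then have qp: "q p = \<zero>" if "q \<in> rmod_hom D P (regular_right_module D)" for q using that by blast
  interpret U: right_module S U by (rule U)
  interpret Q: right_module S Q by (rule Q)
  interpret P: right_module D P by (rule P)
  interpret FQ: right_module D "F Q" by (rule FQ)
  obtain y1 where y1: "y1 \<in> carrier (F Q)" "\<epsilon> y1 = \<one>" by (rule \<epsilon>_unit)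
  obtain k where k: "k \<in> rmod_hom S Q U"
    and fk: "\<And>y. y \<in> carrier (F Q) \<Longrightarrow> f Q U k y = \<epsilon> y \<odot>\<^bsub>P\<^esub> p"
    using lift_point[OF p(1)] by blast
  note zero = rmod_hom_const_zero[OF Q Q]
  \<comment> \<open>The image of \<open>x\<close> followed by \<open>\<epsilon>\<close> is a
    functional on \<open>P\<close>, so it vanishes at \<open>p\<close>. Hence the image of
    \<open>x k\<close> is zero.\<close>
  have xk: "x (k w) = \<zero>\<^bsub>Q\<^esub>" if x: "x \<in> rmod_hom S U Q" and w: "w \<in> carrier Q" for x w
  proof -
    note xk_hom = rmod_hom_compose[OF k x Q] and fx = F_hom[OF U Q x]
    have "compose (carrier P) \<epsilon> (f U Q x) p = \<zero>"
      by (rule qp[OF rmod_hom_compose[OF fx \<epsilon>_hom P]])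
    then have fxp: "f U Q x p = \<zero>\<^bsub>F Q\<^esub>"
      using p \<epsilon>_zero_iff[OF rmod_homD(2)[OF fx p(1)]] by (simp add: compose_def)
    have "f Q Q (compose (carrier Q) x k) = f Q Q (\<lambda>w\<in>carrier Q. \<zero>\<^bsub>Q\<^esub>)"
    proof (rule rmod_hom_eqI[OF F_hom[OF Q Q xk_hom] F_hom[OF Q Q zero]])
      fix y assume y: "y \<in> carrier (F Q)"
      have \<epsilon>y: "\<epsilon> y \<in> carrier D" using rmod_homD(2)[OF \<epsilon>_hom y] by simp
      have "f Q Q (compose (carrier Q) x k) y = f U Q x (f Q U k y)"
        by (rule F_comp[OF Q U Q k x xk_hom _ y]) (simp add: compose_def)
      also have "\<dots> = \<epsilon> y \<odot>\<^bsub>F Q\<^esub> f U Q x p"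
        unfolding fk[OF y] by (rule rmod_homD(4)[OF fx \<epsilon>y p(1)])
      also have "\<dots> = f Q Q (\<lambda>w\<in>carrier Q. \<zero>\<^bsub>Q\<^esub>) y"
        using F_zero[OF Q Q zero _ y] \<epsilon>y by (simp add: fxp FQ.smult_zero_right)
      finally show "f Q Q (compose (carrier Q) x k) y = f Q Q (\<lambda>w\<in>carrier Q. \<zero>\<^bsub>Q\<^esub>) y" .
    qed
    then have "compose (carrier Q) x k = (\<lambda>w\<in>carrier Q. \<zero>\<^bsub>Q\<^esub>)"
      by (rule faithful[OF Q Q xk_hom zero])
    then show ?thesis using w by (metis compose_eq restrict_apply')
  qed
  \<comment> \<open>\<open>K\<close> collects the morphisms annihilated by every morphism back to
    \<open>Q\<close>. Read in \<open>S\<close>, the set \<open>T\<close> defined next is the left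
    annihilator of all their values.\<close>
  define K where "K = {k \<in> rmod_hom S Q U. \<forall>x\<in>rmod_hom S U Q. \<forall>w\<in>carrier Q. x (k w) = \<zero>\<^bsub>Q\<^esub>}"
  define T where "T = {z \<in> carrier U. \<forall>k\<in>K. \<forall>w\<in>carrier Q. pt U z (k w) = \<zero>\<^bsub>U\<^esub>}"
  have KU: "k w \<in> carrier U" if "k \<in> K" "w \<in> carrier Q" for k w
    using that rmod_homD(2)[of k] by (auto simp: K_def)
  have pt_eq: "pt U z u = \<kappa> u \<odot>\<^bsub>U\<^esub> z" if "u \<in> carrier U" for u z
    using that by (simp add: pt_def)
  have "submodule T S U"
    unfolding U.submodule_iff
  proof (intro conjI ballI)
    show "T \<subseteq> carrier U" by (auto simp: T_def)
    show "\<zero>\<^bsub>U\<^esub> \<in> T" by (simp add: T_def pt_eq KU \<kappa>_closed U.smult_zero_right)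
    show "z \<oplus>\<^bsub>U\<^esub> z' \<in> T" if "z \<in> T" "z' \<in> T" for z z'
      using that by (simp add: T_def pt_eq KU \<kappa>_closed U.smult_distr_module)
    show "a \<odot>\<^bsub>U\<^esub> z \<in> T" if a: "a \<in> carrier S" and z: "z \<in> T" for a z
    proof -
      have zU: "z \<in> carrier U" using z by (simp add: T_def)
      have "pt U (a \<odot>\<^bsub>U\<^esub> z) (k w) = \<zero>\<^bsub>U\<^esub>" if k: "k \<in> K" and w: "w \<in> carrier Q" for k w
      proof -
        have kh: "k \<in> rmod_hom S Q U" using k by (simp add: K_def)
        note ah = pt_hom[OF U i_closed[OF a]]
        \<comment> \<open>\<open>K\<close> is stable under left multiplication by \<open>a\<close>.
          This is what makes \<open>T\<close> a right ideal, and why \<open>T\<close> is formed with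
          all of \<open>K\<close> instead of the single \<open>k\<close>.\<close>
        have "compose (carrier Q) (pt U (i a)) k \<in> K"
          unfolding K_def
        proof (intro CollectI conjI ballI)
          show "compose (carrier Q) (pt U (i a)) k \<in> rmod_hom S Q U"
            by (rule rmod_hom_compose[OF kh ah Q])
          fix x v assume x: "x \<in> rmod_hom S U Q" and v: "v \<in> carrier Q"
          have "compose (carrier U) x (pt U (i a)) (k v) = \<zero>\<^bsub>Q\<^esub>"
            using k v rmod_hom_compose[OF ah x U] by (simp add: K_def)
          then show "x (compose (carrier Q) (pt U (i a)) k v) = \<zero>\<^bsub>Q\<^esub>"
            using v KU[OF k v] by (simp add: compose_def)
        qed
        then have "pt U z (pt U (i a) (k w)) = \<zero>\<^bsub>U\<^esub>"
          using z w by (auto simp: T_def compose_def)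
        moreover obtain s where s: "s \<in> carrier S" "k w = i s" using KU[OF k w] by (rule U_cases)
        ultimately show ?thesis
          using a zU by (simp add: pt_i U_smult U.smult_assoc)
      qed
      then show ?thesis using a zU by (simp add: T_def U.smult_closed)
    qed
  qed
  moreover have "t y \<in> T" if t: "t \<in> rmod_hom S Q U" and y: "y \<in> carrier Q" for t y
  proof -
    have "pt U (t y) (k w) = \<zero>\<^bsub>U\<^esub>" if k: "k \<in> K" and w: "w \<in> carrier Q" for k w
    proof -
      \<comment> \<open>\<open>t\<close> commutes with multiplication from the right, and
        \<open>pt Q y\<close> is a morphism from \<open>U\<close> to \<open>Q\<close>, so it kills
        \<open>k w\<close>.\<close>
      have "pt U (t y) (k w) = t (pt Q y (k w))"
        using rmod_homD(4)[OF t \<kappa>_closed[OF KU[OF k w]] y] KU[OF k w] by (simp add: pt_def)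
      also have "\<dots> = \<zero>\<^bsub>U\<^esub>"
        using k w pt_hom[OF Q y] Q.rmod_hom_zero[OF U t] by (simp add: K_def)
      finally show ?thesis .
    qed
    then show ?thesis using rmod_homD(2)[OF t y] by (simp add: T_def)
  qed
  ultimately have "T = carrier U" by (rule trace_full)
  \<comment> \<open>Now the copy of \<open>1\<close> annihilates every \<open>k w\<close>, which
    makes \<open>k\<close> zero.\<close>
  then have "i \<one>\<^bsub>S\<^esub> \<in> T" by (simp add: i_closed)
  moreover have "k \<in> K" using k xk by (simp add: K_def)
  ultimately have "pt U (i \<one>\<^bsub>S\<^esub>) (k w) = \<zero>\<^bsub>U\<^esub>" if "w \<in> carrier Q" for w
    using that by (simp add: T_def)
  moreover have "pt U (i \<one>\<^bsub>S\<^esub>) (k w) = k w" if "w \<in> carrier Q" for w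
    using rmod_homD(2)[OF k that] \<kappa>_closed[OF rmod_homD(2)[OF k that]] by (simp add: pt_eq U_smult i_\<kappa>)
  ultimately have "k w = \<zero>\<^bsub>U\<^esub>" if "w \<in> carrier Q" for w
    using that by simp
  then have "f Q U k y1 = \<zero>\<^bsub>P\<^esub>" by (rule F_zero[OF Q U k _ y1(1)])
  then show False using fk[OF y1(1)] y1 p by (simp add: P.smult_one)
qed

text \<open>If \<open>P\<close> were zero, faithfulness would kill every \<open>pt Q y\<close> and
  hence \<open>Q\<close>, although \<open>F Q\<close> is a copy of \<open>D\<close>, where
  \<open>1 \<noteq> 0\<close>.\<close>

lemma P_nonzero: "carrier P \<noteq> {\<zero>\<^bsub>P\<^esub>}"
proof
  assume P0: "carrier P = {\<zero>\<^bsub>P\<^esub>}"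
  interpret P: right_module D P by (rule P)
  interpret Q: right_module S Q by (rule Q)
  have Q0: "y = \<zero>\<^bsub>Q\<^esub>" if y: "y \<in> carrier Q" for y
  proof -
    note zero = rmod_hom_const_zero[OF U Q] and h = pt_hom[OF Q y]
    have "f U Q (pt Q y) = f U Q (\<lambda>u\<in>carrier U. \<zero>\<^bsub>Q\<^esub>)"
    proof (rule rmod_hom_eqI[OF F_hom[OF U Q h] F_hom[OF U Q zero]])
      fix p assume "p \<in> carrier P"
      then show "f U Q (pt Q y) p = f U Q (\<lambda>u\<in>carrier U. \<zero>\<^bsub>Q\<^esub>) p"
        using P0 P.rmod_hom_zero[OF FQ F_hom[OF U Q h]] P.rmod_hom_zero[OF FQ F_hom[OF U Q zero]] by simp
    qed
    then have "pt Q y = (\<lambda>u\<in>carrier U. \<zero>\<^bsub>Q\<^esub>)" by (rule faithful[OF U Q h zero])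
    then have "pt Q y (i \<one>\<^bsub>S\<^esub>) = \<zero>\<^bsub>Q\<^esub>" by (simp add: i_closed)
    then show ?thesis using pt_one[OF Q y] by simp
  qed
  obtain y1 where y1: "y1 \<in> carrier (F Q)" "\<epsilon> y1 = \<one>" by (rule \<epsilon>_unit)
  note id = rmod_hom_id[OF Q]
  have "f Q Q (\<lambda>y\<in>carrier Q. y) y1 = y1" by (rule F_id[OF Q id _ y1(1)]) simp
  moreover have "f Q Q (\<lambda>y\<in>carrier Q. y) y1 = \<zero>\<^bsub>F Q\<^esub>"
    by (rule F_zero[OF Q Q id _ y1(1)]) (simp add: Q0)
  ultimately have "\<epsilon> y1 = \<zero>" using \<epsilon>_zero_iff[OF y1(1)] by simp
  then show False using y1 by simp
qed

definition \<theta> :: "'s \<Rightarrow> 'u \<Rightarrow> 'u" where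
  "\<theta> s = f U U (pt U (i s))"

text \<open>\<open>\<theta>\<close> composes the bijection from \<open>S\<close> to the
  endomorphisms of \<open>U\<close> by left multiplication with the bijection given by full
  faithfulness. Additivity comes from \<open>F_plus\<close>, where the infinite universe
  enters.\<close>

lemma endo_ring_P: "endo_ring D P S \<theta>"
proof -
  have bij1: "bij_betw (\<lambda>s. pt U (i s)) (carrier S) (rmod_hom S U U)"
  proof (rule bij_betw_imageI)
    show "inj_on (\<lambda>s. pt U (i s)) (carrier S)"
    proof (rule inj_onI)
      fix s t assume st: "s \<in> carrier S" "t \<in> carrier S" "pt U (i s) = pt U (i t)"
      have "i s = i t" using fun_cong[OF st(3), of "i \<one>\<^bsub>S\<^esub>"]
        unfolding pt_one[OF U i_closed[OF st(1)]] pt_one[OF U i_closed[OF st(2)]] .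
      then show "s = t" using inj_onD[OF i_inj] st by blast
    qed
    show "(\<lambda>s. pt U (i s)) ` carrier S = rmod_hom S U U"
    proof (intro equalityI subsetI)
      fix h assume h: "h \<in> rmod_hom S U U"
      have "h (i \<one>\<^bsub>S\<^esub>) \<in> carrier U" using rmod_homD(2)[OF h] by (simp add: i_closed)
      then obtain s where s: "s \<in> carrier S" "h (i \<one>\<^bsub>S\<^esub>) = i s" by (rule U_cases)
      show "h \<in> (\<lambda>s. pt U (i s)) ` carrier S"
        using pt_unique[OF U h] s by (intro image_eqI[of _ _ s]) simp_all
    qed (auto intro: pt_hom[OF U] i_closed)
  qed
  have bij2: "bij_betw (f U U) (rmod_hom S U U) (rmod_hom D P P)"
  proof (rule bij_betw_imageI)
    show "inj_on (f U U) (rmod_hom S U U)" by (rule inj_onI) (rule faithful[OF U U])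
    show "f U U ` rmod_hom S U U = rmod_hom D P P"
    proof (intro equalityI subsetI)
      fix k assume "k \<in> rmod_hom D P P"
      from full[OF U U this] show "k \<in> f U U ` rmod_hom S U U" by blast
    qed (auto intro: F_hom[OF U U])
  qed
  interpret P: right_module D P by (rule P)
  interpret U: right_module S U by (rule U)
  show ?thesis
  proof
    have "\<theta> = f U U \<circ> (\<lambda>s. pt U (i s))" by (simp add: \<theta>_def fun_eq_iff)
    then show "bij_betw \<theta> (carrier S) (rmod_hom D P P)" using bij_betw_trans[OF bij1 bij2] by simp
    fix s t p assume st: "s \<in> carrier S" "t \<in> carrier S" and p: "p \<in> carrier P"
    note hs = pt_hom[OF U i_closed[OF st(1)]] and ht = pt_hom[OF U i_closed[OF st(2)]]
    have hst: "pt U (i (s \<otimes>\<^bsub>S\<^esub> t)) \<in> rmod_hom S U U" "pt U (i (s \<oplus>\<^bsub>S\<^esub> t)) \<in> rmod_hom S U U"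
      using st by (simp_all add: pt_hom[OF U] i_closed)
    show "\<theta> (s \<otimes>\<^bsub>S\<^esub> t) p = \<theta> s (\<theta> t p)"
      unfolding \<theta>_def
    proof (rule F_comp[OF U U U ht hs hst(1) _ p])
      fix u assume "u \<in> carrier U"
      then obtain r where "r \<in> carrier S" "u = i r" by (rule U_cases)
      then show "pt U (i (s \<otimes>\<^bsub>S\<^esub> t)) u = pt U (i s) (pt U (i t) u)"
        using st by (simp add: pt_i U_smult S.m_assoc)
    qed
    show "\<theta> (s \<oplus>\<^bsub>S\<^esub> t) p = \<theta> s p \<oplus>\<^bsub>P\<^esub> \<theta> t p"
      unfolding \<theta>_def
    proof (rule F_plus[OF infinite_univ U U hs ht hst(2) _ p])
      fix u assume "u \<in> carrier U"
      then obtain r where "r \<in> carrier S" "u = i r" by (rule U_cases)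
      then show "pt U (i (s \<oplus>\<^bsub>S\<^esub> t)) u = pt U (i s) u \<oplus>\<^bsub>U\<^esub> pt U (i t) u"
        using st by (simp add: pt_i U_smult U_add S.l_distr)
    qed
  qed (use functionals_separate P_nonzero in blast)+
qed

end

section \<open>The converse implications and the conclusion\<close>

lemma C4_star_if_iso_domain:
  assumes D: "domain D" and S: "ring S" and iso: "S \<simeq> D"
  shows "right_C4_star_ring S"
proof -
  interpret S: ring S by fact
  interpret D: domain D by fact
  interpret SS: right_module S "regular_right_module S" by (rule regular_right_module[OF S])
  obtain \<phi> where \<phi>: "\<phi> \<in> ring_hom S D" "inj_on \<phi> (carrier S)"
    using iso by (auto simp: is_ring_iso_def ring_iso_def bij_betw_def)
  have \<phi>0: "\<phi> \<zero>\<^bsub>S\<^esub> = \<zero>\<^bsub>D\<^esub>"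
    by (rule ring_hom_zero[OF \<phi>(1) S D.ring_axioms])
  \<comment> \<open>Absence of zero divisors, and then commutativity, are pulled back to
    \<open>S\<close> along the injective \<open>\<phi>\<close>.\<close>
  have integral: "x = \<zero>\<^bsub>S\<^esub> \<or> y = \<zero>\<^bsub>S\<^esub>"
    if xy: "x \<in> carrier S" "y \<in> carrier S" "x \<otimes>\<^bsub>S\<^esub> y = \<zero>\<^bsub>S\<^esub>" for x y
  proof -
    have "\<phi> x \<otimes>\<^bsub>D\<^esub> \<phi> y = \<zero>\<^bsub>D\<^esub>" using ring_hom_mult[OF \<phi>(1) xy(1,2)] xy(3) \<phi>0 by simp
    then have "\<phi> x = \<phi> \<zero>\<^bsub>S\<^esub> \<or> \<phi> y = \<phi> \<zero>\<^bsub>S\<^esub>"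
      using D.integral ring_hom_closed[OF \<phi>(1)] xy \<phi>0 by simp
    then show ?thesis using \<phi>(2) xy by (auto simp: inj_on_def)
  qed
  have comm: "x \<otimes>\<^bsub>S\<^esub> y = y \<otimes>\<^bsub>S\<^esub> x" if xy: "x \<in> carrier S" "y \<in> carrier S" for x y
  proof -
    have "\<phi> (x \<otimes>\<^bsub>S\<^esub> y) = \<phi> (y \<otimes>\<^bsub>S\<^esub> x)"
      using ring_hom_mult[OF \<phi>(1)] ring_hom_closed[OF \<phi>(1)] xy D.m_comm by simp
    then show ?thesis using \<phi>(2) xy by (auto simp: inj_on_def)
  qed
  show ?thesis
    unfolding right_C4_star_ring_def C4_star_module_def C4_module_def
  proof (intro allI impI)
    fix N A B f
    assume N: "submodule N S (regular_right_module S)"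
      and "internal_direct_sum S (regular_right_module S\<lparr>carrier := N\<rparr>) A B"
      and f: "f \<in> rmod_hom S (regular_right_module S\<lparr>carrier := N, carrier := A\<rparr>)
        (regular_right_module S\<lparr>carrier := N, carrier := B\<rparr>)"
    note AB = SS.internal_direct_sum_subD[OF N this(2)]
    have A: "A \<subseteq> carrier S" "\<zero>\<^bsub>S\<^esub> \<in> A" and B: "B \<subseteq> carrier S" "\<zero>\<^bsub>S\<^esub> \<in> B"
      using AB(1,3) by (auto simp: SS.submodule_iff)
    have modA: "right_module S (regular_right_module S\<lparr>carrier := A\<rparr>)"
      and modB: "right_module S (regular_right_module S\<lparr>carrier := B\<rparr>)"
      using SS.submodule_right_module AB(1,3) by blast+
    have f0: "f \<zero>\<^bsub>S\<^esub> = \<zero>\<^bsub>S\<^esub>"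
      using right_module.rmod_hom_zero[OF modA modB] f by simp
    \<comment> \<open>By commutativity \<open>x * f x\<close> lies in both \<open>A\<close> and
      \<open>B\<close>, so it is zero and one factor vanishes; if that factor is \<open>x\<close>,
      then \<open>f x = 0\<close> as well.\<close>
    have "f x = \<zero>\<^bsub>S\<^esub>" if x: "x \<in> A" for x
    proof -
      have fx: "f x \<in> B" using rmod_homD(2)[OF f] x by simp
      have "x \<otimes>\<^bsub>S\<^esub> f x \<in> A" using AB(1) x fx B by (auto simp: SS.submodule_iff)
      moreover have "f x \<otimes>\<^bsub>S\<^esub> x \<in> B" using AB(3) x fx A by (auto simp: SS.submodule_iff)
      moreover have "x \<otimes>\<^bsub>S\<^esub> f x = f x \<otimes>\<^bsub>S\<^esub> x"
        using comm subsetD[OF A(1) x] subsetD[OF B(1) fx] .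
      ultimately have "x \<otimes>\<^bsub>S\<^esub> f x \<in> A \<inter> B" by simp
      then have "x \<otimes>\<^bsub>S\<^esub> f x = \<zero>\<^bsub>S\<^esub>" using AB(5) by simp
      then show ?thesis using integral[of x "f x"] x fx A B f0 by auto
    qed
    then have "f ` A = {\<zero>\<^bsub>S\<^esub>}" using A(2) by auto
    then show "direct_summand S (regular_right_module S\<lparr>carrier := N, carrier := B\<rparr>) (f ` A)"
      using right_module.direct_summand_zero[OF modB] by simp
  qed
qed

lemma C4_if_C4_star:
  assumes "ring S" "right_C4_star_ring S"
  shows "right_C4_ring S"
proof -
  interpret SS: right_module S "regular_right_module S" by (rule regular_right_module[OF assms(1)])
  have "C4_module S (regular_right_module S\<lparr>carrier := carrier S\<rparr>)"
    using assms(2) SS.submodule_self by (simp add: right_C4_star_ring_def C4_star_module_def)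
  moreover have "regular_right_module S\<lparr>carrier := carrier S\<rparr> = regular_right_module S"
    by (simp add: regular_right_module_def)
  ultimately show ?thesis by (simp add: right_C4_ring_def)
qed

theorem theorem8p5:
  fixes D :: "('d, 'x) ring_scheme" and S :: "('s, 'y) ring_scheme"
  assumes "dedekind_domain D" and "\<not> field D"
    and "ring S"
    and "infinite (UNIV :: 'u set)"
    and "carrier D \<lesssim> (UNIV :: 'u set)" and "carrier S \<lesssim> (UNIV :: 'u set)"
    and "morita_equivalent TYPE('u) S D"
  shows "(right_C4_ring S \<longleftrightarrow> right_C4_star_ring S) \<and>
    (right_C4_star_ring S \<longleftrightarrow> strongly_right_C4_star_ring S) \<and>
    (strongly_right_C4_star_ring S \<longleftrightarrow> S \<simeq> D) \<and>
    right_semi_weak_CS_ring S"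
proof -
  interpret D: dedekind_domain D by fact
  interpret S: ring S by fact
  obtain F :: "('s, 'u, 'd) rmod_objmap" and f G g \<eta> \<epsilon> where
    F: "rmod_functor S D F f" and G: "rmod_functor D S G g" and
    \<eta>: "rmod_nat_iso S S (\<lambda>M. M) (\<lambda>M N h. h) (\<lambda>M. G (F M)) (\<lambda>M N h. g (F M) (F N) (f M N h)) \<eta>" and
    \<epsilon>: "rmod_nat_iso D D (\<lambda>M. F (G M)) (\<lambda>M N h. f (G M) (G N) (g M N h)) (\<lambda>M. M) (\<lambda>M N h. h) \<epsilon>"
    using assms(7) unfolding morita_equivalent_def by blast
  obtain i :: "'s \<Rightarrow> 'u" where i: "inj_on i (carrier S)" using assms(6) by (auto simp: lepoll_def)
  obtain j :: "'d \<Rightarrow> 'u" where j: "inj_on j (carrier (regular_right_module D))"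
    using assms(5) by (auto simp: lepoll_def)
  \<comment> \<open>A copy of the regular module of \<open>D\<close> inside the universe. Its
    preimage is \<open>G V\<close>, and \<open>\<epsilon> V\<close> followed by the inverse of
    \<open>j\<close> identifies \<open>F (G V)\<close> with the regular module.\<close>
  define V where "V = image_module j (regular_right_module D)"
  note V = image_module_inj[OF regular_right_module[OF D.ring_axioms] j, folded V_def]
  let ?\<kappa> = "\<lambda>u\<in>j ` carrier (regular_right_module D). inv_into (carrier (regular_right_module D)) j u"
  have \<epsilon>V: "\<epsilon> V \<in> rmod_iso D (F (G V)) V" using \<epsilon> V(1) by (simp add: rmod_nat_iso_def)
  have FGV: "right_module D (F (G V))" and GV: "right_module S (G V)"
    using F G V(1) by (simp_all add: rmod_functor_def)
  have "bij_betw ?\<kappa> (carrier V) (carrier D)"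
    using bij_betw_inv_into[OF inj_on_imp_bij_betw[OF j]] by (simp add: V_def)
  then have "compose (carrier (F (G V))) ?\<kappa> (\<epsilon> V) \<in> rmod_iso D (F (G V)) (regular_right_module D)"
    using \<epsilon>V rmod_hom_compose[OF _ V(3) FGV] unfolding rmod_iso_def
    by (auto intro: bij_betw_compose)
  then interpret regular_preimage D S F f i "G V" "compose (carrier (F (G V))) ?\<kappa> (\<epsilon> V)"
    using full_faithful_if_equivalence[OF F G \<eta> \<epsilon>] assms(4) i GV
    by (intro regular_preimage.intro regular_preimage_axioms.intro D.domain_axioms S.ring_axioms)
  interpret endo_ring D P S \<theta> by (rule endo_ring_P)
  interpret dedekind_endo_ring D P S \<theta> ..
  have "right_semi_weak_CS_ring S" using semi_weak_CS assms(2) by blast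
  moreover have "S \<simeq> D" if "right_C4_ring S" using iso_if_C4 assms(2) that by blast
  moreover have "right_C4_star_ring S" if "S \<simeq> D"
    using C4_star_if_iso_domain[OF D.domain_axioms assms(3) that] .
  moreover have "right_C4_ring S" if "right_C4_star_ring S" using C4_if_C4_star assms(3) that .
  moreover have "strongly_right_C4_star_ring S \<longleftrightarrow> right_C4_star_ring S \<and> right_semi_weak_CS_ring S"
    by (simp add: strongly_right_C4_star_ring_def strongly_C4_star_module_def right_C4_star_ring_def
        right_semi_weak_CS_ring_def)
  ultimately show ?thesis by blast
qed

end
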